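(* Let $k$ be a field and let $R=kQ_R/I_R$ be a bound quiver algebra with orthogonal idempotents $e,e'_1,e'_2$, each a sum of primitive idempotents corresponding to vertices of $Q_R$, such that $1_R=e'_1+e+e'_2$ and $e'_1Re'_2=e'_2Re'_1=0$. Let $e_i=e'_i+e$, $A_i=e_iRe_i=kQ_{A_i}/I_i$ for $i=1,2$ and $C=eRe=kQ_C/I_C$. Assume that $A_1$ and $A_2$ admit semi-normed bases. Then, for each abelian group $G$, there exists a long exact sequence of simplicial cohomology groups $$\cdots\to{\rm SH}^n(R,G)\to{\rm SH}^n(A_1,G)\oplus{\rm SH}^n(A_2,G)\to{\rm SH}^n(C,G)\to{\rm SH}^{n+1}(R,G)\to\cdots .$$
   Context: Paths are composed left to right; a bound quiver $(Q,I)$ is a quiver with an admissible ideal $I$ of $kQ$ ($F^m\subseteq I\subseteq F^2$ for some $m\ge2$, $F$ the ideal generated by the arrows); $\varepsilon_x$ is the idempotent of the vertex $x$. $Q_C$, $Q_{A_i}$ are the full subquivers of $Q_R$ on the vertices occurring in $e$, $e_i$, and $I_C=kQ_C\cap I_R$, $I_i=kQ_{A_i}\cap I_R$. Let $\Lambda=kQ/I$. For vertices $x,y$ let ${}_y\mathbb B_x$ be a $k$-basis of $\varepsilon_x\Lambda\varepsilon_y$ and $\mathbb B=\bigcup_{x,y}{}_y\mathbb B_x$. $\mathbb B$ is a \emph{semi-normed basis} of $\Lambda$ if (a) $\varepsilon_x\in{}_x\mathbb B_x$ for every vertex $x$; (b) $\alpha+I\in{}_y\mathbb B_x$ for every arrow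 $\alpha:x\to y$; (c) for $\sigma,\sigma'\in\mathbb B$, either $\sigma\sigma'=0$ or $\sigma\sigma'=\lambda_{\sigma,\sigma'}b(\sigma,\sigma')$ with $0\ne\lambda_{\sigma,\sigma'}\in k$ and $b(\sigma,\sigma')\in\mathbb B$. Given a semi-normed basis $\mathbb B$, the chain complex ${\rm SC}_\bullet(\Lambda)$ is: ${\rm SC}_0(\Lambda)$ and ${\rm SC}_1(\Lambda)$ are the free abelian groups on $Q_0$ and $\mathbb B$; for $n\ge2$, ${\rm SC}_n(\Lambda)$ is the free abelian group on the $n$-tuples $(\sigma_1,\dots,\sigma_n)\in\mathbb B^n$ with $\sigma_1\cdots\sigma_n\ne0$ and no $\sigma_i$ equal to a stationary idempotent $\varepsilon_x$. The differential is $d_1(\sigma)=y-x$ for $\sigma\in{}_y\mathbb B_x$, and for $n\ge2$, $d_n(\sigma_1,\dots,\sigma_n)=(\sigma_2,\dots,\sigma_n)+\sum_{j=1}^{n-1}(-1)^j(\sigma_1,\dots,b(\sigma_j,\sigma_{j+1}),\dots,\sigma_n)+(-1)^n(\sigma_1,\dots,\sigma_{n-1})$. ${\rm SH}^n(\Lambda,G)$ (with respect to $\mathbb B$) is the $n$th cohomology group of the complex ${\rm Hom}_{\mathbb Z}({\rm SC}_\bullet(\Lambda),G)$. Bases used: if $\mathbb B_1$, $\mathbb B_2$ are semi-normed bases of $A_1$, $A_2$, the simplicial cohomology groups of $A_1,A_2,R,C$ are taken with respect to $\mathbb B_1$, $\mathbb B_2$, $\mathbb B_R=\mathbb B_1\cup\mathbb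 B_2$ and $\mathbb B_C=\mathbb B_1\cap\mathbb B_2$ respectively; the paper asserts that $\mathbb B_R$ and $\mathbb B_C$ are then semi-normed bases of $R$ and $C$.
   Formalization: For arbitrary semi-normed bases B_1, B_2 their union and intersection need not be semi-normed bases of R and C (αβ in B_1, λαβ in B_2); B_2 is therefore replaced by a rescaling by nonzero scalars, equal to B_2 itself when B_1 and B_2 agree on C. *)

theory Defs
  imports
    "Graph_Theory.Arc_Walk"
    "Graph_Theory.Digraph_Component"
    "HOL-Algebra.Module"
    "HOL-Algebra.QuotRing"
    "HOL-Algebra.Ideal_Product"
    "HOL-Algebra.Free_Abelian_Groups"
begin

section \<open>Path algebras and bound quivers\<close>

text \<open>
  A path is a triple of its source, its list of arrows (in order of traversal) and its target, so
  that the stationary path at \<open>x\<close> is \<open>(x, [], x)\<close>.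
\<close>

type_synonym ('v, 'a) qpath = "'v \<times> 'a list \<times> 'v"

definition paths :: "('v, 'a) pre_digraph \<Rightarrow> ('v, 'a) qpath set" where
  "paths Q = {(x, p, y). pre_digraph.awalk Q x p y}"

definition stationary :: "'v \<Rightarrow> ('v, 'a) qpath" where
  "stationary x = (x, [], x)"

definition arrow_path :: "('v, 'a) pre_digraph \<Rightarrow> 'a \<Rightarrow> ('v, 'a) qpath" where
  "arrow_path Q a = (tail Q a, [a], head Q a)"

text \<open>Product of two paths in the path algebra: composition from left to right, or zero.\<close>

fun path_mult :: "('v, 'a) qpath \<Rightarrow> ('v, 'a) qpath \<Rightarrow> ('v, 'a) qpath \<Rightarrow>\<^sub>0 'k::field" where
  "path_mult (x, p, y) (y', q, z) = (if y = y' then Poly_Mapping.single (x, p @ q, z) 1 else 0)"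

definition pa_smult :: "'k::field \<Rightarrow> ('b \<Rightarrow>\<^sub>0 'k) \<Rightarrow> ('b \<Rightarrow>\<^sub>0 'k)" where
  "pa_smult c f = Poly_Mapping.map ((*) c) f"

definition pa_mult ::
  "(('v, 'a) qpath \<Rightarrow>\<^sub>0 'k::field) \<Rightarrow> (('v, 'a) qpath \<Rightarrow>\<^sub>0 'k) \<Rightarrow> (('v, 'a) qpath \<Rightarrow>\<^sub>0 'k)" where
  "pa_mult f g =
     (\<Sum>u\<in>Poly_Mapping.keys f. \<Sum>w\<in>Poly_Mapping.keys g.
        pa_smult (Poly_Mapping.lookup f u * Poly_Mapping.lookup g w) (path_mult u w))"

text \<open>
  The library's record of modules is used as the signature of a \<open>k\<close>-algebra (the ring operations
  together with a scalar multiplication); the scalars form the field type \<open>'k\<close>.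
\<close>

definition path_algebra ::
  "('v, 'a) pre_digraph \<Rightarrow> ('k::field, ('v, 'a) qpath \<Rightarrow>\<^sub>0 'k) module" where
  "path_algebra Q =
     \<lparr>carrier = {f. Poly_Mapping.keys f \<subseteq> paths Q},
      monoid.mult = pa_mult,
      one = (\<Sum>x\<in>verts Q. Poly_Mapping.single (stationary x) 1),
      ring.zero = 0,
      ring.add = (+),
      smult = pa_smult\<rparr>"

definition arrow_ideal ::
  "('v, 'a) pre_digraph \<Rightarrow> (('v, 'a) qpath \<Rightarrow>\<^sub>0 'k::field) set" where
  "arrow_ideal Q =
     Idl\<^bsub>path_algebra Q\<^esub> ((\<lambda>a. Poly_Mapping.single (arrow_path Q a) 1) ` arcs Q)"

primrec ideal_power :: "('r, 'm) ring_scheme \<Rightarrow> 'r set \<Rightarrow> nat \<Rightarrow> 'r set" where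
  "ideal_power A J 0 = carrier A"
| "ideal_power A J (Suc n) = ideal_prod A (ideal_power A J n) J"

definition admissible ::
  "('v, 'a) pre_digraph \<Rightarrow> (('v, 'a) qpath \<Rightarrow>\<^sub>0 'k::field) set \<Rightarrow> bool" where
  "admissible Q I \<longleftrightarrow>
     ideal I (path_algebra Q) \<and>
     (\<exists>m\<ge>2. ideal_power (path_algebra Q) (arrow_ideal Q) m \<subseteq> I) \<and>
     I \<subseteq> ideal_power (path_algebra Q) (arrow_ideal Q) 2"

text \<open>
  Finitely many vertices are needed for the path algebra to have an identity. Loops and multiple
  arrows are allowed.
\<close>

definition bound_quiver ::
  "('v, 'a) pre_digraph \<Rightarrow> (('v, 'a) qpath \<Rightarrow>\<^sub>0 'k::field) set \<Rightarrow> bool" where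
  "bound_quiver Q I \<longleftrightarrow> wf_digraph Q \<and> finite (verts Q) \<and> admissible Q I"

text \<open>The quotient ring \<open>kQ/I\<close>, whose elements are cosets, with its scalar multiplication.\<close>

definition bound_quiver_algebra ::
  "('v, 'a) pre_digraph \<Rightarrow> (('v, 'a) qpath \<Rightarrow>\<^sub>0 'k::field) set \<Rightarrow>
   ('k, (('v, 'a) qpath \<Rightarrow>\<^sub>0 'k) set) module" where
  "bound_quiver_algebra Q I =
     ring.extend (path_algebra Q Quot I)
       (module.fields (\<lambda>c X. set_add (path_algebra Q) I (pa_smult c ` X)))"

definition path_class ::
  "('v, 'a) pre_digraph \<Rightarrow> (('v, 'a) qpath \<Rightarrow>\<^sub>0 'k::field) set \<Rightarrow> ('v, 'a) qpath \<Rightarrow>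
   (('v, 'a) qpath \<Rightarrow>\<^sub>0 'k) set" where
  "path_class Q I u = I +>\<^bsub>path_algebra Q\<^esub> (Poly_Mapping.single u 1)"


section \<open>Corner algebras\<close>

definition orthogonal_elems :: "('r, 'm) ring_scheme \<Rightarrow> 'r \<Rightarrow> 'r \<Rightarrow> bool" where
  "orthogonal_elems A e f \<longleftrightarrow> e \<otimes>\<^bsub>A\<^esub> f = \<zero>\<^bsub>A\<^esub> \<and> f \<otimes>\<^bsub>A\<^esub> e = \<zero>\<^bsub>A\<^esub>"

definition peirce :: "('r, 'm) ring_scheme \<Rightarrow> 'r \<Rightarrow> 'r \<Rightarrow> 'r set" where
  "peirce A e f = {e \<otimes>\<^bsub>A\<^esub> a \<otimes>\<^bsub>A\<^esub> f | a. a \<in> carrier A}"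

definition corner :: "('r, 'm) ring_scheme \<Rightarrow> 'r \<Rightarrow> ('r, 'm) ring_scheme" where
  "corner A e = A\<lparr>carrier := peirce A e e, one := e\<rparr>"

definition restricted_ideal ::
  "('v, 'a) pre_digraph \<Rightarrow> (('v, 'a) qpath \<Rightarrow>\<^sub>0 'k::field) set \<Rightarrow> 'v set \<Rightarrow>
   (('v, 'a) qpath \<Rightarrow>\<^sub>0 'k) set" where
  "restricted_ideal Q I S = carrier (path_algebra (induce_subgraph Q S)) \<inter> I"

text \<open>
  The equality \<open>eRe = kQ\<^sub>S/I\<^sub>S\<close>, where \<open>Q\<^sub>S\<close> is the full subquiver of \<open>Q\<close> on the set \<open>S\<close> of the
  vertices occurring in \<open>e\<close> and \<open>I\<^sub>S = kQ\<^sub>S \<inter> I\<close>: the canonical map \<open>p + I\<^sub>S \<mapsto> p + I\<close> is an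
  isomorphism onto \<open>eRe\<close>. This is a genuine condition, since a path between vertices of \<open>S\<close> may
  pass through vertices outside \<open>S\<close>.
\<close>

definition corner_is_bound_quiver_algebra ::
  "('v, 'a) pre_digraph \<Rightarrow> (('v, 'a) qpath \<Rightarrow>\<^sub>0 'k::field) set \<Rightarrow> 'v set \<Rightarrow>
   (('v, 'a) qpath \<Rightarrow>\<^sub>0 'k) set \<Rightarrow> bool" where
  "corner_is_bound_quiver_algebra Q I S e \<longleftrightarrow>
     (\<lambda>X. set_add (path_algebra Q) I X)
       \<in> ring_iso (bound_quiver_algebra (induce_subgraph Q S) (restricted_ideal Q I S))
                  (corner (bound_quiver_algebra Q I) e)"


section \<open>Semi-normed bases\<close>

definition lin_comb :: "('k::field, 'r, 'm) module_scheme \<Rightarrow> ('r \<Rightarrow>\<^sub>0 'k) \<Rightarrow> 'r" where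
  "lin_comb A c = (\<Oplus>\<^bsub>A\<^esub>\<sigma>\<in>Poly_Mapping.keys c. Poly_Mapping.lookup c \<sigma> \<odot>\<^bsub>A\<^esub> \<sigma>)"

definition k_basis :: "('k::field, 'r, 'm) module_scheme \<Rightarrow> 'r set \<Rightarrow> 'r set \<Rightarrow> bool" where
  "k_basis A V B \<longleftrightarrow>
     B \<subseteq> V \<and>
     (\<forall>c. Poly_Mapping.keys c \<subseteq> B \<longrightarrow> lin_comb A c = \<zero>\<^bsub>A\<^esub> \<longrightarrow> c = 0) \<and>
     (\<forall>v\<in>V. \<exists>c. Poly_Mapping.keys c \<subseteq> B \<and> v = lin_comb A c)"

text \<open>
  Throughout, \<open>A\<close> is an algebra which is presented by the quiver \<open>Q\<close> through the map \<open>\<gamma>\<close> sending a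
  path to its class in \<open>A\<close>. This covers \<open>kQ/I\<close> itself as well as its corners, viewed as subsets of
  \<open>kQ/I\<close>, so that bases of different corners can be compared inside the same algebra. The basis of
  \<open>\<epsilon>\<^sub>x A \<epsilon>\<^sub>y\<close> is the intersection of \<open>B\<close> with that subspace.
\<close>

definition semi_normed_basis ::
  "('k::field, 'r, 'm) module_scheme \<Rightarrow> ('v, 'a) pre_digraph \<Rightarrow> (('v, 'a) qpath \<Rightarrow> 'r) \<Rightarrow>
   'r set \<Rightarrow> bool" where
  "semi_normed_basis A Q \<gamma> B \<longleftrightarrow>
     B \<subseteq> (\<Union>x\<in>verts Q. \<Union>y\<in>verts Q. peirce A (\<gamma> (stationary x)) (\<gamma> (stationary y))) \<and>
     (\<forall>x\<in>verts Q. \<forall>y\<in>verts Q.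
        k_basis A (peirce A (\<gamma> (stationary x)) (\<gamma> (stationary y)))
          (B \<inter> peirce A (\<gamma> (stationary x)) (\<gamma> (stationary y)))) \<and>
     (\<forall>x\<in>verts Q. \<gamma> (stationary x) \<in> B) \<and>
     (\<forall>a\<in>arcs Q. \<gamma> (arrow_path Q a) \<in> B) \<and>
     (\<forall>\<sigma>\<in>B. \<forall>\<sigma>'\<in>B. \<sigma> \<otimes>\<^bsub>A\<^esub> \<sigma>' = \<zero>\<^bsub>A\<^esub> \<or>
        (\<exists>c b. c \<noteq> 0 \<and> b \<in> B \<and> \<sigma> \<otimes>\<^bsub>A\<^esub> \<sigma>' = c \<odot>\<^bsub>A\<^esub> b))"

text \<open>The element is unique whenever \<open>B\<close> is a semi-normed basis and the product is nonzero.\<close>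

definition basis_product ::
  "('k::field, 'r, 'm) module_scheme \<Rightarrow> 'r set \<Rightarrow> 'r \<Rightarrow> 'r \<Rightarrow> 'r" where
  "basis_product A B \<sigma> \<sigma>' =
     (THE b. b \<in> B \<and> (\<exists>c. c \<noteq> 0 \<and> \<sigma> \<otimes>\<^bsub>A\<^esub> \<sigma>' = c \<odot>\<^bsub>A\<^esub> b))"

definition rescaling :: "('k::field, 'r, 'm) module_scheme \<Rightarrow> 'r set \<Rightarrow> 'r set \<Rightarrow> bool" where
  "rescaling A B B' \<longleftrightarrow> (\<exists>c. (\<forall>\<sigma>\<in>B. c \<sigma> \<noteq> 0) \<and> B' = (\<lambda>\<sigma>. c \<sigma> \<odot>\<^bsub>A\<^esub> \<sigma>) ` B)"


section \<open>Simplicial cohomology\<close>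

datatype ('v, 'r) sc_simplex = Vertex 'v | Tuple "'r list"

text \<open>Note that the stationary idempotents are excluded only in degrees at least two.\<close>

definition sc_simplices ::
  "('k::field, 'r, 'm) module_scheme \<Rightarrow> ('v, 'a) pre_digraph \<Rightarrow> (('v, 'a) qpath \<Rightarrow> 'r) \<Rightarrow>
   'r set \<Rightarrow> nat \<Rightarrow> ('v, 'r) sc_simplex set" where
  "sc_simplices A Q \<gamma> B n =
     (if n = 0 then Vertex ` verts Q
      else if n = 1 then {Tuple [\<sigma>] | \<sigma>. \<sigma> \<in> B}
      else {Tuple s | s. length s = n \<and> set s \<subseteq> B \<and>
              foldr (\<lambda>\<sigma> \<tau>. \<sigma> \<otimes>\<^bsub>A\<^esub> \<tau>) s \<one>\<^bsub>A\<^esub> \<noteq> \<zero>\<^bsub>A\<^esub> \<and>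
              set s \<inter> (\<lambda>x. \<gamma> (stationary x)) ` verts Q = {}})"

definition sc_chain_group ::
  "('k::field, 'r, 'm) module_scheme \<Rightarrow> ('v, 'a) pre_digraph \<Rightarrow> (('v, 'a) qpath \<Rightarrow> 'r) \<Rightarrow>
   'r set \<Rightarrow> nat \<Rightarrow> (('v, 'r) sc_simplex \<Rightarrow>\<^sub>0 int) monoid" where
  "sc_chain_group A Q \<gamma> B n = free_Abelian_group (sc_simplices A Q \<gamma> B n)"

text \<open>The endpoints \<open>(x, y)\<close> of an element of the basis of \<open>\<epsilon>\<^sub>x A \<epsilon>\<^sub>y\<close>.\<close>

definition endpoints ::
  "('k::field, 'r, 'm) module_scheme \<Rightarrow> ('v, 'a) pre_digraph \<Rightarrow> (('v, 'a) qpath \<Rightarrow> 'r) \<Rightarrow>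
   'r \<Rightarrow> 'v \<times> 'v" where
  "endpoints A Q \<gamma> \<sigma> =
     (THE (x, y). x \<in> verts Q \<and> y \<in> verts Q \<and>
        \<sigma> \<in> peirce A (\<gamma> (stationary x)) (\<gamma> (stationary y)))"

text \<open>
  Lists are indexed from zero, so \<open>s ! (j - 1)\<close> and \<open>s ! j\<close> are the \<open>j\<close>-th and \<open>(j+1)\<close>-st entries.
\<close>

fun sc_boundary_simplex ::
  "('k::field, 'r, 'm) module_scheme \<Rightarrow> ('v, 'a) pre_digraph \<Rightarrow> (('v, 'a) qpath \<Rightarrow> 'r) \<Rightarrow>
   'r set \<Rightarrow> ('v, 'r) sc_simplex \<Rightarrow> ('v, 'r) sc_simplex \<Rightarrow>\<^sub>0 int" where
  "sc_boundary_simplex A Q \<gamma> B (Vertex x) = 0"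
| "sc_boundary_simplex A Q \<gamma> B (Tuple s) =
     (if length s = 1 then
        frag_of (Vertex (snd (endpoints A Q \<gamma> (hd s)))) -
        frag_of (Vertex (fst (endpoints A Q \<gamma> (hd s))))
      else
        frag_of (Tuple (tl s)) +
        (\<Sum>j = 1..length s - 1. frag_cmul ((-1) ^ j)
           (frag_of (Tuple (take (j - 1) s @
              basis_product A B (s ! (j - 1)) (s ! j) # drop (j + 1) s)))) +
        frag_cmul ((-1) ^ length s) (frag_of (Tuple (butlast s))))"

definition sc_boundary ::
  "('k::field, 'r, 'm) module_scheme \<Rightarrow> ('v, 'a) pre_digraph \<Rightarrow> (('v, 'a) qpath \<Rightarrow> 'r) \<Rightarrow>
   'r set \<Rightarrow> (('v, 'r) sc_simplex \<Rightarrow>\<^sub>0 int) \<Rightarrow> ('v, 'r) sc_simplex \<Rightarrow>\<^sub>0 int" where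
  "sc_boundary A Q \<gamma> B = frag_extend (sc_boundary_simplex A Q \<gamma> B)"

text \<open>
  The group of homomorphisms into an abelian group with pointwise multiplication; homomorphisms
  are made extensional so that they are determined by their values on the carrier.
\<close>

definition hom_group :: "('c, 'm) monoid_scheme \<Rightarrow> ('g, 'n) monoid_scheme \<Rightarrow> ('c \<Rightarrow> 'g) monoid" where
  "hom_group M G =
     \<lparr>carrier = hom M G \<inter> extensional (carrier M),
      monoid.mult = (\<lambda>f g. \<lambda>x\<in>carrier M. f x \<otimes>\<^bsub>G\<^esub> g x),
      one = (\<lambda>x\<in>carrier M. \<one>\<^bsub>G\<^esub>)\<rparr>"

definition sc_cochain_group ::
  "('k::field, 'r, 'm) module_scheme \<Rightarrow> ('v, 'a) pre_digraph \<Rightarrow> (('v, 'a) qpath \<Rightarrow> 'r) \<Rightarrow>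
   'r set \<Rightarrow> ('g, 'n) monoid_scheme \<Rightarrow> nat \<Rightarrow> ((('v, 'r) sc_simplex \<Rightarrow>\<^sub>0 int) \<Rightarrow> 'g) monoid" where
  "sc_cochain_group A Q \<gamma> B G n = hom_group (sc_chain_group A Q \<gamma> B n) G"

definition sc_coboundary ::
  "('k::field, 'r, 'm) module_scheme \<Rightarrow> ('v, 'a) pre_digraph \<Rightarrow> (('v, 'a) qpath \<Rightarrow> 'r) \<Rightarrow>
   'r set \<Rightarrow> nat \<Rightarrow> ((('v, 'r) sc_simplex \<Rightarrow>\<^sub>0 int) \<Rightarrow> 'g) \<Rightarrow>
   (('v, 'r) sc_simplex \<Rightarrow>\<^sub>0 int) \<Rightarrow> 'g" where
  "sc_coboundary A Q \<gamma> B n f =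
     compose (carrier (sc_chain_group A Q \<gamma> B (Suc n))) f (sc_boundary A Q \<gamma> B)"

definition sc_cocycles ::
  "('k::field, 'r, 'm) module_scheme \<Rightarrow> ('v, 'a) pre_digraph \<Rightarrow> (('v, 'a) qpath \<Rightarrow> 'r) \<Rightarrow>
   'r set \<Rightarrow> ('g, 'n) monoid_scheme \<Rightarrow> nat \<Rightarrow> ((('v, 'r) sc_simplex \<Rightarrow>\<^sub>0 int) \<Rightarrow> 'g) set" where
  "sc_cocycles A Q \<gamma> B G n =
     kernel (sc_cochain_group A Q \<gamma> B G n) (sc_cochain_group A Q \<gamma> B G (Suc n))
       (sc_coboundary A Q \<gamma> B n)"

definition sc_coboundaries ::
  "('k::field, 'r, 'm) module_scheme \<Rightarrow> ('v, 'a) pre_digraph \<Rightarrow> (('v, 'a) qpath \<Rightarrow> 'r) \<Rightarrow>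
   'r set \<Rightarrow> ('g, 'n) monoid_scheme \<Rightarrow> nat \<Rightarrow> ((('v, 'r) sc_simplex \<Rightarrow>\<^sub>0 int) \<Rightarrow> 'g) set" where
  "sc_coboundaries A Q \<gamma> B G n =
     (case n of
        0 \<Rightarrow> {\<one>\<^bsub>sc_cochain_group A Q \<gamma> B G 0\<^esub>}
      | Suc m \<Rightarrow> sc_coboundary A Q \<gamma> B m ` carrier (sc_cochain_group A Q \<gamma> B G m))"

text \<open>\<open>SH\<^sup>n(A, G)\<close> with respect to the semi-normed basis \<open>B\<close>.\<close>

definition SH ::
  "('k::field, 'r, 'm) module_scheme \<Rightarrow> ('v, 'a) pre_digraph \<Rightarrow> (('v, 'a) qpath \<Rightarrow> 'r) \<Rightarrow>
   'r set \<Rightarrow> ('g, 'n) monoid_scheme \<Rightarrow> nat \<Rightarrow>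
   ((('v, 'r) sc_simplex \<Rightarrow>\<^sub>0 int) \<Rightarrow> 'g) set monoid" where
  "SH A Q \<gamma> B G n =
     ((sc_cochain_group A Q \<gamma> B G n)\<lparr>carrier := sc_cocycles A Q \<gamma> B G n\<rparr>)
       Mod (sc_coboundaries A Q \<gamma> B G n)"

text \<open>
  Exactness of \<open>\<cdots> \<rightarrow> X\<^sub>n \<rightarrow> Y\<^sub>n \<rightarrow> Z\<^sub>n \<rightarrow> X\<^sub>n\<^sub>+\<^sub>1 \<rightarrow> \<cdots>\<close> at every place. The terms of negative degree
  are zero, so the sequence begins with \<open>0 \<rightarrow> X\<^sub>0\<close>.
\<close>

definition long_exact_sequence ::
  "(nat \<Rightarrow> 'x monoid) \<Rightarrow> (nat \<Rightarrow> 'y monoid) \<Rightarrow> (nat \<Rightarrow> 'z monoid) \<Rightarrow> bool" where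
  "long_exact_sequence X Y Z \<longleftrightarrow>
     (\<exists>f g \<delta>.
        (\<forall>n. group_hom (X n) (Y n) (f n) \<and>
             group_hom (Y n) (Z n) (g n) \<and>
             group_hom (Z n) (X (Suc n)) (\<delta> n) \<and>
             f n ` carrier (X n) = kernel (Y n) (Z n) (g n) \<and>
             g n ` carrier (Y n) = kernel (Z n) (X (Suc n)) (\<delta> n) \<and>
             \<delta> n ` carrier (Z n) = kernel (X (Suc n)) (Y (Suc n)) (f (Suc n))) \<and>
        kernel (X 0) (Y 0) (f 0) = {\<one>\<^bsub>X 0\<^esub>})"

end

theory Submission
  imports Defs
begin

text \<open>
  Write \<open>T\<^sub>i = S\<^sub>i' \<union> S\<close> for the set of vertices of \<open>A\<^sub>i\<close>. Since every basis element of \<open>C\<close> is a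
  multiple of the class of a path inside the quiver of \<open>C\<close>, and every such nonzero class is a
  multiple of an element of either basis, \<open>B\<^sub>1\<close> and \<open>B\<^sub>2\<close> agree on \<open>C\<close> up to scalars. Replacing
  the elements of \<open>B\<^sub>2\<close> in \<open>C\<close> by those of \<open>B\<^sub>1\<close> makes the bases agree there. A tuple of elements
  of \<open>B\<^sub>1 \<union> B\<^sub>2\<close> with nonzero product cannot visit both a vertex of \<open>S\<^sub>1'\<close> and one of \<open>S\<^sub>2'\<close>, as a
  subproduct would lie in \<open>e\<^sub>1'Re\<^sub>2' = 0\<close> or \<open>e\<^sub>2'Re\<^sub>1' = 0\<close>. So the simplices of \<open>R\<close> are the union of
  those of \<open>A\<^sub>1\<close> and \<open>A\<^sub>2\<close>, and those of \<open>C\<close> are their intersection, with the same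
  boundaries. The cochain complexes thus form a pullback square with surjective restriction maps,
  and the sequence is its Mayer--Vietoris sequence.
\<close>

section \<open>Cochain complexes\<close>

text \<open>
  Homomorphisms of quotient groups are induced by relations rather than functions, because the
  connecting homomorphism involves a choice of lifts.
\<close>

locale coset_relation = M: comm_group M + N: comm_group N
  for M :: "('a, 'm) monoid_scheme" and N :: "('b, 'n) monoid_scheme" +
  fixes B D \<rho>
  assumes B: "subgroup B M" and D: "subgroup D N"
    and total: "x \<in> carrier M \<Longrightarrow> \<exists>y. \<rho> x y"
    and dom: "\<rho> x y \<Longrightarrow> x \<in> carrier M" and ran: "\<rho> x y \<Longrightarrow> y \<in> carrier N"
    and mult: "\<rho> x y \<Longrightarrow> \<rho> x' y' \<Longrightarrow> \<rho> (x \<otimes>\<^bsub>M\<^esub> x') (y \<otimes>\<^bsub>N\<^esub> y')"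
    and inv: "\<rho> x y \<Longrightarrow> \<rho> (inv\<^bsub>M\<^esub> x) (inv\<^bsub>N\<^esub> y)"
    and cong: "\<rho> x y \<Longrightarrow> x \<in> B \<Longrightarrow> y \<in> D"
begin

definition coset_map :: "'a set \<Rightarrow> 'b set" where
  "coset_map X = (\<Union>x\<in>X. \<Union>y\<in>{y. \<rho> x y}. D #>\<^bsub>N\<^esub> y)"

lemma coset_map_coset:
  assumes "\<rho> x y"
  shows "coset_map (B #>\<^bsub>M\<^esub> x) = D #>\<^bsub>N\<^esub> y"
proof -
  have x: "x \<in> carrier M" and y: "y \<in> carrier N" using assms dom ran by auto
  have 1: "D #>\<^bsub>N\<^esub> y' = D #>\<^bsub>N\<^esub> y" if "x' \<in> B #>\<^bsub>M\<^esub> x" "\<rho> x' y'" for x' y'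
  proof -
    have "x' \<otimes>\<^bsub>M\<^esub> inv\<^bsub>M\<^esub> x \<in> B"
      using subgroup.rcos_module_imp[OF B M.is_group x that(1)] .
    then have "y' \<otimes>\<^bsub>N\<^esub> inv\<^bsub>N\<^esub> y \<in> D"
      using cong mult inv assms that(2) by blast
    then have "y' \<in> D #>\<^bsub>N\<^esub> y"
      using subgroup.rcos_module[OF D N.is_group y] ran that(2) by blast
    then show ?thesis
      using D y N.repr_independence by blast
  qed
  have "x \<in> B #>\<^bsub>M\<^esub> x" using B x by (simp add: M.rcos_self)
  then show ?thesis unfolding coset_map_def using 1 assms by blast
qed

lemma coset_map_hom: "group_hom (M Mod B) (N Mod D) coset_map"
proof -
  have nB: "B \<lhd> M" and nD: "D \<lhd> N"
    using B D M.subgroup_imp_normal N.subgroup_imp_normal by auto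
  have "coset_map \<in> hom (M Mod B) (N Mod D)"
  proof (rule homI)
    fix X assume "X \<in> carrier (M Mod B)"
    then obtain x where x: "x \<in> carrier M" "X = B #>\<^bsub>M\<^esub> x"
      by (auto simp: FactGroup_def RCOSETS_def)
    then obtain y where "\<rho> x y" using total by blast
    then show "coset_map X \<in> carrier (N Mod D)"
      using x ran coset_map_coset by (auto simp: FactGroup_def RCOSETS_def)
  next
    fix X X' assume "X \<in> carrier (M Mod B)" "X' \<in> carrier (M Mod B)"
    then obtain x x' where x: "x \<in> carrier M" "X = B #>\<^bsub>M\<^esub> x" "x' \<in> carrier M" "X' = B #>\<^bsub>M\<^esub> x'"
      by (auto simp: FactGroup_def RCOSETS_def)
    then obtain y y' where y: "\<rho> x y" "\<rho> x' y'" using total by blast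
    have "X \<otimes>\<^bsub>M Mod B\<^esub> X' = B #>\<^bsub>M\<^esub> (x \<otimes>\<^bsub>M\<^esub> x')"
      using x nB by (simp add: FactGroup_def normal.rcos_sum)
    moreover have "(D #>\<^bsub>N\<^esub> y) \<otimes>\<^bsub>N Mod D\<^esub> (D #>\<^bsub>N\<^esub> y') = D #>\<^bsub>N\<^esub> (y \<otimes>\<^bsub>N\<^esub> y')"
      using y ran nD by (simp add: FactGroup_def normal.rcos_sum)
    ultimately show "coset_map (X \<otimes>\<^bsub>M Mod B\<^esub> X') = coset_map X \<otimes>\<^bsub>N Mod D\<^esub> coset_map X'"
      using x y mult by (simp add: coset_map_coset)
  qed
  then show ?thesis
    using nB nD by (simp add: group_hom_def group_hom_axioms_def normal.factorgroup_is_group)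
qed

end

definition cocycles :: "(nat \<Rightarrow> 'a monoid) \<Rightarrow> (nat \<Rightarrow> 'a \<Rightarrow> 'a) \<Rightarrow> nat \<Rightarrow> 'a set" where
  "cocycles K d n = kernel (K n) (K (Suc n)) (d n)"

definition coboundaries :: "(nat \<Rightarrow> 'a monoid) \<Rightarrow> (nat \<Rightarrow> 'a \<Rightarrow> 'a) \<Rightarrow> nat \<Rightarrow> 'a set" where
  "coboundaries K d n = (case n of 0 \<Rightarrow> {\<one>\<^bsub>K 0\<^esub>} | Suc m \<Rightarrow> d m ` carrier (K m))"

definition cocycle_group :: "(nat \<Rightarrow> 'a monoid) \<Rightarrow> (nat \<Rightarrow> 'a \<Rightarrow> 'a) \<Rightarrow> nat \<Rightarrow> 'a monoid" where
  "cocycle_group K d n = (K n)\<lparr>carrier := cocycles K d n\<rparr>"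

definition cohomology :: "(nat \<Rightarrow> 'a monoid) \<Rightarrow> (nat \<Rightarrow> 'a \<Rightarrow> 'a) \<Rightarrow> nat \<Rightarrow> 'a set monoid" where
  "cohomology K d n = cocycle_group K d n Mod coboundaries K d n"

locale cochain_complex =
  fixes K :: "nat \<Rightarrow> 'a monoid" and d :: "nat \<Rightarrow> 'a \<Rightarrow> 'a"
  assumes comm: "comm_group (K n)"
    and d_hom: "d n \<in> hom (K n) (K (Suc n))"
    and d_d: "x \<in> carrier (K n) \<Longrightarrow> d (Suc n) (d n x) = \<one>\<^bsub>K (Suc (Suc n))\<^esub>"
begin

lemma grp: "group (K n)"
  using comm comm_group_def by blast

lemma d_group_hom: "group_hom (K n) (K (Suc n)) (d n)"
  by (simp add: group_hom_def group_hom_axioms_def grp d_hom)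

lemma cocycles_iff: "x \<in> cocycles K d n \<longleftrightarrow> x \<in> carrier (K n) \<and> d n x = \<one>\<^bsub>K (Suc n)\<^esub>"
  by (simp add: cocycles_def kernel_def)

lemma subgroup_cocycles: "subgroup (cocycles K d n) (K n)"
  unfolding cocycles_def by (rule group_hom.subgroup_kernel[OF d_group_hom])

lemma subgroup_coboundaries: "subgroup (coboundaries K d n) (K n)"
proof (cases n)
  case 0
  then show ?thesis by (simp add: coboundaries_def group.triv_subgroup grp)
next
  case (Suc m)
  then show ?thesis
    using group_hom.img_is_subgroup[OF d_group_hom[of m]] by (simp add: coboundaries_def)
qed

lemma coboundaries_subset: "coboundaries K d n \<subseteq> cocycles K d n"
proof (cases n)
  case 0
  then show ?thesis
    using subgroup.one_closed[OF subgroup_cocycles] by (simp add: coboundaries_def)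
next
  case (Suc m)
  then show ?thesis
    using d_d hom_in_carrier[OF d_hom] by (auto simp: coboundaries_def cocycles_iff)
qed

lemma cocycle_group_simps [simp]:
  "carrier (cocycle_group K d n) = cocycles K d n"
  "x \<otimes>\<^bsub>cocycle_group K d n\<^esub> y = x \<otimes>\<^bsub>K n\<^esub> y"
  "\<one>\<^bsub>cocycle_group K d n\<^esub> = \<one>\<^bsub>K n\<^esub>"
  by (simp_all add: cocycle_group_def)

lemma comm_cocycle_group: "comm_group (cocycle_group K d n)"
proof (rule group.group_comm_groupI)
  show "group (cocycle_group K d n)"
    unfolding cocycle_group_def
    using group.subgroup_imp_group[OF grp subgroup_cocycles] .
next
  fix x y assume "x \<in> carrier (cocycle_group K d n)" "y \<in> carrier (cocycle_group K d n)"
  then show "x \<otimes>\<^bsub>cocycle_group K d n\<^esub> y = y \<otimes>\<^bsub>cocycle_group K d n\<^esub> x"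
    using comm_monoid.m_comm[OF comm_group.axioms(1)[OF comm[of n]], of x y]
    by (simp add: cocycles_iff)
qed

lemma subgroup_coboundaries_cocycles: "subgroup (coboundaries K d n) (cocycle_group K d n)"
  unfolding cocycle_group_def
  using group.subgroup_incl[OF grp subgroup_coboundaries subgroup_cocycles coboundaries_subset] .

lemma inv_cocycle_group [simp]:
  "x \<in> cocycles K d n \<Longrightarrow> inv\<^bsub>cocycle_group K d n\<^esub> x = inv\<^bsub>K n\<^esub> x"
  unfolding cocycle_group_def using group.m_inv_consistent[OF grp subgroup_cocycles] by blast

definition cls :: "nat \<Rightarrow> 'a \<Rightarrow> 'a set" where
  "cls n x = coboundaries K d n #>\<^bsub>cocycle_group K d n\<^esub> x"

lemma normal_coboundaries: "coboundaries K d n \<lhd> cocycle_group K d n"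
  using comm_cocycle_group subgroup_coboundaries_cocycles comm_group.subgroup_imp_normal by blast

lemma comm_cohomology: "comm_group (cohomology K d n)"
  unfolding cohomology_def
  by (rule comm_group.abelian_FactGroup[OF comm_cocycle_group subgroup_coboundaries_cocycles])

lemma carrier_cohomology: "carrier (cohomology K d n) = cls n ` cocycles K d n"
  by (auto simp: cohomology_def FactGroup_def RCOSETS_def cls_def)

lemma one_cohomology: "\<one>\<^bsub>cohomology K d n\<^esub> = coboundaries K d n"
  by (simp add: cohomology_def FactGroup_def)

lemma cls_mult:
  assumes "x \<in> cocycles K d n" "y \<in> cocycles K d n"
  shows "cls n x \<otimes>\<^bsub>cohomology K d n\<^esub> cls n y = cls n (x \<otimes>\<^bsub>K n\<^esub> y)"
  using normal.rcos_sum[OF normal_coboundaries[of n], of x y] assms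
  by (simp add: cohomology_def FactGroup_def cls_def)

lemma cls_eq_one_iff:
  assumes "x \<in> cocycles K d n"
  shows "cls n x = \<one>\<^bsub>cohomology K d n\<^esub> \<longleftrightarrow> x \<in> coboundaries K d n"
proof -
  interpret Z: comm_group "cocycle_group K d n" by (rule comm_cocycle_group)
  show ?thesis
    using assms subgroup_coboundaries_cocycles[of n] Z.coset_join1 Z.coset_join2
    unfolding one_cohomology cls_def by (metis cocycle_group_simps(1) Z.rcos_self)
qed

lemma cls_inv:
  assumes "x \<in> cocycles K d n"
  shows "inv\<^bsub>cohomology K d n\<^esub> (cls n x) = cls n (inv\<^bsub>K n\<^esub> x)"
  using assms normal.rcos_inv[OF normal_coboundaries[of n], of x] 
    normal.inv_FactGroup[OF normal_coboundaries[of n], of "cls n x"]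
  by (metis cls_def carrier_cohomology cocycle_group_simps(1) cohomology_def image_eqI inv_cocycle_group)

lemma cls_eq_iff:
  assumes "x \<in> cocycles K d n" "y \<in> cocycles K d n"
  shows "cls n x = cls n y \<longleftrightarrow> x \<otimes>\<^bsub>K n\<^esub> inv\<^bsub>K n\<^esub> y \<in> coboundaries K d n"
proof -
  interpret H: comm_group "cohomology K d n" by (rule comm_cohomology)
  have y': "inv\<^bsub>K n\<^esub> y \<in> cocycles K d n"
    using subgroup.m_inv_closed[OF subgroup_cocycles] assms(2) .
  have xy: "x \<otimes>\<^bsub>K n\<^esub> inv\<^bsub>K n\<^esub> y \<in> cocycles K d n"
    using subgroup.m_closed[OF subgroup_cocycles] assms(1) y' by blast
  have c: "cls n x \<in> carrier (cohomology K d n)" "cls n y \<in> carrier (cohomology K d n)"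
    using assms carrier_cohomology by auto
  have "cls n x = cls n y \<longleftrightarrow> cls n x \<otimes>\<^bsub>cohomology K d n\<^esub> inv\<^bsub>cohomology K d n\<^esub> cls n y = \<one>\<^bsub>cohomology K d n\<^esub>"
    using c by (metis H.inv_equality H.inv_inv H.r_inv H.inv_closed)
  also have "\<dots> \<longleftrightarrow> x \<otimes>\<^bsub>K n\<^esub> inv\<^bsub>K n\<^esub> y \<in> coboundaries K d n"
    using assms y' xy by (simp add: cls_inv cls_mult cls_eq_one_iff)
  finally show ?thesis .
qed

end

section \<open>The Mayer--Vietoris sequence of a pullback square of cochain complexes\<close>

locale mayer_vietoris =
  R: cochain_complex K d + A: cochain_complex K1 d1 + B: cochain_complex K2 d2 + C: cochain_complex KC dC
  for K :: "nat \<Rightarrow> 'a monoid" and d and K1 :: "nat \<Rightarrow> 'b monoid" and d1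
    and K2 :: "nat \<Rightarrow> 'c monoid" and d2 and KC :: "nat \<Rightarrow> 'e monoid" and dC +
  fixes r1 :: "nat \<Rightarrow> 'a \<Rightarrow> 'b" and r2 :: "nat \<Rightarrow> 'a \<Rightarrow> 'c"
    and s1 :: "nat \<Rightarrow> 'b \<Rightarrow> 'e" and s2 :: "nat \<Rightarrow> 'c \<Rightarrow> 'e"
  assumes r1_hom: "r1 n \<in> hom (K n) (K1 n)" and r2_hom: "r2 n \<in> hom (K n) (K2 n)"
    and s1_hom: "s1 n \<in> hom (K1 n) (KC n)" and s2_hom: "s2 n \<in> hom (K2 n) (KC n)"
    and r1_d: "x \<in> carrier (K n) \<Longrightarrow> r1 (Suc n) (d n x) = d1 n (r1 n x)"
    and r2_d: "x \<in> carrier (K n) \<Longrightarrow> r2 (Suc n) (d n x) = d2 n (r2 n x)"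
    and s1_d: "y \<in> carrier (K1 n) \<Longrightarrow> s1 (Suc n) (d1 n y) = dC n (s1 n y)"
    and s2_d: "z \<in> carrier (K2 n) \<Longrightarrow> s2 (Suc n) (d2 n z) = dC n (s2 n z)"
    and square: "x \<in> carrier (K n) \<Longrightarrow> s1 n (r1 n x) = s2 n (r2 n x)"
    and joint_inj: "x \<in> carrier (K n) \<Longrightarrow> x' \<in> carrier (K n) \<Longrightarrow>
      r1 n x = r1 n x' \<Longrightarrow> r2 n x = r2 n x' \<Longrightarrow> x = x'"
    and pullback: "y \<in> carrier (K1 n) \<Longrightarrow> z \<in> carrier (K2 n) \<Longrightarrow> s1 n y = s2 n z \<Longrightarrow>
      \<exists>x\<in>carrier (K n). r1 n x = y \<and> r2 n x = z"
    and s1_surj: "w \<in> carrier (KC n) \<Longrightarrow> \<exists>y\<in>carrier (K1 n). s1 n y = w"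
begin

lemma r1_group_hom: "group_hom (K n) (K1 n) (r1 n)"
  by (simp add: group_hom_def group_hom_axioms_def R.grp A.grp r1_hom)
lemma r2_group_hom: "group_hom (K n) (K2 n) (r2 n)"
  by (simp add: group_hom_def group_hom_axioms_def R.grp B.grp r2_hom)
lemma s1_group_hom: "group_hom (K1 n) (KC n) (s1 n)"
  by (simp add: group_hom_def group_hom_axioms_def C.grp A.grp s1_hom)
lemma s2_group_hom: "group_hom (K2 n) (KC n) (s2 n)"
  by (simp add: group_hom_def group_hom_axioms_def C.grp B.grp s2_hom)

lemmas homs = r1_group_hom r2_group_hom s1_group_hom s2_group_hom
  R.d_group_hom A.d_group_hom B.d_group_hom C.d_group_hom
lemmas grps = R.grp A.grp B.grp C.grp
lemmas [simp] = homs[THEN group_hom.hom_mult] homs[THEN group_hom.hom_one]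
  homs[THEN group_hom.hom_inv] homs[THEN group_hom.hom_closed]
  grps[THEN group.inv_closed] grps[THEN group.is_monoid, THEN monoid.m_closed]
  grps[THEN group.is_monoid, THEN monoid.one_closed]
  grps[THEN group.is_monoid, THEN monoid.l_one] grps[THEN group.is_monoid, THEN monoid.r_one]
  grps[THEN group.r_inv] grps[THEN group.l_inv] grps[THEN group.inv_inv]
  grps[THEN group.is_monoid, THEN monoid.inv_one]
  r1_d r2_d s1_d s2_d R.d_d A.d_d B.d_d C.d_d

lemma r1_cocycles: "x \<in> cocycles K d n \<Longrightarrow> r1 n x \<in> cocycles K1 d1 n"
  by (simp add: R.cocycles_iff A.cocycles_iff flip: r1_d)
lemma r2_cocycles: "x \<in> cocycles K d n \<Longrightarrow> r2 n x \<in> cocycles K2 d2 n"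
  by (simp add: R.cocycles_iff B.cocycles_iff flip: r2_d)
lemma s1_cocycles: "y \<in> cocycles K1 d1 n \<Longrightarrow> s1 n y \<in> cocycles KC dC n"
  by (simp add: C.cocycles_iff A.cocycles_iff flip: s1_d)
lemma s2_cocycles: "z \<in> cocycles K2 d2 n \<Longrightarrow> s2 n z \<in> cocycles KC dC n"
  by (simp add: C.cocycles_iff B.cocycles_iff flip: s2_d)

lemma r1_coboundaries: "x \<in> coboundaries K d n \<Longrightarrow> r1 n x \<in> coboundaries K1 d1 n"
  by (auto simp: coboundaries_def split: nat.splits)
lemma r2_coboundaries: "x \<in> coboundaries K d n \<Longrightarrow> r2 n x \<in> coboundaries K2 d2 n"
  by (auto simp: coboundaries_def split: nat.splits)
lemma s1_coboundaries: "y \<in> coboundaries K1 d1 n \<Longrightarrow> s1 n y \<in> coboundaries KC dC n"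
  by (auto simp: coboundaries_def split: nat.splits)
lemma s2_coboundaries: "z \<in> coboundaries K2 d2 n \<Longrightarrow> s2 n z \<in> coboundaries KC dC n"
  by (auto simp: coboundaries_def split: nat.splits)

lemma coboundary_lift:
  assumes "w \<in> coboundaries KC dC n"
  shows "\<exists>y\<in>coboundaries K1 d1 n. s1 n y = w"
proof (cases n)
  case 0
  then show ?thesis using assms by (simp add: coboundaries_def)
next
  case (Suc m)
  then obtain v where v: "v \<in> carrier (KC m)" "w = dC m v"
    using assms by (auto simp: coboundaries_def)
  then obtain y where y: "y \<in> carrier (K1 m)" "s1 m y = v" using s1_surj by blast
  then have "s1 (Suc m) (d1 m y) = w" using v by simp
  then show ?thesis using y Suc by (auto simp: coboundaries_def)
qed

lemma coboundaries_carrier: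
  "x \<in> coboundaries K d n \<Longrightarrow> x \<in> carrier (K n)"
  "y \<in> coboundaries K1 d1 n \<Longrightarrow> y \<in> carrier (K1 n) \<and> d1 n y = \<one>\<^bsub>K1 (Suc n)\<^esub>"
  using R.coboundaries_subset A.coboundaries_subset R.cocycles_iff A.cocycles_iff by blast+

lemma restriction_relation:
  assumes "cochain_complex L e" "cochain_complex M f" "h \<in> hom (L n) (M n)"
    "\<And>x. x \<in> cocycles L e n \<Longrightarrow> h x \<in> cocycles M f n"
    "\<And>x. x \<in> coboundaries L e n \<Longrightarrow> h x \<in> coboundaries M f n"
  shows "coset_relation (cocycle_group L e n) (cocycle_group M f n) (coboundaries L e n)
    (coboundaries M f n) (\<lambda>x y. x \<in> cocycles L e n \<and> y = h x)"
proof -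
  interpret L: cochain_complex L e by fact
  interpret M: cochain_complex M f by fact
  have h: "group_hom (L n) (M n) h"
    using assms(3) L.grp M.grp by (simp add: group_hom_def group_hom_axioms_def)
  interpret Z: comm_group "cocycle_group L e n" by (rule L.comm_cocycle_group)
  show ?thesis
    unfolding coset_relation_def coset_relation_axioms_def
    using L.comm_cocycle_group M.comm_cocycle_group L.subgroup_coboundaries_cocycles
      M.subgroup_coboundaries_cocycles assms(4,5)
      L.subgroup_cocycles[THEN subgroup.m_closed] L.subgroup_cocycles[THEN subgroup.m_inv_closed]
      group_hom.hom_mult[OF h] group_hom.hom_inv[OF h]
    by (auto simp: L.cocycles_iff)
qed

definition connecting :: "nat \<Rightarrow> 'e \<Rightarrow> 'a \<Rightarrow> bool" where
  "connecting n w x \<longleftrightarrow> w \<in> cocycles KC dC n \<and> x \<in> cocycles K d (Suc n) \<and>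
     r2 (Suc n) x = \<one>\<^bsub>K2 (Suc n)\<^esub> \<and> (\<exists>y\<in>carrier (K1 n). s1 n y = w \<and> r1 (Suc n) x = d1 n y)"

lemma connecting_exists:
  assumes "y \<in> carrier (K1 n)" "s1 n y \<in> cocycles KC dC n"
  shows "\<exists>x. connecting n (s1 n y) x \<and> r1 (Suc n) x = d1 n y"
proof -
  have "s1 (Suc n) (d1 n y) = s2 (Suc n) \<one>\<^bsub>K2 (Suc n)\<^esub>"
    using assms C.cocycles_iff by simp
  then obtain x where x: "x \<in> carrier (K (Suc n))" "r1 (Suc n) x = d1 n y"
    "r2 (Suc n) x = \<one>\<^bsub>K2 (Suc n)\<^esub>"
    using pullback[of "d1 n y" "Suc n" "\<one>\<^bsub>K2 (Suc n)\<^esub>"] assms by auto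
  have "d (Suc n) x = \<one>\<^bsub>K (Suc (Suc n))\<^esub>"
    by (rule joint_inj[where n = "Suc (Suc n)"]) (use x assms in simp_all)
  then show ?thesis
    using x assms by (auto simp: connecting_def R.cocycles_iff)
qed

lemma connecting_coset_relation:
  "coset_relation (cocycle_group KC dC n) (cocycle_group K d (Suc n)) (coboundaries KC dC n)
    (coboundaries K d (Suc n)) (connecting n)"
  unfolding coset_relation_def coset_relation_axioms_def
proof (intro conjI allI impI)
  fix w assume "w \<in> carrier (cocycle_group KC dC n)"
  then have w: "w \<in> cocycles KC dC n" by simp
  then obtain y where "y \<in> carrier (K1 n)" "s1 n y = w" 
    using s1_surj C.cocycles_iff by blast
  then show "\<exists>x. connecting n w x" using connecting_exists w by blast
next
  fix w x w' x' assume "connecting n w x" "connecting n w' x'"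
  then obtain y y' where *: "w \<in> cocycles KC dC n" "w' \<in> cocycles KC dC n"
    "x \<in> cocycles K d (Suc n)" "x' \<in> cocycles K d (Suc n)"
    "r2 (Suc n) x = \<one>\<^bsub>K2 (Suc n)\<^esub>" "r2 (Suc n) x' = \<one>\<^bsub>K2 (Suc n)\<^esub>"
    and y: "y \<in> carrier (K1 n)" "s1 n y = w" "r1 (Suc n) x = d1 n y"
      "y' \<in> carrier (K1 n)" "s1 n y' = w'" "r1 (Suc n) x' = d1 n y'"
    unfolding connecting_def by blast
  have "connecting n (w \<otimes>\<^bsub>KC n\<^esub> w') (x \<otimes>\<^bsub>K (Suc n)\<^esub> x')"
    unfolding connecting_def
  proof (intro conjI bexI)
    show "s1 n (y \<otimes>\<^bsub>K1 n\<^esub> y') = w \<otimes>\<^bsub>KC n\<^esub> w'" using y by simp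
    show "r1 (Suc n) (x \<otimes>\<^bsub>K (Suc n)\<^esub> x') = d1 n (y \<otimes>\<^bsub>K1 n\<^esub> y')"
      using y * by (simp add: R.cocycles_iff)
  qed (use * y in \<open>simp_all add: R.cocycles_iff C.cocycles_iff\<close>)
  then show "connecting n (w \<otimes>\<^bsub>cocycle_group KC dC n\<^esub> w') (x \<otimes>\<^bsub>cocycle_group K d (Suc n)\<^esub> x')"
    by simp
next
  fix w x assume "connecting n w x"
  then obtain y where *: "w \<in> cocycles KC dC n" 
    "x \<in> cocycles K d (Suc n)" "r2 (Suc n) x = \<one>\<^bsub>K2 (Suc n)\<^esub>"
    and y: "y \<in> carrier (K1 n)" "s1 n y = w" "r1 (Suc n) x = d1 n y"
    unfolding connecting_def by blast
  have "connecting n (inv\<^bsub>KC n\<^esub> w) (inv\<^bsub>K (Suc n)\<^esub> x)"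
    unfolding connecting_def
  proof (intro conjI bexI)
    show "s1 n (inv\<^bsub>K1 n\<^esub> y) = inv\<^bsub>KC n\<^esub> w" using y by simp
    show "r1 (Suc n) (inv\<^bsub>K (Suc n)\<^esub> x) = d1 n (inv\<^bsub>K1 n\<^esub> y)"
      using y * by (simp add: R.cocycles_iff)
  qed (use * y in \<open>simp_all add: R.cocycles_iff C.cocycles_iff\<close>)
  then show "connecting n (inv\<^bsub>cocycle_group KC dC n\<^esub> w) (inv\<^bsub>cocycle_group K d (Suc n)\<^esub> x)"
    using * by simp
next
  fix w x assume "connecting n w x" and w: "w \<in> coboundaries KC dC n"
  then obtain y where *: "x \<in> cocycles K d (Suc n)" "r2 (Suc n) x = \<one>\<^bsub>K2 (Suc n)\<^esub>"
    and y: "y \<in> carrier (K1 n)" "s1 n y = w" "r1 (Suc n) x = d1 n y"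
    unfolding connecting_def by blast
  obtain b where b: "b \<in> coboundaries K1 d1 n" "s1 n b = w" using coboundary_lift w by blast
  then have b': "b \<in> carrier (K1 n)" "d1 n b = \<one>\<^bsub>K1 (Suc n)\<^esub>" using coboundaries_carrier by auto
  have "s1 n (y \<otimes>\<^bsub>K1 n\<^esub> inv\<^bsub>K1 n\<^esub> b) = s2 n \<one>\<^bsub>K2 n\<^esub>"
  proof -
    have "s1 n b \<in> carrier (KC n)" using b' by simp
    then show ?thesis using y b b' by simp
  qed
  then obtain u where u: "u \<in> carrier (K n)" "r1 n u = y \<otimes>\<^bsub>K1 n\<^esub> inv\<^bsub>K1 n\<^esub> b" "r2 n u = \<one>\<^bsub>K2 n\<^esub>"
    using pullback[of "y \<otimes>\<^bsub>K1 n\<^esub> inv\<^bsub>K1 n\<^esub> b" n "\<one>\<^bsub>K2 n\<^esub>"] y(1) b'(1) by auto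
  have "d n u = x"
    by (rule joint_inj[where n = "Suc n"]) (use u y b' * in \<open>simp_all add: R.cocycles_iff\<close>)
  then show "x \<in> coboundaries K d (Suc n)" using u by (auto simp: coboundaries_def)
qed (auto simp: connecting_def C.comm_cocycle_group R.comm_cocycle_group
      C.subgroup_coboundaries_cocycles R.subgroup_coboundaries_cocycles)

sublocale r1: coset_relation "cocycle_group K d n" "cocycle_group K1 d1 n" "coboundaries K d n"
    "coboundaries K1 d1 n" "\<lambda>x y. x \<in> cocycles K d n \<and> y = r1 n x" for n
  by (intro restriction_relation R.cochain_complex_axioms A.cochain_complex_axioms r1_hom
      r1_cocycles r1_coboundaries)

sublocale r2: coset_relation "cocycle_group K d n" "cocycle_group K2 d2 n" "coboundaries K d n"
    "coboundaries K2 d2 n" "\<lambda>x y. x \<in> cocycles K d n \<and> y = r2 n x" for n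
  by (intro restriction_relation R.cochain_complex_axioms B.cochain_complex_axioms r2_hom
      r2_cocycles r2_coboundaries)

sublocale s1: coset_relation "cocycle_group K1 d1 n" "cocycle_group KC dC n" "coboundaries K1 d1 n"
    "coboundaries KC dC n" "\<lambda>x y. x \<in> cocycles K1 d1 n \<and> y = s1 n x" for n
  by (intro restriction_relation C.cochain_complex_axioms A.cochain_complex_axioms s1_hom
      s1_cocycles s1_coboundaries)

sublocale s2: coset_relation "cocycle_group K2 d2 n" "cocycle_group KC dC n" "coboundaries K2 d2 n"
    "coboundaries KC dC n" "\<lambda>x y. x \<in> cocycles K2 d2 n \<and> y = s2 n x" for n
  by (intro restriction_relation C.cochain_complex_axioms B.cochain_complex_axioms s2_hom
      s2_cocycles s2_coboundaries)

sublocale con: coset_relation "cocycle_group KC dC n" "cocycle_group K d (Suc n)"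
    "coboundaries KC dC n" "coboundaries K d (Suc n)" "connecting n" for n
  by (rule connecting_coset_relation)

lemma r1_cls: "x \<in> cocycles K d n \<Longrightarrow> r1.coset_map n (R.cls n x) = A.cls n (r1 n x)"
  using r1.coset_map_coset by (simp add: R.cls_def A.cls_def)
lemma r2_cls: "x \<in> cocycles K d n \<Longrightarrow> r2.coset_map n (R.cls n x) = B.cls n (r2 n x)"
  using r2.coset_map_coset by (simp add: R.cls_def B.cls_def)
lemma s1_cls: "x \<in> cocycles K1 d1 n \<Longrightarrow> s1.coset_map n (A.cls n x) = C.cls n (s1 n x)"
  using s1.coset_map_coset by (simp add: A.cls_def C.cls_def)
lemma s2_cls: "x \<in> cocycles K2 d2 n \<Longrightarrow> s2.coset_map n (B.cls n x) = C.cls n (s2 n x)"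
  using s2.coset_map_coset by (simp add: B.cls_def C.cls_def)
lemma con_cls: "connecting n w x \<Longrightarrow> con.coset_map n (C.cls n w) = R.cls (Suc n) x"
  using con.coset_map_coset by (simp add: R.cls_def C.cls_def)

lemma exact_at_sum:
  assumes y: "y \<in> cocycles K1 d1 n" and z: "z \<in> cocycles K2 d2 n"
    and eq: "s1 n y \<otimes>\<^bsub>KC n\<^esub> inv\<^bsub>KC n\<^esub> s2 n z \<in> coboundaries KC dC n"
  shows "\<exists>x\<in>cocycles K d n. A.cls n (r1 n x) = A.cls n y \<and> r2 n x = z"
proof -
  have y': "y \<in> carrier (K1 n)" "d1 n y = \<one>\<^bsub>K1 (Suc n)\<^esub>"
    and z': "z \<in> carrier (K2 n)" "d2 n z = \<one>\<^bsub>K2 (Suc n)\<^esub>"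
    using y z by (simp_all add: A.cocycles_iff B.cocycles_iff)
  obtain b where b: "b \<in> coboundaries K1 d1 n" "s1 n b = s1 n y \<otimes>\<^bsub>KC n\<^esub> inv\<^bsub>KC n\<^esub> s2 n z"
    using coboundary_lift[OF eq] by blast
  then have b': "b \<in> carrier (K1 n)" "d1 n b = \<one>\<^bsub>K1 (Suc n)\<^esub>" using coboundaries_carrier by auto
  interpret KC: comm_group "KC n" by (rule C.comm)
  interpret K1: comm_group "K1 n" by (rule A.comm)
  have "s1 n (inv\<^bsub>K1 n\<^esub> b \<otimes>\<^bsub>K1 n\<^esub> y) = s2 n z"
  proof -
    have c: "s1 n y \<in> carrier (KC n)" "s2 n z \<in> carrier (KC n)" using y' z' by simp_all
    have "inv\<^bsub>KC n\<^esub> (s1 n y \<otimes>\<^bsub>KC n\<^esub> inv\<^bsub>KC n\<^esub> s2 n z) \<otimes>\<^bsub>KC n\<^esub> s1 n y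
        = s2 n z \<otimes>\<^bsub>KC n\<^esub> (inv\<^bsub>KC n\<^esub> s1 n y \<otimes>\<^bsub>KC n\<^esub> s1 n y)"
      using c by (simp only: KC.inv_mult KC.inv_closed KC.inv_inv KC.m_assoc KC.m_closed
          KC.m_lcomm[of "inv\<^bsub>KC n\<^esub> s1 n y"])
    then show ?thesis using y' b b' c by simp
  qed
  then obtain x where x: "x \<in> carrier (K n)" "r1 n x = inv\<^bsub>K1 n\<^esub> b \<otimes>\<^bsub>K1 n\<^esub> y" "r2 n x = z"
    using pullback[of "inv\<^bsub>K1 n\<^esub> b \<otimes>\<^bsub>K1 n\<^esub> y" n z] y' z' b' by auto
  have "d n x = \<one>\<^bsub>K (Suc n)\<^esub>"
    by (rule joint_inj[where n = "Suc n"]) (use x y' z' b' in simp_all)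
  then have x': "x \<in> cocycles K d n" using x by (simp add: R.cocycles_iff)
  have "r1 n x \<otimes>\<^bsub>K1 n\<^esub> inv\<^bsub>K1 n\<^esub> y = inv\<^bsub>K1 n\<^esub> b"
    using x y' b' by (simp add: K1.m_assoc)
  then have "A.cls n (r1 n x) = A.cls n y"
    using A.cls_eq_iff[OF r1_cocycles[OF x'] y] b subgroup.m_inv_closed[OF A.subgroup_coboundaries]
    by simp
  then show ?thesis using x x' by blast
qed

lemma exact_at_intersection:
  assumes w: "connecting n w x" and x: "x \<in> coboundaries K d (Suc n)"
  shows "\<exists>y\<in>cocycles K1 d1 n. \<exists>z\<in>cocycles K2 d2 n. w = s1 n y \<otimes>\<^bsub>KC n\<^esub> inv\<^bsub>KC n\<^esub> s2 n z"
proof -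
  obtain y where *: "r2 (Suc n) x = \<one>\<^bsub>K2 (Suc n)\<^esub>"
    and y: "y \<in> carrier (K1 n)" "s1 n y = w" "r1 (Suc n) x = d1 n y"
    using w unfolding connecting_def by blast
  obtain u where u: "u \<in> carrier (K n)" "x = d n u" using x by (auto simp: coboundaries_def)
  interpret KC: comm_group "KC n" by (rule C.comm)
  show ?thesis
  proof (intro bexI)
    show "w = s1 n (y \<otimes>\<^bsub>K1 n\<^esub> inv\<^bsub>K1 n\<^esub> r1 n u) \<otimes>\<^bsub>KC n\<^esub> inv\<^bsub>KC n\<^esub> s2 n (inv\<^bsub>K2 n\<^esub> r2 n u)"
    proof -
      have "s2 n (r2 n u) \<in> carrier (KC n)" "w \<in> carrier (KC n)"
        using u y group_hom.hom_closed[OF s1_group_hom y(1)] by simp_all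
      then show ?thesis using y u by (simp add: square KC.m_assoc)
    qed
    show "y \<otimes>\<^bsub>K1 n\<^esub> inv\<^bsub>K1 n\<^esub> r1 n u \<in> cocycles K1 d1 n"
      using y u by (simp add: A.cocycles_iff flip: r1_d)
    show "inv\<^bsub>K2 n\<^esub> r2 n u \<in> cocycles K2 d2 n"
      using * u by (simp add: B.cocycles_iff flip: r2_d)
  qed
qed

lemma connecting_image:
  assumes y: "y \<in> cocycles K1 d1 n" and z: "z \<in> cocycles K2 d2 n"
    and x: "connecting n (s1 n y \<otimes>\<^bsub>KC n\<^esub> inv\<^bsub>KC n\<^esub> s2 n z) x"
  shows "x \<in> coboundaries K d (Suc n)"
proof -
  have y': "y \<in> carrier (K1 n)" "d1 n y = \<one>\<^bsub>K1 (Suc n)\<^esub>"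
    and z': "z \<in> carrier (K2 n)" "d2 n z = \<one>\<^bsub>K2 (Suc n)\<^esub>"
    using y z by (simp_all add: A.cocycles_iff B.cocycles_iff)
  obtain v where *: "x \<in> cocycles K d (Suc n)" "r2 (Suc n) x = \<one>\<^bsub>K2 (Suc n)\<^esub>"
    and v: "v \<in> carrier (K1 n)" "s1 n v = s1 n y \<otimes>\<^bsub>KC n\<^esub> inv\<^bsub>KC n\<^esub> s2 n z" "r1 (Suc n) x = d1 n v"
    using x unfolding connecting_def by blast
  interpret KC: comm_group "KC n" by (rule C.comm)
  have "s1 n (v \<otimes>\<^bsub>K1 n\<^esub> inv\<^bsub>K1 n\<^esub> y) = s2 n (inv\<^bsub>K2 n\<^esub> z)"
  proof -
    have "s2 n z \<in> carrier (KC n)" "s1 n y \<in> carrier (KC n)" using z' y' by simp_all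
    then show ?thesis using y' z' v by (simp add: KC.m_assoc KC.m_comm[of "inv\<^bsub>KC n\<^esub> s2 n z"])
      (simp add: KC.m_assoc[symmetric])
  qed
  then obtain u where u: "u \<in> carrier (K n)" "r1 n u = v \<otimes>\<^bsub>K1 n\<^esub> inv\<^bsub>K1 n\<^esub> y" "r2 n u = inv\<^bsub>K2 n\<^esub> z"
    using pullback[of "v \<otimes>\<^bsub>K1 n\<^esub> inv\<^bsub>K1 n\<^esub> y" n "inv\<^bsub>K2 n\<^esub> z"] y' z' v by auto
  have "d n u = x"
    by (rule joint_inj[where n = "Suc n"]) (use u y' z' v * in \<open>simp_all add: R.cocycles_iff\<close>)
  then show ?thesis using u by (auto simp: coboundaries_def)
qed

lemma exact_at_union:
  assumes x: "x \<in> cocycles K d (Suc n)"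
    and x1: "r1 (Suc n) x \<in> coboundaries K1 d1 (Suc n)"
    and x2: "r2 (Suc n) x \<in> coboundaries K2 d2 (Suc n)"
  shows "\<exists>w x'. connecting n w x' \<and> R.cls (Suc n) x' = R.cls (Suc n) x"
proof -
  obtain y z where y: "y \<in> carrier (K1 n)" "r1 (Suc n) x = d1 n y"
    and z: "z \<in> carrier (K2 n)" "r2 (Suc n) x = d2 n z"
    using x1 x2 by (auto simp: coboundaries_def)
  have xc: "x \<in> carrier (K (Suc n))" using x by (simp add: R.cocycles_iff)
  obtain y2 where y2: "y2 \<in> carrier (K1 n)" "s1 n y2 = s2 n z"
    using s1_surj[of "s2 n z" n] z by auto
  obtain u where u: "u \<in> carrier (K n)" "r1 n u = y2" "r2 n u = z"
    using pullback y2 z by blast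
  define x' where "x' = x \<otimes>\<^bsub>K (Suc n)\<^esub> inv\<^bsub>K (Suc n)\<^esub> d n u"
  define y' where "y' = y \<otimes>\<^bsub>K1 n\<^esub> inv\<^bsub>K1 n\<^esub> y2"
  have x': "x' \<in> cocycles K d (Suc n)"
    using x u by (simp add: x'_def R.cocycles_iff)
  have y': "y' \<in> carrier (K1 n)" using y y2 by (simp add: y'_def)
  have "dC n (s1 n y') = \<one>\<^bsub>KC (Suc n)\<^esub>"
  proof -
    have "dC n (s1 n y) = dC n (s2 n z)"
      using square[OF xc] y z by simp
    then show ?thesis using y y2 z by (simp add: y'_def)
  qed
  then have "connecting n (s1 n y') x'"
    unfolding connecting_def
    using x' y' xc u y y2 z
    by (auto simp: C.cocycles_iff x'_def y'_def intro!: bexI[of _ y'])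
  moreover have "R.cls (Suc n) x' = R.cls (Suc n) x"
  proof -
    interpret KR: comm_group "K (Suc n)" by (rule R.comm)
    have "x' \<otimes>\<^bsub>K (Suc n)\<^esub> inv\<^bsub>K (Suc n)\<^esub> x = d n (inv\<^bsub>K n\<^esub> u)"
      using xc u by (simp add: x'_def KR.m_assoc KR.m_comm[of "inv\<^bsub>K (Suc n)\<^esub> d n u"])
        (simp add: KR.m_assoc[symmetric])
    moreover have "d n (inv\<^bsub>K n\<^esub> u) \<in> coboundaries K d (Suc n)"
      unfolding coboundaries_def nat.case by (intro imageI) (use u in simp)
    ultimately show ?thesis
      using R.cls_eq_iff[OF x' x] by metis
  qed
  ultimately show ?thesis by blast
qed

theorem long_exact_sequence:
  "long_exact_sequence (cohomology K d) (\<lambda>n. cohomology K1 d1 n \<times>\<times> cohomology K2 d2 n)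
    (cohomology KC dC)"
proof -
  define f where "f n X = (r1.coset_map n X, r2.coset_map n X)" for n X
  define g where "g n = (\<lambda>(U, V). s1.coset_map n U \<otimes>\<^bsub>cohomology KC dC n\<^esub>
    inv\<^bsub>cohomology KC dC n\<^esub> s2.coset_map n V)" for n
  have grpR: "group (cohomology K d n)" and grpA: "group (cohomology K1 d1 n)"
    and grpB: "group (cohomology K2 d2 n)" for n
    using R.comm_cohomology A.comm_cohomology B.comm_cohomology
    by (auto simp: comm_group_def)
  have hr1: "group_hom (cohomology K d n) (cohomology K1 d1 n) (r1.coset_map n)"
    and hr2: "group_hom (cohomology K d n) (cohomology K2 d2 n) (r2.coset_map n)"
    and hs1: "group_hom (cohomology K1 d1 n) (cohomology KC dC n) (s1.coset_map n)"
    and hs2: "group_hom (cohomology K2 d2 n) (cohomology KC dC n) (s2.coset_map n)"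
    and hcon: "group_hom (cohomology KC dC n) (cohomology K d (Suc n)) (con.coset_map n)" for n
    using r1.coset_map_hom r2.coset_map_hom s1.coset_map_hom s2.coset_map_hom con.coset_map_hom
    by (simp_all add: cohomology_def)
  have f_cls: "f n (R.cls n x) = (A.cls n (r1 n x), B.cls n (r2 n x))" if "x \<in> cocycles K d n" for n x
    using that by (simp add: f_def r1_cls r2_cls)
  have g_cls: "g n (A.cls n y, B.cls n z) = C.cls n (s1 n y \<otimes>\<^bsub>KC n\<^esub> inv\<^bsub>KC n\<^esub> s2 n z)"
    and g_coc: "s1 n y \<otimes>\<^bsub>KC n\<^esub> inv\<^bsub>KC n\<^esub> s2 n z \<in> cocycles KC dC n"
    if "y \<in> cocycles K1 d1 n" "z \<in> cocycles K2 d2 n" for n y z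
    using that s1_cocycles[OF that(1)] s2_cocycles[OF that(2)]
      C.subgroup_cocycles[of n, THEN subgroup.m_inv_closed] C.subgroup_cocycles[of n, THEN subgroup.m_closed]
    by (simp_all add: g_def s1_cls s2_cls C.cls_inv C.cls_mult)
  have grpAB: "group (cohomology K1 d1 n \<times>\<times> cohomology K2 d2 n)" for n
    using DirProd_group grpA grpB by blast
  have hf: "group_hom (cohomology K d n) (cohomology K1 d1 n \<times>\<times> cohomology K2 d2 n) (f n)" for n
    using group_hom.hom_closed[OF hr1] group_hom.hom_closed[OF hr2]
      group_hom.hom_mult[OF hr1] group_hom.hom_mult[OF hr2] grpR grpAB
    by (auto simp: group_hom_def group_hom_axioms_def f_def hom_def)
  have hg: "group_hom (cohomology K1 d1 n \<times>\<times> cohomology K2 d2 n) (cohomology KC dC n) (g n)" for n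
  proof -
    interpret HC: comm_group "cohomology KC dC n" by (rule C.comm_cohomology)
    have "g n \<in> hom (cohomology K1 d1 n \<times>\<times> cohomology K2 d2 n) (cohomology KC dC n)"
      using group_hom.hom_closed[OF hs1[of n]] group_hom.hom_closed[OF hs2[of n]]
        group_hom.hom_mult[OF hs1[of n]] group_hom.hom_mult[OF hs2[of n]]
      by (auto simp: g_def hom_def HC.inv_mult HC.m_ac)
    then show ?thesis using grpAB HC.is_group by (simp add: group_hom_def group_hom_axioms_def)
  qed
  have 1: "f n ` carrier (cohomology K d n) =
    kernel (cohomology K1 d1 n \<times>\<times> cohomology K2 d2 n) (cohomology KC dC n) (g n)" for n
  proof (intro equalityI subsetI)
    fix Y assume "Y \<in> f n ` carrier (cohomology K d n)"
    then obtain x where x: "x \<in> cocycles K d n" "Y = f n (R.cls n x)"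
      by (auto simp: R.carrier_cohomology)
    then have "x \<in> carrier (K n)" by (simp add: R.cocycles_iff)
    then have "g n Y = C.cls n \<one>\<^bsub>KC n\<^esub>"
      using x by (simp add: f_cls g_cls r1_cocycles r2_cocycles square)
    also have "\<dots> = \<one>\<^bsub>cohomology KC dC n\<^esub>"
      using C.cls_eq_one_iff subgroup.one_closed[OF C.subgroup_coboundaries]
        subgroup.one_closed[OF C.subgroup_cocycles] by blast
    finally show "Y \<in> kernel (cohomology K1 d1 n \<times>\<times> cohomology K2 d2 n) (cohomology KC dC n) (g n)"
      using x by (simp add: kernel_def f_cls A.carrier_cohomology B.carrier_cohomology
          r1_cocycles r2_cocycles)
  next
    fix Y assume "Y \<in> kernel (cohomology K1 d1 n \<times>\<times> cohomology K2 d2 n) (cohomology KC dC n) (g n)"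
    then obtain y z where yz: "y \<in> cocycles K1 d1 n" "z \<in> cocycles K2 d2 n"
      "Y = (A.cls n y, B.cls n z)" "g n Y = \<one>\<^bsub>cohomology KC dC n\<^esub>"
      by (auto simp: kernel_def A.carrier_cohomology B.carrier_cohomology)
    then have "s1 n y \<otimes>\<^bsub>KC n\<^esub> inv\<^bsub>KC n\<^esub> s2 n z \<in> coboundaries KC dC n"
      by (simp add: g_cls g_coc C.cls_eq_one_iff)
    then obtain x where "x \<in> cocycles K d n" "A.cls n (r1 n x) = A.cls n y" "r2 n x = z"
      using exact_at_sum yz by blast
    then show "Y \<in> f n ` carrier (cohomology K d n)"
      using yz f_cls by (force simp: R.carrier_cohomology)
  qed
  have 2: "g n ` carrier (cohomology K1 d1 n \<times>\<times> cohomology K2 d2 n) =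
    kernel (cohomology KC dC n) (cohomology K d (Suc n)) (con.coset_map n)" for n
  proof (intro equalityI subsetI)
    fix W assume "W \<in> g n ` carrier (cohomology K1 d1 n \<times>\<times> cohomology K2 d2 n)"
    then obtain y z where yz: "y \<in> cocycles K1 d1 n" "z \<in> cocycles K2 d2 n"
      "W = C.cls n (s1 n y \<otimes>\<^bsub>KC n\<^esub> inv\<^bsub>KC n\<^esub> s2 n z)"
      by (auto simp: A.carrier_cohomology B.carrier_cohomology g_cls)
    obtain x where x: "connecting n (s1 n y \<otimes>\<^bsub>KC n\<^esub> inv\<^bsub>KC n\<^esub> s2 n z) x"
      using con.total g_coc[OF yz(1,2)] by auto
    then have "x \<in> cocycles K d (Suc n)" by (simp add: connecting_def)
    then have "con.coset_map n W = \<one>\<^bsub>cohomology K d (Suc n)\<^esub>"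
      using x yz connecting_image by (simp add: con_cls R.cls_eq_one_iff)
    then show "W \<in> kernel (cohomology KC dC n) (cohomology K d (Suc n)) (con.coset_map n)"
      using g_coc[OF yz(1,2)] yz(3) by (simp add: kernel_def C.carrier_cohomology)
  next
    fix W assume "W \<in> kernel (cohomology KC dC n) (cohomology K d (Suc n)) (con.coset_map n)"
    then obtain w where w: "w \<in> cocycles KC dC n" "W = C.cls n w"
      and W: "con.coset_map n W = \<one>\<^bsub>cohomology K d (Suc n)\<^esub>"
      by (auto simp: kernel_def C.carrier_cohomology)
    obtain x where x: "connecting n w x" using con.total w by auto
    then have "x \<in> cocycles K d (Suc n)" by (simp add: connecting_def)
    then have "x \<in> coboundaries K d (Suc n)"
      using x w W by (simp add: con_cls R.cls_eq_one_iff)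
    then obtain y z where yz: "y \<in> cocycles K1 d1 n" "z \<in> cocycles K2 d2 n"
      "w = s1 n y \<otimes>\<^bsub>KC n\<^esub> inv\<^bsub>KC n\<^esub> s2 n z"
      using exact_at_intersection x by blast
    then have "W = g n (A.cls n y, B.cls n z)" using w g_cls by simp
    then show "W \<in> g n ` carrier (cohomology K1 d1 n \<times>\<times> cohomology K2 d2 n)"
      using yz by (auto simp: A.carrier_cohomology B.carrier_cohomology)
  qed
  have f_ker: "x \<in> cocycles K d n \<Longrightarrow>
    R.cls n x \<in> kernel (cohomology K d n) (cohomology K1 d1 n \<times>\<times> cohomology K2 d2 n) (f n) \<longleftrightarrow>
    r1 n x \<in> coboundaries K1 d1 n \<and> r2 n x \<in> coboundaries K2 d2 n" for n x
    by (simp add: kernel_def R.carrier_cohomology f_cls A.cls_eq_one_iff B.cls_eq_one_iff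
        r1_cocycles r2_cocycles)
  have 3: "con.coset_map n ` carrier (cohomology KC dC n) =
    kernel (cohomology K d (Suc n)) (cohomology K1 d1 (Suc n) \<times>\<times> cohomology K2 d2 (Suc n)) (f (Suc n))"
    for n
  proof (intro equalityI subsetI)
    fix X assume "X \<in> con.coset_map n ` carrier (cohomology KC dC n)"
    then obtain w where w: "w \<in> cocycles KC dC n" "X = con.coset_map n (C.cls n w)"
      by (auto simp: C.carrier_cohomology)
    obtain x where x: "connecting n w x" using con.total w by auto
    then have "r1 (Suc n) x \<in> coboundaries K1 d1 (Suc n)" "r2 (Suc n) x \<in> coboundaries K2 d2 (Suc n)"
      using subgroup.one_closed[OF B.subgroup_coboundaries[of "Suc n"]]
      by (auto simp: connecting_def) (auto simp: coboundaries_def)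
    then show "X \<in> kernel (cohomology K d (Suc n))
        (cohomology K1 d1 (Suc n) \<times>\<times> cohomology K2 d2 (Suc n)) (f (Suc n))"
      using x w f_ker by (simp add: con_cls connecting_def)
  next
    fix X assume X: "X \<in> kernel (cohomology K d (Suc n))
        (cohomology K1 d1 (Suc n) \<times>\<times> cohomology K2 d2 (Suc n)) (f (Suc n))"
    then obtain x where x: "x \<in> cocycles K d (Suc n)" "X = R.cls (Suc n) x"
      by (auto simp: kernel_def R.carrier_cohomology)
    then obtain w x' where wx: "connecting n w x'" "R.cls (Suc n) x' = X"
      using exact_at_union X f_ker by blast
    then have "X = con.coset_map n (C.cls n w)" by (simp add: con_cls)
    moreover have "C.cls n w \<in> carrier (cohomology KC dC n)"
      using wx by (simp add: C.carrier_cohomology connecting_def)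
    ultimately show "X \<in> con.coset_map n ` carrier (cohomology KC dC n)" by blast
  qed
  have 4: "kernel (cohomology K d 0) (cohomology K1 d1 0 \<times>\<times> cohomology K2 d2 0) (f 0) =
    {\<one>\<^bsub>cohomology K d 0\<^esub>}"
  proof (intro equalityI subsetI)
    fix X assume X: "X \<in> kernel (cohomology K d 0) (cohomology K1 d1 0 \<times>\<times> cohomology K2 d2 0) (f 0)"
    then obtain x where x: "x \<in> cocycles K d 0" "X = R.cls 0 x"
      by (auto simp: kernel_def R.carrier_cohomology)
    then have "r1 0 x = \<one>\<^bsub>K1 0\<^esub>" "r2 0 x = \<one>\<^bsub>K2 0\<^esub>"
      using X f_ker by (auto simp: coboundaries_def)
    then have "x = \<one>\<^bsub>K 0\<^esub>"
      using x by (intro joint_inj[where n = 0]) (auto simp: R.cocycles_iff)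
    then show "X \<in> {\<one>\<^bsub>cohomology K d 0\<^esub>}"
      using x R.cls_eq_one_iff[of x 0] by (simp add: coboundaries_def)
  next
    fix X assume "X \<in> {\<one>\<^bsub>cohomology K d 0\<^esub>}"
    then show "X \<in> kernel (cohomology K d 0) (cohomology K1 d1 0 \<times>\<times> cohomology K2 d2 0) (f 0)"
      using group_hom.hom_one[OF hf[of 0]] monoid.one_closed[OF group.is_monoid[OF grpR[of 0]]]
      by (simp add: kernel_def)
  qed
  show ?thesis
    unfolding long_exact_sequence_def
    by (intro exI[of _ f] exI[of _ g] exI[of _ con.coset_map] conjI allI) (fact hf hg hcon 1 2 3 4)+
qed

end

section \<open>Cochains on based complexes of free abelian groups\<close>

lemma comm_group_hom_group:
  assumes "group M" "comm_group G"
  shows "comm_group (hom_group M G)"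
proof -
  interpret M: group M by fact
  interpret G: comm_group G by fact
  show ?thesis
  proof (rule comm_groupI)
    fix f g assume "f \<in> carrier (hom_group M G)" "g \<in> carrier (hom_group M G)"
    then have fg: "f \<in> hom M G" "g \<in> hom M G" by (auto simp: hom_group_def)
    then show "f \<otimes>\<^bsub>hom_group M G\<^esub> g \<in> carrier (hom_group M G)"
      by (auto simp: hom_group_def hom_def G.m_ac Pi_iff)
    show "f \<otimes>\<^bsub>hom_group M G\<^esub> g = g \<otimes>\<^bsub>hom_group M G\<^esub> f"
      using hom_in_carrier[OF fg(1)] hom_in_carrier[OF fg(2)]
      by (auto simp: hom_group_def G.m_comm restrict_def)
  next
    show "\<one>\<^bsub>hom_group M G\<^esub> \<in> carrier (hom_group M G)"
      by (auto simp: hom_group_def hom_def)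
  next
    fix f g h assume "f \<in> carrier (hom_group M G)" "g \<in> carrier (hom_group M G)"
      "h \<in> carrier (hom_group M G)"
    then have "f \<in> hom M G" "g \<in> hom M G" "h \<in> hom M G" by (auto simp: hom_group_def)
    from this[THEN hom_in_carrier]
    show "f \<otimes>\<^bsub>hom_group M G\<^esub> g \<otimes>\<^bsub>hom_group M G\<^esub> h = f \<otimes>\<^bsub>hom_group M G\<^esub> (g \<otimes>\<^bsub>hom_group M G\<^esub> h)"
      by (auto simp: hom_group_def restrict_def G.m_assoc)
  next
    fix f assume "f \<in> carrier (hom_group M G)"
    then have f: "f \<in> hom M G" "f \<in> extensional (carrier M)" by (auto simp: hom_group_def)
    show "\<one>\<^bsub>hom_group M G\<^esub> \<otimes>\<^bsub>hom_group M G\<^esub> f = f"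
      using f hom_in_carrier[OF f(1)]
      by (auto simp: hom_group_def restrict_def extensional_def)
    let ?g = "\<lambda>x\<in>carrier M. inv\<^bsub>G\<^esub> f x"
    have "?g \<in> carrier (hom_group M G)"
      using f hom_in_carrier[OF f(1)] hom_mult[OF f(1)]
      by (auto simp: hom_group_def hom_def G.inv_mult)
    moreover have "?g \<otimes>\<^bsub>hom_group M G\<^esub> f = \<one>\<^bsub>hom_group M G\<^esub>"
      using hom_in_carrier[OF f(1)] by (auto simp: hom_group_def restrict_def)
    ultimately show "\<exists>g\<in>carrier (hom_group M G). g \<otimes>\<^bsub>hom_group M G\<^esub> f = \<one>\<^bsub>hom_group M G\<^esub>" by blast
  qed
qed

definition cochains :: "(nat \<Rightarrow> 's set) \<Rightarrow> ('g, 'm) monoid_scheme \<Rightarrow> nat \<Rightarrow> (('s \<Rightarrow>\<^sub>0 int) \<Rightarrow> 'g) monoid" where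
  "cochains X G n = hom_group (free_Abelian_group (X n)) G"

definition coboundary ::
  "(nat \<Rightarrow> 's set) \<Rightarrow> ('s \<Rightarrow> 's \<Rightarrow>\<^sub>0 int) \<Rightarrow> nat \<Rightarrow> (('s \<Rightarrow>\<^sub>0 int) \<Rightarrow> 'g) \<Rightarrow> ('s \<Rightarrow>\<^sub>0 int) \<Rightarrow> 'g" where
  "coboundary X bd n f = compose (carrier (free_Abelian_group (X (Suc n)))) f (frag_extend bd)"

lemma coboundary_cong:
  assumes "\<And>n s. s \<in> X (Suc n) \<Longrightarrow> bd s = bd' s"
  shows "coboundary X bd = coboundary X bd'"
proof (intro ext)
  fix n and f :: "('a \<Rightarrow>\<^sub>0 int) \<Rightarrow> 'b" and c
  have "frag_extend bd c = frag_extend bd' c" if "Poly_Mapping.keys c \<subseteq> X (Suc n)"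
    using that assms by (intro frag_extend_eq) blast
  then show "coboundary X bd n f c = coboundary X bd' n f c"
    by (simp add: coboundary_def compose_def)
qed

lemma carrier_cochains:
  "f \<in> carrier (cochains X G n) \<longleftrightarrow>
    f \<in> hom (free_Abelian_group (X n)) G \<and> f \<in> extensional (carrier (free_Abelian_group (X n)))"
  by (auto simp: cochains_def hom_group_def)

lemma cochains_mult:
  "f \<otimes>\<^bsub>cochains X G n\<^esub> g = (\<lambda>x\<in>carrier (free_Abelian_group (X n)). f x \<otimes>\<^bsub>G\<^esub> g x)"
  by (simp add: cochains_def hom_group_def)

lemma cochains_one:
  "\<one>\<^bsub>cochains X G n\<^esub> = (\<lambda>x\<in>carrier (free_Abelian_group (X n)). \<one>\<^bsub>G\<^esub>)"
  by (simp add: cochains_def hom_group_def)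

lemma hom_free_Abelian_group_eqI:
  assumes "group G" "f \<in> hom (free_Abelian_group S) G" "g \<in> hom (free_Abelian_group S) G"
    and eq: "\<And>s. s \<in> S \<Longrightarrow> f (frag_of s) = g (frag_of s)" and c: "Poly_Mapping.keys c \<subseteq> S"
  shows "f c = g c"
proof -
  have f: "group_hom (free_Abelian_group S) G f" and g: "group_hom (free_Abelian_group S) G g"
    using assms by (simp_all add: group_hom_def group_hom_axioms_def)
  show ?thesis
  proof (rule free_Abelian_group_induct[OF c])
    show "f 0 = g 0"
      using group_hom.hom_one[OF f] group_hom.hom_one[OF g] by simp
  next
    fix x y assume xy: "Poly_Mapping.keys x \<subseteq> S" "Poly_Mapping.keys y \<subseteq> S" "f x = g x" "f y = g y"
    have "h (x - y) = h x \<otimes>\<^bsub>G\<^esub> inv\<^bsub>G\<^esub> h y" if "group_hom (free_Abelian_group S) G h" for h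
      using group_hom.hom_mult[OF that, of x "- y"] group_hom.hom_inv[OF that, of y] xy by simp
    from this[OF f] this[OF g] show "f (x - y) = g (x - y)" using xy by simp
  qed (use eq in auto)
qed

lemma cochain_extend:
  assumes "comm_group G" "\<And>s. s \<in> X n \<Longrightarrow> v s \<in> carrier G"
  shows "\<exists>h\<in>carrier (cochains X G n). \<forall>s\<in>X n. h (frag_of s) = v s"
proof -
  have "v ` X n \<subseteq> carrier G" using assms by auto
  then obtain h where h: "h \<in> hom (free_Abelian_group (X n)) G" "\<And>s. s \<in> X n \<Longrightarrow> h (frag_of s) = v s"
    using comm_group.free_Abelian_group_universal[OF assms(1)] by metis
  let ?h = "restrict h (carrier (free_Abelian_group (X n)))"
  have "?h \<in> carrier (cochains X G n)"
    using h(1) group.is_monoid[OF group_free_Abelian_group, THEN monoid.m_closed, of _ "X n"]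
    by (auto simp: carrier_cochains hom_def)
  moreover have "?h (frag_of s) = v s" if "s \<in> X n" for s
    using h that by simp
  ultimately show ?thesis by blast
qed

lemma cochains_eqI:
  assumes "group G" "f \<in> carrier (cochains X G n)" "g \<in> carrier (cochains X G n)"
    "\<And>s. s \<in> X n \<Longrightarrow> f (frag_of s) = g (frag_of s)"
  shows "f = g"
proof (rule extensionalityI)
  show "f \<in> extensional (carrier (free_Abelian_group (X n)))"
    "g \<in> extensional (carrier (free_Abelian_group (X n)))"
    using assms by (auto simp: carrier_cochains)
  show "f x = g x" if "x \<in> carrier (free_Abelian_group (X n))" for x
    by (rule hom_free_Abelian_group_eqI[of G f "X n" g]) (use that assms in \<open>auto simp: carrier_cochains\<close>)
qed

lemma restrict_cochain:
  assumes "f \<in> carrier (cochains X G n)" "Y n \<subseteq> X n"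
  shows "restrict f (carrier (free_Abelian_group (Y n))) \<in> carrier (cochains Y G n)"
proof -
  have "x + y \<in> carrier (free_Abelian_group (Y n))"
    if "x \<in> carrier (free_Abelian_group (Y n))" "y \<in> carrier (free_Abelian_group (Y n))" for x y
    using group.is_monoid[OF group_free_Abelian_group, THEN monoid.m_closed, OF that] by simp
  then show ?thesis
    using assms by (auto simp: carrier_cochains hom_def Pi_iff dest: subset_trans)
qed

locale based_complex =
  fixes X :: "nat \<Rightarrow> 's set" and bd :: "'s \<Rightarrow> 's \<Rightarrow>\<^sub>0 int"
  assumes bd_closed: "s \<in> X (Suc n) \<Longrightarrow> Poly_Mapping.keys (bd s) \<subseteq> X n"
    and bd_bd: "s \<in> X (Suc (Suc n)) \<Longrightarrow> frag_extend bd (bd s) = 0"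
begin

lemma frag_extend_bd_closed:
  assumes "Poly_Mapping.keys c \<subseteq> X (Suc n)"
  shows "Poly_Mapping.keys (frag_extend bd c) \<subseteq> X n"
proof -
  have "Poly_Mapping.keys (bd s) \<subseteq> X n" if "s \<in> Poly_Mapping.keys c" for s
    using that assms bd_closed by blast
  then show ?thesis using keys_frag_extend[of bd c] by blast
qed

lemma frag_extend_bd_bd:
  assumes "Poly_Mapping.keys c \<subseteq> X (Suc (Suc n))"
  shows "frag_extend bd (frag_extend bd c) = 0"
  by (rule free_Abelian_group_induct[OF assms]) (auto simp: frag_extend_diff bd_bd)

lemma coboundary_closed:
  assumes "f \<in> carrier (cochains X G n)"
  shows "coboundary X bd n f \<in> carrier (cochains X G (Suc n))"
proof -
  have "x + y \<in> carrier (free_Abelian_group (X (Suc n)))"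
    if "x \<in> carrier (free_Abelian_group (X (Suc n)))" "y \<in> carrier (free_Abelian_group (X (Suc n)))" for x y
    using group.is_monoid[OF group_free_Abelian_group, THEN monoid.m_closed, OF that] by simp
  then show ?thesis
    using assms frag_extend_bd_closed
    by (auto simp: carrier_cochains coboundary_def hom_def compose_def Pi_iff frag_extend_add)
qed

lemma cochain_complex:
  assumes G: "comm_group G"
  shows "cochain_complex (cochains X G) (coboundary X bd)"
proof (rule cochain_complex.intro)
  fix n
  show "comm_group (cochains X G n)"
    unfolding cochains_def by (rule comm_group_hom_group[OF group_free_Abelian_group G])
  show "coboundary X bd n \<in> hom (cochains X G n) (cochains X G (Suc n))"
  proof (rule homI)
    fix f g assume "f \<in> carrier (cochains X G n)" "g \<in> carrier (cochains X G n)"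
    show "coboundary X bd n (f \<otimes>\<^bsub>cochains X G n\<^esub> g) =
        coboundary X bd n f \<otimes>\<^bsub>cochains X G (Suc n)\<^esub> coboundary X bd n g"
      using frag_extend_bd_closed
      by (auto simp: cochains_mult coboundary_def compose_def restrict_def)
  qed (rule coboundary_closed)
  fix f assume f: "f \<in> carrier (cochains X G n)"
  have "group_hom (free_Abelian_group (X n)) G f"
    using f G by (auto simp: carrier_cochains group_hom_def group_hom_axioms_def comm_group_def)
  then have "f 0 = \<one>\<^bsub>G\<^esub>" using group_hom.hom_one by fastforce
  then show "coboundary X bd (Suc n) (coboundary X bd n f) = \<one>\<^bsub>cochains X G (Suc (Suc n))\<^esub>"
    using frag_extend_bd_closed frag_extend_bd_bd
    by (auto simp: cochains_one coboundary_def compose_def restrict_def)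
qed

end

theorem mayer_vietoris_based_complexes:
  assumes X1: "based_complex X1 bd" and X2: "based_complex X2 bd" and G: "comm_group G"
  shows "long_exact_sequence
    (cohomology (cochains (\<lambda>n. X1 n \<union> X2 n) G) (coboundary (\<lambda>n. X1 n \<union> X2 n) bd))
    (\<lambda>n. cohomology (cochains X1 G) (coboundary X1 bd) n \<times>\<times>
         cohomology (cochains X2 G) (coboundary X2 bd) n)
    (cohomology (cochains (\<lambda>n. X1 n \<inter> X2 n) G) (coboundary (\<lambda>n. X1 n \<inter> X2 n) bd))"
proof -
  let ?X = "\<lambda>n. X1 n \<union> X2 n" and ?Y = "\<lambda>n. X1 n \<inter> X2 n"
  have X: "based_complex ?X bd" and Y: "based_complex ?Y bd"
    using X1 X2 unfolding based_complex_def by blast+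
  define res where "res Y n f = restrict f (carrier (free_Abelian_group (Y n)))"
    for Y :: "nat \<Rightarrow> 'a set" and n and f :: "('a \<Rightarrow>\<^sub>0 int) \<Rightarrow> 'b"
  have grpG: "group G" using G by (simp add: comm_group_def)
  have res_closed: "res Y' n f \<in> carrier (cochains Y' G n)"
    if "f \<in> carrier (cochains X' G n)" "Y' n \<subseteq> X' n" for X' Y' n f
    unfolding res_def using restrict_cochain that .
  have res_hom: "res Y' n \<in> hom (cochains X' G n) (cochains Y' G n)" if "Y' n \<subseteq> X' n" for X' Y' n
  proof (rule homI)
    fix f g assume "f \<in> carrier (cochains X' G n)" "g \<in> carrier (cochains X' G n)"
    show "res Y' n (f \<otimes>\<^bsub>cochains X' G n\<^esub> g) = res Y' n f \<otimes>\<^bsub>cochains Y' G n\<^esub> res Y' n g"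
      using subset_trans[OF _ that] by (simp add: cochains_mult res_def restrict_def fun_eq_iff)
  qed (rule res_closed[where X' = X' and Y' = Y' and n = n, OF _ that])
  have res_d: "res Y' (Suc n) (coboundary X' bd n f) = coboundary Y' bd n (res Y' n f)"
    if "based_complex Y' bd" "Y' (Suc n) \<subseteq> X' (Suc n)" for X' Y' n f
    using subset_trans[OF _ that(2)] based_complex.frag_extend_bd_closed[OF that(1)]
    by (simp add: res_def coboundary_def compose_def restrict_def fun_eq_iff)
  have res_of: "res Y' n f (frag_of s) = f (frag_of s)" if "s \<in> Y' n" for Y' n f s
    using that by (simp add: res_def)
  have val: "f (frag_of s) \<in> carrier G" if "f \<in> carrier (cochains X' G n)" "s \<in> X' n" for f X' n s
    using that by (auto simp: carrier_cochains intro: hom_in_carrier)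
  interpret mayer_vietoris "cochains ?X G" "coboundary ?X bd" "cochains X1 G" "coboundary X1 bd"
    "cochains X2 G" "coboundary X2 bd" "cochains ?Y G" "coboundary ?Y bd"
    "res X1" "res X2" "res ?Y" "res ?Y"
  proof (intro mayer_vietoris.intro mayer_vietoris_axioms.intro
      based_complex.cochain_complex[OF _ G] X X1 X2 Y res_hom res_d)
    fix f n assume "f \<in> carrier (cochains ?X G n)"
    show "res ?Y n (res X1 n f) = res ?Y n (res X2 n f)"
      by (auto simp: res_def restrict_def)
  next
    fix f g n assume f: "f \<in> carrier (cochains ?X G n)" and g: "g \<in> carrier (cochains ?X G n)"
      and eq: "res X1 n f = res X1 n g" "res X2 n f = res X2 n g"
    show "f = g"
    proof (rule cochains_eqI[OF grpG f g])
      fix s assume "s \<in> X1 n \<union> X2 n"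
      then show "f (frag_of s) = g (frag_of s)"
        using eq res_of by (metis Un_iff)
    qed
  next
    fix f g n assume f: "f \<in> carrier (cochains X1 G n)" and g: "g \<in> carrier (cochains X2 G n)"
      and eq: "res ?Y n f = res ?Y n g"
    define v where "v s = (if s \<in> X1 n then f (frag_of s) else g (frag_of s))" for s
    have vg: "v s = g (frag_of s)" if "s \<in> X2 n" for s
      using that res_of[of s ?Y n f] res_of[of s ?Y n g] eq by (auto simp: v_def)
    have "v s \<in> carrier G" if "s \<in> ?X n" for s
      using that val[OF f] val[OF g] by (auto simp: v_def)
    then obtain h where h: "h \<in> carrier (cochains ?X G n)" "\<And>s. s \<in> ?X n \<Longrightarrow> h (frag_of s) = v s"
      using cochain_extend[OF G, of ?X n v] by blast
    have "res X1 n h = f"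
      by (rule cochains_eqI[OF grpG res_closed[OF h(1)] f]) (auto simp: res_of h v_def)
    moreover have "res X2 n h = g"
      by (rule cochains_eqI[OF grpG res_closed[OF h(1)] g]) (auto simp: res_of h vg)
    ultimately show "\<exists>h\<in>carrier (cochains ?X G n). res X1 n h = f \<and> res X2 n h = g"
      using h by blast
  next
    fix f n assume f: "f \<in> carrier (cochains ?Y G n)"
    define v where "v s = (if s \<in> ?Y n then f (frag_of s) else \<one>\<^bsub>G\<^esub>)" for s
    have "v s \<in> carrier G" for s
      using val[OF f] monoid.one_closed[OF group.is_monoid[OF grpG]] by (simp add: v_def)
    then obtain h where h: "h \<in> carrier (cochains X1 G n)" "\<And>s. s \<in> X1 n \<Longrightarrow> h (frag_of s) = v s"
      using cochain_extend[OF G, of X1 n v] by blast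
    have "res ?Y n h = f"
      by (rule cochains_eqI[OF grpG res_closed[OF h(1)] f]) (auto simp: res_of h v_def)
    then show "\<exists>h\<in>carrier (cochains X1 G n). res ?Y n h = f" using h by blast
  qed auto
  show ?thesis by (rule long_exact_sequence)
qed

section \<open>Face maps of the bar construction\<close>

fun face :: "('r \<Rightarrow> 'r \<Rightarrow> 'r) \<Rightarrow> nat \<Rightarrow> 'r list \<Rightarrow> 'r list" where
  "face m 0 s = tl s"
| "face m (Suc j) [] = []"
| "face m (Suc 0) [x] = []"
| "face m (Suc 0) (x # y # s) = m x y # s"
| "face m (Suc (Suc j)) (x # s) = x # face m (Suc j) s"

lemma length_face: "s \<noteq> [] \<Longrightarrow> j \<le> length s \<Longrightarrow> length (face m j s) = length s - 1"
  by (induction m j s rule: face.induct) (auto simp flip: length_greater_0_conv)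

lemma face_last: "s \<noteq> [] \<Longrightarrow> face m (length s) s = butlast s"
proof (induction s)
  case (Cons x s)
  then show ?case by (cases s) auto
qed simp

lemma face_middle:
  "1 \<le> j \<Longrightarrow> j < length s \<Longrightarrow>
    face m j s = take (j - 1) s @ m (s ! (j - 1)) (s ! j) # drop (j + 1) s"
  by (induction m j s rule: face.induct) auto

lemma face_face:
  assumes "i < j" "j \<le> length s"
    and "\<And>x y z u v. s = u @ x # y # z # v \<Longrightarrow> m (m x y) z = m x (m y z)"
  shows "face m i (face m j s) = face m (j - 1) (face m i s)"
  using assms
proof (induction s arbitrary: i j)
  case Nil
  then show ?case by simp
next
  case (Cons x s)
  show ?case
  proof (cases i)
    case 0
    then show ?thesis using Cons.prems
      by (cases "(m, j, x # s)" rule: face.cases) auto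
  next
    case i: (Suc i')
    then have "j = Suc (Suc (j - 2))" using Cons.prems(1) by simp
    then obtain j' where j: "j = Suc (Suc j')" by blast
    then obtain y t where s: "s = y # t" using Cons.prems(2) by (cases s) auto
    show ?thesis
    proof (cases i')
      case 0
      show ?thesis
      proof (cases j')
        case j0: 0
        show ?thesis
        proof (cases t)
          case (Cons z v)
          have "m (m x y) z = m x (m y z)"
            using Cons.prems(3)[of "[]" x y z v] s Cons by simp
          then show ?thesis using i j s 0 j0 Cons by simp
        qed (use i j s 0 j0 in simp)
      next
        case (Suc j'')
        then show ?thesis using i j s 0 by simp
      qed
    next
      case (Suc i'')
      have "face m (Suc i'') (face m (Suc j') s) = face m (Suc j' - 1) (face m (Suc i'') s)"
      proof (rule Cons.IH)
        fix a b c u v assume "s = u @ a # b # c # v"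
        then show "m (m a b) c = m a (m b c)" using Cons.prems(3)[of "x # u" a b c v] by simp
      qed (use Cons.prems i j Suc in auto)
      moreover obtain k where "j' = Suc k"
        using Cons.prems(1) i j Suc by (cases j') auto
      ultimately show ?thesis using i j Suc by simp
    qed
  qed
qed

lemma alternating_double_sum:
  fixes g :: "nat \<Rightarrow> nat \<Rightarrow> 'x::ab_group_add"
  assumes "\<And>i j. i < j \<Longrightarrow> j \<le> n \<Longrightarrow> g i j = - g (j - 1) i"
  shows "(\<Sum>j\<le>n. \<Sum>i<n. g i j) = 0"
proof -
  let ?A = "{(j, i). i < j \<and> j \<le> n}" and ?B = "{(j, i). j \<le> i \<and> i < n}"
  have fin: "finite ?A" "finite ?B"
    by (rule finite_subset[of _ "{..n} \<times> {..n}"]; auto)+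
  have "(\<Sum>j\<le>n. \<Sum>i<n. g i j) = (\<Sum>(j, i)\<in>{..n} \<times> {..<n}. g i j)"
    by (simp add: sum.cartesian_product)
  also have "{..n} \<times> {..<n} = ?A \<union> ?B" by auto
  also have "(\<Sum>(j, i)\<in>?A \<union> ?B. g i j) = (\<Sum>(j, i)\<in>?A. g i j) + (\<Sum>(j, i)\<in>?B. g i j)"
    by (rule sum.union_disjoint[OF fin]) auto
  also have "(\<Sum>(j, i)\<in>?A. g i j) = (\<Sum>(j, i)\<in>?B. - g i j)"
    by (rule sum.reindex_bij_witness[of _ "\<lambda>(j, i). (Suc i, j)" "\<lambda>(j, i). (i, j - 1)"])
      (use assms in auto)
  finally show ?thesis by (simp add: sum_negf case_prod_unfold)
qed

definition bar_boundary :: "('r \<Rightarrow> 'r \<Rightarrow> 'r) \<Rightarrow> 'r list \<Rightarrow> ('v, 'r) sc_simplex \<Rightarrow>\<^sub>0 int" where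
  "bar_boundary m s = (\<Sum>j\<le>length s. frag_cmul ((-1) ^ j) (frag_of (Tuple (face m j s))))"

lemma bar_boundary_unfold:
  assumes "length s \<ge> 2"
  shows "bar_boundary m s =
    frag_of (Tuple (tl s)) +
    (\<Sum>j = 1..length s - 1. frag_cmul ((-1) ^ j)
       (frag_of (Tuple (take (j - 1) s @ m (s ! (j - 1)) (s ! j) # drop (j + 1) s)))) +
    frag_cmul ((-1) ^ length s) (frag_of (Tuple (butlast s)))"
proof -
  let ?t = "\<lambda>j. frag_cmul ((-1) ^ j) (frag_of (Tuple (face m j s)))"
  have s: "s \<noteq> []" using assms by auto
  have "length s = Suc (Suc (length s - 2))" using assms by simp
  then obtain n where n: "length s = Suc (Suc n)" by blast
  have "{..length s} = insert 0 (insert (length s) {1..length s - 1})" using n by auto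
  then have "bar_boundary m s = ?t 0 + (?t (length s) + (\<Sum>j = 1..length s - 1. ?t j))"
    unfolding bar_boundary_def using n by simp
  also have "(\<Sum>j = 1..length s - 1. ?t j) = (\<Sum>j = 1..length s - 1. frag_cmul ((-1) ^ j)
       (frag_of (Tuple (take (j - 1) s @ m (s ! (j - 1)) (s ! j) # drop (j + 1) s))))"
    by (rule sum.cong) (use n in \<open>auto simp: face_middle\<close>)
  finally show ?thesis by (simp add: face_last[OF s] add_ac)
qed

lemma bar_boundary_bar_boundary:
  assumes "length s \<ge> 1"
    and assoc: "\<And>x y z u v. s = u @ x # y # z # v \<Longrightarrow> m (m x y) z = m x (m y z)"
  shows "(\<Sum>j\<le>length s. frag_cmul ((-1) ^ j) (bar_boundary m (face m j s))) = 0"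
proof -
  let ?g = "\<lambda>i j. frag_cmul ((-1) ^ (i + j)) (frag_of (Tuple (face m i (face m j s))))"
  have s: "s \<noteq> []" using assms by auto
  have "(\<Sum>j\<le>length s. frag_cmul ((-1) ^ j) (bar_boundary m (face m j s))) =
      (\<Sum>j\<le>length s. \<Sum>i<length s. ?g i j)"
  proof (rule sum.cong)
    fix j assume "j \<in> {..length s}"
    then have "{..length (face m j s)} = {..<length s}"
      using assms by (auto simp: length_face[OF s])
    then show "frag_cmul ((-1) ^ j) (bar_boundary m (face m j s)) = (\<Sum>i<length s. ?g i j)"
      by (simp add: bar_boundary_def frag_cmul_sum power_add mult.commute)
  qed simp
  also have "\<dots> = 0"
  proof (rule alternating_double_sum)
    fix i j assume ij: "i < j" "j \<le> length s"
    have "(-1::int) ^ (i + j) = - ((-1) ^ (j - 1 + i))"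
      using ij by (cases j) (auto simp: add.commute)
    then show "?g i j = - ?g (j - 1) i"
      using face_face[OF ij assoc] by simp
  qed
  finally show ?thesis .
qed

section \<open>Algebras over a field and their corners\<close>

locale field_algebra = ring R for R :: "('k::field, 'r, 'm) module_scheme" (structure) +
  assumes smult_closed [simp]: "a \<in> carrier R \<Longrightarrow> c \<odot> a \<in> carrier R"
    and smult_l_distr: "a \<in> carrier R \<Longrightarrow> (c + d) \<odot> a = c \<odot> a \<oplus> d \<odot> a"
    and smult_r_distr: "a \<in> carrier R \<Longrightarrow> b \<in> carrier R \<Longrightarrow> c \<odot> (a \<oplus> b) = c \<odot> a \<oplus> c \<odot> b"
    and smult_smult: "a \<in> carrier R \<Longrightarrow> c \<odot> (d \<odot> a) = (c * d) \<odot> a"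
    and smult_one [simp]: "a \<in> carrier R \<Longrightarrow> 1 \<odot> a = a"
    and smult_mult: "a \<in> carrier R \<Longrightarrow> b \<in> carrier R \<Longrightarrow> (c \<odot> a) \<otimes> b = c \<odot> (a \<otimes> b)"
    and mult_smult: "a \<in> carrier R \<Longrightarrow> b \<in> carrier R \<Longrightarrow> a \<otimes> (c \<odot> b) = c \<odot> (a \<otimes> b)"
begin

lemma smult_zero_left [simp]:
  assumes "a \<in> carrier R" shows "0 \<odot> a = \<zero>"
proof -
  have "0 \<odot> a \<oplus> 0 \<odot> a = 0 \<odot> a" using smult_l_distr[OF assms, of 0 0] by simp
  then show ?thesis using assms add.l_cancel_one[of "0 \<odot> a" "0 \<odot> a"] by simp
qed

lemma smult_zero_right [simp]: "c \<odot> \<zero> = \<zero>"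
proof -
  have "c \<odot> \<zero> \<oplus> c \<odot> \<zero> = c \<odot> \<zero>" using smult_r_distr[of \<zero> \<zero> c] by simp
  then show ?thesis using add.l_cancel_one[of "c \<odot> \<zero>" "c \<odot> \<zero>"] by simp
qed

lemma smult_eq_zero_iff:
  assumes "a \<in> carrier R" shows "c \<odot> a = \<zero> \<longleftrightarrow> c = 0 \<or> a = \<zero>"
proof -
  have "a = \<zero>" if "c \<odot> a = \<zero>" "c \<noteq> 0"
    using smult_smult[OF assms, of "inverse c" c] that assms by simp
  then show ?thesis using assms by auto
qed

lemma smult_eq_iff:
  assumes "a \<in> carrier R" "b \<in> carrier R" "c \<noteq> 0"
  shows "c \<odot> a = b \<longleftrightarrow> a = inverse c \<odot> b"
  using assms by (auto simp: smult_smult)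

lemma lin_comb_closed [simp]:
  "Poly_Mapping.keys c \<subseteq> carrier R \<Longrightarrow> lin_comb R c \<in> carrier R"
  unfolding lin_comb_def by (rule finsum_closed) auto

lemma lin_comb_eq_sum:
  assumes "finite A" "Poly_Mapping.keys c \<subseteq> A" "A \<subseteq> carrier R"
  shows "lin_comb R c = (\<Oplus>\<sigma>\<in>A. Poly_Mapping.lookup c \<sigma> \<odot> \<sigma>)"
  unfolding lin_comb_def
  by (rule add.finprod_mono_neutral_cong_left)
    (use assms in \<open>auto simp: in_keys_iff subset_iff\<close>)

lemma lin_comb_zero [simp]: "lin_comb R 0 = \<zero>"
  by (simp add: lin_comb_def)

lemma lin_comb_single [simp]:
  assumes "a \<in> carrier R" shows "lin_comb R (Poly_Mapping.single a c) = c \<odot> a"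
  using lin_comb_eq_sum[of "{a}" "Poly_Mapping.single a c"] assms by simp

lemma lin_comb_add:
  assumes "Poly_Mapping.keys c \<subseteq> carrier R" "Poly_Mapping.keys d \<subseteq> carrier R"
  shows "lin_comb R (c + d) = lin_comb R c \<oplus> lin_comb R d"
proof -
  let ?A = "Poly_Mapping.keys c \<union> Poly_Mapping.keys d"
  have A: "finite ?A" "?A \<subseteq> carrier R" using assms by auto
  have "lin_comb R (c + d) = (\<Oplus>\<sigma>\<in>?A. Poly_Mapping.lookup c \<sigma> \<odot> \<sigma> \<oplus> Poly_Mapping.lookup d \<sigma> \<odot> \<sigma>)"
    unfolding lin_comb_eq_sum[OF A(1) keys_add A(2)]
    by (rule finsum_cong') (use A in \<open>auto simp: lookup_add smult_l_distr subset_iff\<close>)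
  also have "\<dots> = (\<Oplus>\<sigma>\<in>?A. Poly_Mapping.lookup c \<sigma> \<odot> \<sigma>) \<oplus> (\<Oplus>\<sigma>\<in>?A. Poly_Mapping.lookup d \<sigma> \<odot> \<sigma>)"
    by (rule finsum_addf) (use A in auto)
  also have "\<dots> = lin_comb R c \<oplus> lin_comb R d"
    using lin_comb_eq_sum[OF A(1) _ A(2)] by simp
  finally show ?thesis .
qed

lemma k_basis_unique:
  assumes "k_basis R V B" "V \<subseteq> carrier R" "Poly_Mapping.keys c \<subseteq> B" "Poly_Mapping.keys d \<subseteq> B"
    "lin_comb R c = lin_comb R d"
  shows "c = d"
proof -
  have B: "B \<subseteq> carrier R" using assms by (auto simp: k_basis_def)
  have cd: "Poly_Mapping.keys (c - d) \<subseteq> B" using keys_diff[of c d] assms(3,4) by blast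
  have "lin_comb R (c - d) \<oplus> lin_comb R d = lin_comb R c"
    using lin_comb_add[of "c - d" d] cd B assms by auto
  then have "lin_comb R (c - d) = \<zero>"
    using assms(3-5) B cd add.r_cancel_one[of "lin_comb R d" "lin_comb R (c - d)"] by auto
  then have "c - d = 0" using assms cd by (auto simp: k_basis_def)
  then show ?thesis by simp
qed

lemma k_basis_nonzero:
  assumes "k_basis R V B" "V \<subseteq> carrier R" "b \<in> B"
  shows "b \<noteq> \<zero>"
proof
  assume "b = \<zero>"
  then have "Poly_Mapping.single b (1::'k) = 0"
    by (intro k_basis_unique[OF assms(1,2)]) (use assms in \<open>auto simp: k_basis_def\<close>)
  then show False by (metis lookup_single_eq lookup_zero zero_neq_one)
qed

lemma k_basis_multiples:
  assumes "k_basis R V B" "V \<subseteq> carrier R" "b \<in> B" "b' \<in> B" "c \<odot> b = c' \<odot> b'" "c \<noteq> 0"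
  shows "b = b'"
proof -
  have b: "b \<in> carrier R" "b' \<in> carrier R" using assms by (auto simp: k_basis_def)
  have "Poly_Mapping.single b c = Poly_Mapping.single b' c'"
    by (rule k_basis_unique[OF assms(1,2)]) (use assms b in \<open>auto split: if_splits\<close>)
  then show ?thesis using assms(6) by (metis lookup_single_eq lookup_single_not_eq)
qed

lemma peirce_iff:
  assumes "e \<in> carrier R" "f \<in> carrier R" "e \<otimes> e = e" "f \<otimes> f = f"
  shows "a \<in> peirce R e f \<longleftrightarrow> a \<in> carrier R \<and> e \<otimes> a = a \<and> a \<otimes> f = a"
proof
  assume "a \<in> peirce R e f"
  then obtain b where b: "b \<in> carrier R" "a = e \<otimes> b \<otimes> f" by (auto simp: peirce_def)
  have "e \<otimes> (e \<otimes> b \<otimes> f) = e \<otimes> b \<otimes> f"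
    using b(1) assms m_assoc[of e e "b \<otimes> f"] m_assoc[of e b f] by simp
  moreover have "e \<otimes> b \<otimes> f \<otimes> f = e \<otimes> b \<otimes> f"
    using b(1) assms m_assoc[of "e \<otimes> b" f f] by simp
  ultimately show "a \<in> carrier R \<and> e \<otimes> a = a \<and> a \<otimes> f = a"
    using b assms by simp
next
  assume "a \<in> carrier R \<and> e \<otimes> a = a \<and> a \<otimes> f = a"
  then have "a \<in> carrier R" "a = e \<otimes> a \<otimes> f" by simp_all
  then show "a \<in> peirce R e f" unfolding peirce_def by blast
qed

lemma corner_simps [simp]:
  "carrier (corner R e) = peirce R e e" "\<one>\<^bsub>corner R e\<^esub> = e" "\<zero>\<^bsub>corner R e\<^esub> = \<zero>"
  "a \<otimes>\<^bsub>corner R e\<^esub> b = a \<otimes> b" "a \<oplus>\<^bsub>corner R e\<^esub> b = a \<oplus> b" "c \<odot>\<^bsub>corner R e\<^esub> a = c \<odot> a"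
  by (simp_all add: corner_def)

lemma abelian_monoid_corner:
  assumes "e \<in> carrier R" "e \<otimes> e = e"
  shows "abelian_monoid (corner R e)"
  by (rule abelian_monoidI) (auto simp: peirce_iff assms l_distr r_distr a_ac)

lemma finsum_corner:
  assumes "e \<in> carrier R" "e \<otimes> e = e" "f \<in> A \<rightarrow> peirce R e e"
  shows "finsum (corner R e) f A = finsum R f A"
proof (cases "finite A")
  case True
  interpret C: abelian_monoid "corner R e" by (rule abelian_monoid_corner[OF assms(1,2)])
  show ?thesis
    using True assms(3)
  proof (induction A)
    case (insert x A)
    have "f \<in> A \<rightarrow> carrier R" "f x \<in> carrier R"
      using insert.prems by (auto simp: Pi_iff peirce_iff assms)
    moreover have "f \<in> A \<rightarrow> carrier (corner R e)" "f x \<in> carrier (corner R e)"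
      using insert.prems by auto
    ultimately show ?case using insert by simp
  qed simp
next
  case False
  then show ?thesis
    by (simp add: finsum_infinite abelian_monoid.finsum_infinite[OF abelian_monoid_corner[OF assms(1,2)]])
qed

end

section \<open>Algebras presented by a quiver\<close>

text \<open>
  \<open>J\<close> stands for the image of the arrow ideal; it is there to show that a product of two
  nonstationary basis elements is never stationary.
\<close>

locale quiver_algebra = field_algebra R for R :: "('k::field, 'r, 'm) module_scheme" (structure) +
  fixes Q :: "('v, 'a) pre_digraph" and \<gamma> :: "('v, 'a) qpath \<Rightarrow> 'r" and J :: "'r set"
  assumes wf: "wf_digraph Q" and finite_verts: "finite (verts Q)"
    and path_closed: "u \<in> paths Q \<Longrightarrow> \<gamma> u \<in> carrier R"
    and path_mult: "(x, p, y) \<in> paths Q \<Longrightarrow> (y', q, z) \<in> paths Q \<Longrightarrow>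
      \<gamma> (x, p, y) \<otimes> \<gamma> (y', q, z) = (if y = y' then \<gamma> (x, p @ q, z) else \<zero>)"
    and one_eq: "\<one> = (\<Oplus>x\<in>verts Q. \<gamma> (stationary x))"
    and J_zero: "\<zero> \<in> J"
    and J_mult: "a \<in> J \<Longrightarrow> b \<in> J \<Longrightarrow> a \<otimes> b \<in> J"
    and J_smult: "a \<in> J \<Longrightarrow> c \<odot> a \<in> J"
    and path_in_J: "(x, p, y) \<in> paths Q \<Longrightarrow> p \<noteq> [] \<Longrightarrow> \<gamma> (x, p, y) \<in> J"
    and stationary_notin_J: "x \<in> verts Q \<Longrightarrow> \<gamma> (stationary x) \<notin> J"
    and arrow_nonzero: "\<alpha> \<in> arcs Q \<Longrightarrow> \<gamma> (arrow_path Q \<alpha>) \<noteq> \<zero>"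
begin

abbreviation idem :: "'v \<Rightarrow> 'r" ("\<epsilon>") where "\<epsilon> x \<equiv> \<gamma> (stationary x)"

abbreviation P :: "'v \<Rightarrow> 'v \<Rightarrow> 'r set" where "P x y \<equiv> peirce R (\<epsilon> x) (\<epsilon> y)"

definition E :: "'v set \<Rightarrow> 'r" where "E T = (\<Oplus>x\<in>T. \<epsilon> x)"

lemma stationary_path: "x \<in> verts Q \<Longrightarrow> (x, [], x) \<in> paths Q"
  by (simp add: paths_def pre_digraph.awalk_def pre_digraph.cas.simps)

lemma idem_closed [simp]: "x \<in> verts Q \<Longrightarrow> \<epsilon> x \<in> carrier R"
  by (simp add: stationary_def path_closed stationary_path)

lemma idem_mult: "x \<in> verts Q \<Longrightarrow> y \<in> verts Q \<Longrightarrow> \<epsilon> x \<otimes> \<epsilon> y = (if x = y then \<epsilon> x else \<zero>)"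
  using path_mult[of x "[]" x y "[]" y] stationary_path by (simp add: stationary_def)

lemma idem_nonzero: "x \<in> verts Q \<Longrightarrow> \<epsilon> x \<noteq> \<zero>"
  using stationary_notin_J[of x] J_zero by auto

lemma E_empty [simp]: "E {} = \<zero>"
  by (simp add: E_def)

lemma E_insert:
  assumes "finite T" "T \<subseteq> verts Q" "x \<in> verts Q" "x \<notin> T"
  shows "E (insert x T) = \<epsilon> x \<oplus> E T"
  unfolding E_def using assms by (intro finsum_insert) auto

lemma finite_subset_verts: "T \<subseteq> verts Q \<Longrightarrow> finite T"
  using finite_subset finite_verts by blast

lemma E_closed [simp]: "T \<subseteq> verts Q \<Longrightarrow> E T \<in> carrier R"
  unfolding E_def by (rule finsum_closed) auto

lemma E_verts: "E (verts Q) = \<one>"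
  by (simp add: E_def one_eq)

lemma E_idem:
  assumes "T \<subseteq> verts Q" "x \<in> verts Q"
  shows "E T \<otimes> \<epsilon> x = (if x \<in> T then \<epsilon> x else \<zero>)" "\<epsilon> x \<otimes> E T = (if x \<in> T then \<epsilon> x else \<zero>)"
proof -
  have "E T \<otimes> \<epsilon> x = (if x \<in> T then \<epsilon> x else \<zero>) \<and> \<epsilon> x \<otimes> E T = (if x \<in> T then \<epsilon> x else \<zero>)"
    using finite_subset_verts[OF assms(1)] assms(1)
  proof (induction T)
    case empty
    then show ?case using assms by simp
  next
    case (insert y T)
    then show ?case using assms(2) by (auto simp: E_insert l_distr r_distr idem_mult)
  qed
  then show "E T \<otimes> \<epsilon> x = (if x \<in> T then \<epsilon> x else \<zero>)" "\<epsilon> x \<otimes> E T = (if x \<in> T then \<epsilon> x else \<zero>)"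
    by auto
qed

lemma E_mult:
  assumes "T \<subseteq> verts Q" "U \<subseteq> verts Q"
  shows "E T \<otimes> E U = E (T \<inter> U)"
  using finite_subset_verts[OF assms(1)] assms(1)
proof (induction T)
  case empty
  then show ?case using assms by simp
next
  case (insert y T)
  have "T \<inter> U \<subseteq> verts Q" "finite (T \<inter> U)" using insert by auto
  then show ?case using insert assms(2) by (auto simp: E_insert l_distr E_idem)
qed

lemma E_Un_disjoint:
  assumes "T \<subseteq> verts Q" "U \<subseteq> verts Q" "T \<inter> U = {}"
  shows "E T \<oplus> E U = E (T \<union> U)"
  unfolding E_def
  by (rule finsum_Un_disjoint[symmetric]) (use assms finite_subset_verts in auto)

lemma E_eq_zero_iff: "T \<subseteq> verts Q \<Longrightarrow> E T = \<zero> \<longleftrightarrow> T = {}"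
proof
  assume T: "T \<subseteq> verts Q" "E T = \<zero>"
  have False if "x \<in> T" for x
    using E_idem(1)[of T x] T that idem_nonzero[of x] by auto
  then show "T = {}" by blast
qed simp

lemma E_eq_one_iff: "T \<subseteq> verts Q \<Longrightarrow> E T = \<one> \<longleftrightarrow> T = verts Q"
proof
  assume T: "T \<subseteq> verts Q" "E T = \<one>"
  have "x \<in> T" if "x \<in> verts Q" for x
    using E_idem(1)[of T x] T that idem_nonzero[of x] by (auto split: if_splits)
  then show "T = verts Q" using T by blast
qed (simp add: E_verts)

lemma P_iff: "x \<in> verts Q \<Longrightarrow> y \<in> verts Q \<Longrightarrow> a \<in> P x y \<longleftrightarrow> a \<in> carrier R \<and> \<epsilon> x \<otimes> a = a \<and> a \<otimes> \<epsilon> y = a"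
  by (rule peirce_iff) (simp_all add: idem_mult)

lemma P_subset: "x \<in> verts Q \<Longrightarrow> y \<in> verts Q \<Longrightarrow> P x y \<subseteq> carrier R"
  by (auto simp: P_iff)

lemma idem_in_P: "x \<in> verts Q \<Longrightarrow> \<epsilon> x \<in> P x x"
  by (simp add: P_iff idem_mult)

lemma P_smult: "x \<in> verts Q \<Longrightarrow> y \<in> verts Q \<Longrightarrow> a \<in> P x y \<Longrightarrow> c \<odot> a \<in> P x y"
  by (simp add: P_iff smult_mult mult_smult)

lemma P_mult:
  assumes "x \<in> verts Q" "y \<in> verts Q" "z \<in> verts Q" "a \<in> P x y" "b \<in> P y z"
  shows "a \<otimes> b \<in> P x z"
  using assms by (simp add: P_iff m_assoc) (metis m_assoc idem_closed)

lemma idem_mult_P: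
  assumes "x \<in> verts Q" "y \<in> verts Q" "z \<in> verts Q" "a \<in> P x y"
  shows "\<epsilon> z \<otimes> a = (if z = x then a else \<zero>)" "a \<otimes> \<epsilon> z = (if z = y then a else \<zero>)"
proof -
  have a: "a \<in> carrier R" "\<epsilon> x \<otimes> a = a" "a \<otimes> \<epsilon> y = a" using assms by (auto simp: P_iff)
  have "\<epsilon> z \<otimes> a = \<epsilon> z \<otimes> \<epsilon> x \<otimes> a" using a assms m_assoc[of "\<epsilon> z" "\<epsilon> x" a] by simp
  then show "\<epsilon> z \<otimes> a = (if z = x then a else \<zero>)" using a assms by (auto simp: idem_mult)
  have "a \<otimes> \<epsilon> z = a \<otimes> (\<epsilon> y \<otimes> \<epsilon> z)" using a assms m_assoc[of a "\<epsilon> y" "\<epsilon> z"] by simp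
  then show "a \<otimes> \<epsilon> z = (if z = y then a else \<zero>)" using a assms by (auto simp: idem_mult)
qed

lemma P_mult_zero:
  assumes "x \<in> verts Q" "y \<in> verts Q" "y' \<in> verts Q" "z \<in> verts Q" "a \<in> P x y" "b \<in> P y' z" "y \<noteq> y'"
  shows "a \<otimes> b = \<zero>"
proof -
  have ab: "a \<in> carrier R" "a \<otimes> \<epsilon> y = a" "b \<in> carrier R" using assms by (auto simp: P_iff)
  then have "a \<otimes> b = a \<otimes> (\<epsilon> y \<otimes> b)" using assms m_assoc[of a "\<epsilon> y" b] by simp
  then show ?thesis using assms ab idem_mult_P(1)[of y' z y b] by simp
qed

lemma P_endpoints_unique:
  assumes "x \<in> verts Q" "y \<in> verts Q" "x' \<in> verts Q" "y' \<in> verts Q" "a \<in> P x y" "a \<in> P x' y'" "a \<noteq> \<zero>"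
  shows "x = x'" "y = y'"
proof -
  have a: "\<epsilon> x' \<otimes> a = a" "a \<otimes> \<epsilon> y' = a" using assms by (auto simp: P_iff)
  show "x = x'" using idem_mult_P(1)[of x y x' a] a assms by (auto split: if_splits)
  show "y = y'" using idem_mult_P(2)[of x y y' a] a assms by (auto split: if_splits)
qed

lemma E_mult_P:
  assumes "T \<subseteq> verts Q" "x \<in> verts Q" "y \<in> verts Q" "a \<in> P x y"
  shows "E T \<otimes> a = (if x \<in> T then a else \<zero>)" "a \<otimes> E T = (if y \<in> T then a else \<zero>)"
proof -
  have a: "a \<in> carrier R" "\<epsilon> x \<otimes> a = a" "a \<otimes> \<epsilon> y = a" using assms by (auto simp: P_iff)
  have "E T \<otimes> a = E T \<otimes> \<epsilon> x \<otimes> a" using a assms m_assoc[of "E T" "\<epsilon> x" a] by simp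
  then show "E T \<otimes> a = (if x \<in> T then a else \<zero>)" using a assms by (auto simp: E_idem)
  have "a \<otimes> E T = a \<otimes> (\<epsilon> y \<otimes> E T)" using a assms m_assoc[of a "\<epsilon> y" "E T"] by simp
  then show "a \<otimes> E T = (if y \<in> T then a else \<zero>)" using a assms by (auto simp: E_idem)
qed

lemma EE_iff: "T \<subseteq> verts Q \<Longrightarrow> a \<in> peirce R (E T) (E T) \<longleftrightarrow> a \<in> carrier R \<and> E T \<otimes> a = a \<and> a \<otimes> E T = a"
  by (rule peirce_iff) (simp_all add: E_mult)

lemma P_in_corner_iff:
  assumes "T \<subseteq> verts Q" "x \<in> verts Q" "y \<in> verts Q" "a \<in> P x y" "a \<noteq> \<zero>"
  shows "a \<in> peirce R (E T) (E T) \<longleftrightarrow> x \<in> T \<and> y \<in> T"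
  using assms by (auto simp: EE_iff E_mult_P P_iff split: if_splits)

lemma P_subset_corner:
  assumes "T \<subseteq> verts Q" "x \<in> T" "y \<in> T"
  shows "P x y \<subseteq> peirce R (E T) (E T)"
proof
  fix a assume a: "a \<in> P x y"
  have "x \<in> verts Q" "y \<in> verts Q" using assms by auto
  then show "a \<in> peirce R (E T) (E T)"
    using a assms E_mult_P[OF assms(1) _ _ a] by (simp add: EE_iff) (simp add: P_iff)
qed

lemma peirce_corner:
  assumes "T \<subseteq> verts Q" "x \<in> T" "y \<in> T"
  shows "peirce (corner R (E T)) (\<epsilon> x) (\<epsilon> y) = P x y"
proof
  show "peirce (corner R (E T)) (\<epsilon> x) (\<epsilon> y) \<subseteq> P x y"
  proof
    fix a assume "a \<in> peirce (corner R (E T)) (\<epsilon> x) (\<epsilon> y)"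
    then obtain b where "b \<in> peirce R (E T) (E T)" "a = \<epsilon> x \<otimes> b \<otimes> \<epsilon> y"
      unfolding peirce_def[of "corner R (E T)"] by auto
    then have "b \<in> carrier R" "a = \<epsilon> x \<otimes> b \<otimes> \<epsilon> y" using EE_iff[OF assms(1)] by auto
    then show "a \<in> P x y" unfolding peirce_def by blast
  qed
  show "P x y \<subseteq> peirce (corner R (E T)) (\<epsilon> x) (\<epsilon> y)"
  proof
    fix a assume a: "a \<in> P x y"
    have "x \<in> verts Q" "y \<in> verts Q" using assms by auto
    then have "a = \<epsilon> x \<otimes> a \<otimes> \<epsilon> y"
      using a by (simp add: P_iff)
    moreover have "a \<in> peirce R (E T) (E T)" using a P_subset_corner[OF assms] by (rule subsetD[rotated])
    ultimately show "a \<in> peirce (corner R (E T)) (\<epsilon> x) (\<epsilon> y)"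
      unfolding peirce_def[of "corner R (E T)"] by auto
  qed
qed

definition semi_normed_on :: "'v set \<Rightarrow> 'r set \<Rightarrow> bool" where
  "semi_normed_on T B \<longleftrightarrow>
     B \<subseteq> (\<Union>x\<in>T. \<Union>y\<in>T. P x y) \<and>
     (\<forall>x\<in>T. \<forall>y\<in>T. k_basis R (P x y) (B \<inter> P x y)) \<and>
     (\<forall>x\<in>T. \<epsilon> x \<in> B) \<and>
     (\<forall>a\<in>{a \<in> arcs Q. tail Q a \<in> T \<and> head Q a \<in> T}. \<gamma> (arrow_path Q a) \<in> B) \<and>
     (\<forall>\<sigma>\<in>B. \<forall>\<sigma>'\<in>B. \<sigma> \<otimes> \<sigma>' = \<zero> \<or> (\<exists>c b. c \<noteq> 0 \<and> b \<in> B \<and> \<sigma> \<otimes> \<sigma>' = c \<odot> b))"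

lemma k_basis_corner:
  assumes "T \<subseteq> verts Q" "V \<subseteq> peirce R (E T) (E T)"
  shows "k_basis (corner R (E T)) V B = k_basis R V B"
proof -
  have *: "lin_comb (corner R (E T)) c = lin_comb R c" if "Poly_Mapping.keys c \<subseteq> V" for c
    unfolding lin_comb_def corner_simps
    by (rule finsum_corner) (use that assms in \<open>auto simp: EE_iff smult_mult mult_smult E_mult subset_iff\<close>)
  show ?thesis
  proof (cases "B \<subseteq> V")
    case True
    then have "lin_comb (corner R (E T)) c = lin_comb R c" if "Poly_Mapping.keys c \<subseteq> B" for c
      using * that by blast
    then show ?thesis
      unfolding k_basis_def corner_simps by (simp cong: conj_cong imp_cong)
  qed (simp add: k_basis_def)
qed

lemma semi_normed_basis_corner_iff:
  assumes "T \<subseteq> verts Q"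
  shows "semi_normed_basis (corner R (E T)) (induce_subgraph Q T) \<gamma> B \<longleftrightarrow> semi_normed_on T B"
proof -
  have "arrow_path (induce_subgraph Q T) a = arrow_path Q a" for a
    by (simp add: arrow_path_def)
  moreover have "k_basis (corner R (E T)) (P x y) B' = k_basis R (P x y) B'" if "x \<in> T" "y \<in> T" for x y B'
    using k_basis_corner[OF assms P_subset_corner[OF assms that]] .
  ultimately show ?thesis
    unfolding semi_normed_basis_def semi_normed_on_def induce_subgraph_verts induce_subgraph_arcs
    by (simp add: peirce_corner[OF assms] Ball_def cong: SUP_cong_simp conj_cong imp_cong)
qed

lemma corner_verts: "corner R (E (verts Q)) = R"
proof -
  have "peirce R \<one> \<one> = carrier R" by (auto simp: peirce_iff)
  then show ?thesis by (simp add: E_verts corner_def)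
qed

lemma induce_verts: "induce_subgraph Q (verts Q) = Q"
  using wf by (auto simp: induce_subgraph_def wf_digraph_def intro!: pre_digraph.equality)

end

section \<open>Semi-normed bases of corners and their complexes\<close>

lemma cas_induce_subgraph:
  "pre_digraph.cas (induce_subgraph Q T) u p v = pre_digraph.cas Q u p v"
  by (induction p arbitrary: u) (simp_all add: pre_digraph.cas.simps)

lemma Nil_paths_induce_iff: "(x, [], y) \<in> paths (induce_subgraph Q T) \<longleftrightarrow> x = y \<and> x \<in> T"
  by (auto simp: paths_def pre_digraph.awalk_def pre_digraph.cas.simps)

lemma Cons_paths_induce_iff:
  "(x, a # p, y) \<in> paths (induce_subgraph Q T) \<longleftrightarrow>
    a \<in> arcs Q \<and> x = tail Q a \<and> tail Q a \<in> T \<and> (head Q a, p, y) \<in> paths (induce_subgraph Q T)"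
proof -
  have "v \<in> T" if "pre_digraph.cas Q u p v" "u \<in> T" "set p \<subseteq> {e \<in> arcs Q. tail Q e \<in> T \<and> head Q e \<in> T}"
    for u v
    using that by (induction p arbitrary: u) (auto simp: pre_digraph.cas.simps)
  then show ?thesis
    by (auto simp: paths_def pre_digraph.awalk_def pre_digraph.cas.simps cas_induce_subgraph)
qed

lemma paths_induce_target: "(x, p, y) \<in> paths (induce_subgraph Q T) \<Longrightarrow> x \<in> T \<and> y \<in> T"
  by (induction p arbitrary: x) (auto simp: Nil_paths_induce_iff Cons_paths_induce_iff)

lemma paths_induce_subset:
  assumes "T \<subseteq> verts Q"
  shows "paths (induce_subgraph Q T) \<subseteq> paths Q"
  using assms by (auto simp: paths_def pre_digraph.awalk_def cas_induce_subgraph)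

lemma SH_eq_cohomology:
  "SH A Q \<gamma> B G = cohomology (cochains (sc_simplices A Q \<gamma> B) G)
    (coboundary (sc_simplices A Q \<gamma> B) (sc_boundary_simplex A Q \<gamma> B))"
proof -
  have 1: "sc_cochain_group A Q \<gamma> B G = cochains (sc_simplices A Q \<gamma> B) G"
    by (simp add: fun_eq_iff sc_cochain_group_def cochains_def sc_chain_group_def)
  have 2: "sc_coboundary A Q \<gamma> B = coboundary (sc_simplices A Q \<gamma> B) (sc_boundary_simplex A Q \<gamma> B)"
    by (simp add: fun_eq_iff sc_coboundary_def coboundary_def sc_chain_group_def sc_boundary_def)
  show ?thesis
    by (simp add: fun_eq_iff SH_def cohomology_def cocycle_group_def cocycles_def coboundaries_def
        sc_cocycles_def sc_coboundaries_def 1 2 split: nat.split)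
qed

lemma based_complex_cong:
  assumes "based_complex X bd" "\<And>n s. s \<in> X (Suc n) \<Longrightarrow> bd s = bd' s"
  shows "based_complex X bd'"
proof
  interpret based_complex X bd by fact
  show "Poly_Mapping.keys (bd' s) \<subseteq> X n" if "s \<in> X (Suc n)" for s n
    using that bd_closed assms(2) by fastforce
  fix s n assume s: "s \<in> X (Suc (Suc n))"
  have "frag_extend bd' (bd' s) = frag_extend bd (bd s)"
    unfolding assms(2)[OF s, symmetric]
    by (rule frag_extend_eq) (use bd_closed[OF s] assms(2) in auto)
  then show "frag_extend bd' (bd' s) = 0" using bd_bd[OF s] by simp
qed

context quiver_algebra
begin

lemma path_in_P:
  assumes "(x, p, y) \<in> paths Q" "x \<in> verts Q" "y \<in> verts Q"
  shows "\<gamma> (x, p, y) \<in> P x y"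
  using path_mult[OF stationary_path[OF assms(2)] assms(1)]
    path_mult[OF assms(1) stationary_path[OF assms(3)]] assms path_closed
  by (simp add: P_iff) (simp add: stationary_def)

lemma arrow_path_in_paths: "a \<in> arcs Q \<Longrightarrow> arrow_path Q a \<in> paths Q"
  using wf by (simp add: arrow_path_def paths_def pre_digraph.awalk_def pre_digraph.cas.simps wf_digraph_def)

inductive_set path_span :: "'v set \<Rightarrow> 'r set" for T where
  zero: "\<zero> \<in> path_span T"
| add: "p \<in> paths (induce_subgraph Q T) \<Longrightarrow> a \<in> path_span T \<Longrightarrow> c \<odot> \<gamma> p \<oplus> a \<in> path_span T"

lemma path_span_closed:
  assumes "T \<subseteq> verts Q" "a \<in> path_span T"
  shows "a \<in> carrier R"
  using assms(2)
proof induction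
  case (add p a c)
  then have "\<gamma> p \<in> carrier R" using paths_induce_subset[OF assms(1)] path_closed by blast
  then show ?case using add by simp
qed simp

abbreviation product :: "'r list \<Rightarrow> 'r" where "product s \<equiv> foldr (\<otimes>) s \<one>"

lemma product_closed [simp]: "set s \<subseteq> carrier R \<Longrightarrow> product s \<in> carrier R"
  by (induction s) auto

lemma product_infix_nonzero:
  assumes "set (u @ x # y # v) \<subseteq> carrier R" "product (u @ x # y # v) \<noteq> \<zero>"
  shows "x \<otimes> y \<noteq> \<zero>"
  using assms
proof (induction u)
  case Nil
  then show ?case using m_assoc[of x y "product v"] by auto
next
  case (Cons a u)
  then have "product (u @ x # y # v) \<noteq> \<zero>" by force
  then show ?case using Cons by simp
qed

lemma product_suffix_nonzero:
  assumes "set (u @ v) \<subseteq> carrier R" "product (u @ v) \<noteq> \<zero>"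
  shows "product v \<noteq> \<zero>"
  using assms
proof (induction u)
  case (Cons a u)
  then have "product (u @ v) \<noteq> \<zero>" by force
  then show ?case using Cons by simp
qed simp

definition simplices :: "'v set \<Rightarrow> 'r set \<Rightarrow> nat \<Rightarrow> ('v, 'r) sc_simplex set" where
  "simplices T B n =
     (if n = 0 then Vertex ` T
      else if n = 1 then {Tuple [\<sigma>] | \<sigma>. \<sigma> \<in> B}
      else {Tuple s | s. length s = n \<and> set s \<subseteq> B \<and> product s \<noteq> \<zero> \<and> set s \<inter> \<epsilon> ` verts Q = {}})"

end

locale quiver_basis = quiver_algebra +
  fixes T B
  assumes T: "T \<subseteq> verts Q" and B: "semi_normed_on T B"
begin

lemma endpoints_exist: "b \<in> B \<Longrightarrow> \<exists>x\<in>T. \<exists>y\<in>T. b \<in> P x y"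
  using B unfolding semi_normed_on_def by blast

lemma k_basis_P: "x \<in> T \<Longrightarrow> y \<in> T \<Longrightarrow> k_basis R (P x y) (B \<inter> P x y)"
  using B by (auto simp: semi_normed_on_def)

lemma B_closed: "b \<in> B \<Longrightarrow> b \<in> carrier R"
  using endpoints_exist T P_subset by blast

lemma B_nonzero: "b \<in> B \<Longrightarrow> b \<noteq> \<zero>"
  using endpoints_exist k_basis_P k_basis_nonzero P_subset T by blast

lemma B_in_corner: "b \<in> B \<Longrightarrow> b \<in> peirce R (E T) (E T)"
  using endpoints_exist P_subset_corner T by blast

lemma B_endpoints:
  assumes "b \<in> B" "b \<in> P x y" "x \<in> verts Q" "y \<in> verts Q"
  shows "x \<in> T" "y \<in> T"
proof -
  obtain x' y' where "x' \<in> T" "y' \<in> T" "b \<in> P x' y'" using endpoints_exist assms(1) by blast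
  then show "x \<in> T" "y \<in> T"
    using P_endpoints_unique[of x y x' y' b] assms B_nonzero T by auto
qed

lemma B_multiples:
  assumes "b \<in> B" "b' \<in> B" "c \<odot> b = c' \<odot> b'" "c \<noteq> 0"
  shows "b = b'"
proof -
  obtain x y where xy: "x \<in> T" "y \<in> T" "b \<in> P x y" using endpoints_exist assms(1) by blast
  obtain x' y' where xy': "x' \<in> T" "y' \<in> T" "b' \<in> P x' y'" using endpoints_exist assms(2) by blast
  have v: "x \<in> verts Q" "y \<in> verts Q" "x' \<in> verts Q" "y' \<in> verts Q" using xy xy' T by auto
  have nz: "c \<odot> b \<noteq> \<zero>" using assms B_nonzero B_closed smult_eq_zero_iff by blast
  have "c \<odot> b \<in> P x y" "c \<odot> b \<in> P x' y'"
    using P_smult[OF v(1,2) xy(3), of c] P_smult[OF v(3,4) xy'(3), of c'] assms(3) by simp_all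
  then have "x = x'" "y = y'" using P_endpoints_unique[OF v] nz by auto
  then show ?thesis
    using k_basis_multiples[OF k_basis_P[OF xy(1,2)] P_subset[OF v(1,2)], of b b' c c'] assms xy xy' by auto
qed

abbreviation m where "m \<equiv> basis_product R B"

lemma basis_product_eq:
  assumes "b'' \<in> B" "c \<noteq> 0" "b \<otimes> b' = c \<odot> b''"
  shows "m b b' = b''"
  unfolding basis_product_def
proof (rule the_equality)
  fix a assume "a \<in> B \<and> (\<exists>c. c \<noteq> 0 \<and> b \<otimes> b' = c \<odot> a)"
  then obtain d where "a \<in> B" "d \<noteq> 0" "c \<odot> b'' = d \<odot> a" using assms by auto
  then show "a = b''" using B_multiples[of b'' a c d] assms by auto
qed (use assms in blast)

lemma basis_product:
  assumes "b \<in> B" "b' \<in> B" "b \<otimes> b' \<noteq> \<zero>"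
  obtains c where "m b b' \<in> B" "c \<noteq> 0" "b \<otimes> b' = c \<odot> m b b'"
proof -
  obtain c b'' where *: "b'' \<in> B" "c \<noteq> 0" "b \<otimes> b' = c \<odot> b''"
    using B assms unfolding semi_normed_on_def by blast
  then show thesis using that basis_product_eq[OF *] by metis
qed

lemma basis_product_in_P:
  assumes "b \<in> B" "b' \<in> B" "b \<otimes> b' \<noteq> \<zero>" "b \<in> P x y" "b' \<in> P y z"
    "x \<in> verts Q" "y \<in> verts Q" "z \<in> verts Q"
  shows "m b b' \<in> P x z"
proof -
  obtain c where c: "m b b' \<in> B" "c \<noteq> 0" "b \<otimes> b' = c \<odot> m b b'" using basis_product assms by blast
  then have "m b b' = inverse c \<odot> (b \<otimes> b')"
    using smult_eq_iff[of "m b b'" "b \<otimes> b'" c] B_closed assms by auto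
  then show ?thesis using P_smult P_mult assms by auto
qed

lemma basis_product_assoc:
  assumes "x \<in> B" "y \<in> B" "z \<in> B" "x \<otimes> (y \<otimes> z) \<noteq> \<zero>"
  shows "m (m x y) z = m x (m y z)"
proof -
  have cl: "x \<in> carrier R" "y \<in> carrier R" "z \<in> carrier R" using assms B_closed by auto
  have yz: "y \<otimes> z \<noteq> \<zero>" using assms cl by auto
  have xy: "x \<otimes> y \<noteq> \<zero>" using assms cl m_assoc[of x y z] by auto
  obtain c where c: "m x y \<in> B" "c \<noteq> 0" "x \<otimes> y = c \<odot> m x y" using basis_product assms xy by blast
  obtain d where d: "m y z \<in> B" "d \<noteq> 0" "y \<otimes> z = d \<odot> m y z" using basis_product assms yz by blast
  have e: "x \<otimes> (y \<otimes> z) = c \<odot> (m x y \<otimes> z)"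
    using c cl m_assoc[of x y z] B_closed by (simp add: smult_mult)
  have f: "x \<otimes> (y \<otimes> z) = d \<odot> (x \<otimes> m y z)"
    using d cl B_closed by (simp add: mult_smult)
  have "m x y \<otimes> z \<noteq> \<zero>" using e assms by auto
  then obtain c' where c': "m (m x y) z \<in> B" "c' \<noteq> 0" "m x y \<otimes> z = c' \<odot> m (m x y) z"
    using basis_product c assms by blast
  have "x \<otimes> m y z \<noteq> \<zero>" using f assms by auto
  then obtain d' where d': "m x (m y z) \<in> B" "d' \<noteq> 0" "x \<otimes> m y z = d' \<odot> m x (m y z)"
    using basis_product d assms by blast
  have "(c * c') \<odot> m (m x y) z = (d * d') \<odot> m x (m y z)"
    using e f c' d' B_closed by (simp add: smult_smult)
  then show ?thesis using B_multiples c c' d' by (metis mult_eq_0_iff)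
qed

lemma path_multiple:
  assumes "(x, p, y) \<in> paths (induce_subgraph Q T)"
  shows "\<gamma> (x, p, y) = \<zero> \<or> (\<exists>c b. c \<noteq> 0 \<and> b \<in> B \<and> \<gamma> (x, p, y) = c \<odot> b)"
  using assms
proof (induction p arbitrary: x)
  case Nil
  then have "x \<in> T" "y = x" by (auto simp: Nil_paths_induce_iff)
  then have "\<gamma> (x, [], y) \<in> B" using B by (auto simp: semi_normed_on_def stationary_def)
  then have "\<gamma> (x, [], y) = 1 \<odot> \<gamma> (x, [], y)" using B_closed by simp
  then show ?case using \<open>\<gamma> (x, [], y) \<in> B\<close> zero_neq_one by metis
next
  case (Cons a p)
  then have a: "a \<in> arcs Q" "x = tail Q a" "tail Q a \<in> T" and p: "(head Q a, p, y) \<in> paths (induce_subgraph Q T)"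
    by (auto simp: Cons_paths_induce_iff)
  have "head Q a \<in> T" using paths_induce_target p by fast
  then have aB: "\<gamma> (arrow_path Q a) \<in> B" using B a by (auto simp: semi_normed_on_def)
  have eq: "\<gamma> (x, a # p, y) = \<gamma> (arrow_path Q a) \<otimes> \<gamma> (head Q a, p, y)"
    using path_mult[of "tail Q a" "[a]" "head Q a" "head Q a" p y] arrow_path_in_paths[OF a(1)]
      paths_induce_subset[OF T] p a by (auto simp: arrow_path_def)
  from Cons.IH[OF p] show ?case
  proof (elim disjE exE conjE)
    assume "\<gamma> (head Q a, p, y) = \<zero>"
    then show ?thesis using eq aB B_closed by simp
  next
    fix c b assume b: "c \<noteq> 0" "b \<in> B" "\<gamma> (head Q a, p, y) = c \<odot> b"
    have eq': "\<gamma> (x, a # p, y) = c \<odot> (\<gamma> (arrow_path Q a) \<otimes> b)"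
      using eq b aB B_closed by (simp add: mult_smult)
    show ?thesis
    proof (cases "\<gamma> (arrow_path Q a) \<otimes> b = \<zero>")
      case False
      then obtain d where "m (\<gamma> (arrow_path Q a)) b \<in> B" "d \<noteq> 0"
        "\<gamma> (arrow_path Q a) \<otimes> b = d \<odot> m (\<gamma> (arrow_path Q a)) b"
        using basis_product aB b by blast
      moreover from this have "\<gamma> (x, a # p, y) = (c * d) \<odot> m (\<gamma> (arrow_path Q a)) b"
        using eq' B_closed by (simp add: smult_smult)
      ultimately show ?thesis using b by (metis mult_eq_0_iff)
    qed (use eq' in simp)
  qed
qed

lemma path_span_component:
  assumes a: "a \<in> path_span T" and xy: "x \<in> T" "y \<in> T"
  shows "\<exists>c. Poly_Mapping.keys c \<subseteq> {b \<in> B \<inter> P x y. \<exists>p\<in>paths (induce_subgraph Q T). \<exists>d. d \<noteq> 0 \<and> b = d \<odot> \<gamma> p} \<and>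
    \<epsilon> x \<otimes> a \<otimes> \<epsilon> y = lin_comb R c"
  using a
proof induction
  case zero
  have "x \<in> verts Q" "y \<in> verts Q" using xy T by auto
  then show ?case by (intro exI[of _ 0]) simp
next
  case (add u a d)
  let ?B = "{b \<in> B \<inter> P x y. \<exists>p\<in>paths (induce_subgraph Q T). \<exists>d. d \<noteq> 0 \<and> b = d \<odot> \<gamma> p}"
  obtain c where c: "Poly_Mapping.keys c \<subseteq> ?B" "\<epsilon> x \<otimes> a \<otimes> \<epsilon> y = lin_comb R c"
    using add.IH by blast
  obtain x' p y' where u: "u = (x', p, y')" by (cases u) auto
  have v: "x' \<in> verts Q" "y' \<in> verts Q" "x \<in> verts Q" "y \<in> verts Q"
    using paths_induce_target add.hyps(1) u xy T by fast+
  have uP: "\<gamma> u \<in> P x' y'" using path_in_P paths_induce_subset[OF T] add.hyps(1) u v by blast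
  then have ucl: "\<gamma> u \<in> carrier R" using P_subset v by blast
  have acl: "a \<in> carrier R" using path_span_closed T add.hyps(2) .
  have Bcl: "?B \<subseteq> carrier R" using B_closed by auto
  have eq: "\<epsilon> x \<otimes> (d \<odot> \<gamma> u \<oplus> a) \<otimes> \<epsilon> y = d \<odot> (\<epsilon> x \<otimes> \<gamma> u \<otimes> \<epsilon> y) \<oplus> lin_comb R c"
    using c(2) v ucl acl by (simp add: l_distr r_distr smult_mult mult_smult flip: c(2))
  show ?case
  proof (cases "d = 0 \<or> x \<noteq> x' \<or> y \<noteq> y' \<or> \<gamma> u = \<zero>")
    case True
    have "d \<odot> (\<epsilon> x \<otimes> \<gamma> u \<otimes> \<epsilon> y) = \<zero>"
      using True v ucl idem_mult_P[OF v(1,2) _ uP] by auto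
    then have "\<epsilon> x \<otimes> (d \<odot> \<gamma> u \<oplus> a) \<otimes> \<epsilon> y = lin_comb R c"
      unfolding eq using c(1) Bcl lin_comb_closed[of c] by (simp add: subset_trans)
    with c(1) show ?thesis by (intro exI[of _ c] conjI)
  next
    case False
    then obtain e b where b: "e \<noteq> 0" "b \<in> B" "\<gamma> u = e \<odot> b"
      using path_multiple[of x' p y'] add.hyps(1) u by blast
    have bcl: "b \<in> carrier R" using b B_closed by simp
    have b': "b = inverse e \<odot> \<gamma> u" using smult_eq_iff[OF bcl ucl, of e] b by auto
    then have bP: "b \<in> P x y" using P_smult[OF v(1,2) uP] False by simp
    have bB: "b \<in> ?B" using b b' bP add.hyps(1) nonzero_imp_inverse_nonzero by blast
    let ?c = "Poly_Mapping.single b (d * e) + c"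
    have k: "Poly_Mapping.keys (Poly_Mapping.single b (d * e)) \<subseteq> ?B" using bB by auto
    have "Poly_Mapping.keys ?c \<subseteq> ?B"
      using keys_add[of "Poly_Mapping.single b (d * e)" c] k c(1) by blast
    moreover have "\<epsilon> x \<otimes> \<gamma> u \<otimes> \<epsilon> y = \<gamma> u"
      using uP False v by (simp add: P_iff)
    then have "\<epsilon> x \<otimes> (d \<odot> \<gamma> u \<oplus> a) \<otimes> \<epsilon> y = lin_comb R ?c"
      unfolding eq
      using lin_comb_add[of "Poly_Mapping.single b (d * e)" c] subset_trans[OF k Bcl]
        subset_trans[OF c(1) Bcl] b bcl
      by (simp add: smult_smult)
    ultimately show ?thesis by (intro exI[of _ ?c] conjI)
  qed
qed

lemma basis_path_multiple:
  assumes gen: "peirce R (E T) (E T) \<subseteq> path_span T" and b: "b \<in> B"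
  shows "\<exists>p\<in>paths (induce_subgraph Q T). \<exists>c. c \<noteq> 0 \<and> b = c \<odot> \<gamma> p"
proof -
  obtain x y where xy: "x \<in> T" "y \<in> T" "b \<in> P x y" using endpoints_exist b by blast
  then have v: "x \<in> verts Q" "y \<in> verts Q" using T by auto
  let ?B = "{b \<in> B \<inter> P x y. \<exists>p\<in>paths (induce_subgraph Q T). \<exists>d. d \<noteq> 0 \<and> b = d \<odot> \<gamma> p}"
  have "b \<in> path_span T" using gen B_in_corner b by blast
  then obtain c where c: "Poly_Mapping.keys c \<subseteq> ?B" "\<epsilon> x \<otimes> b \<otimes> \<epsilon> y = lin_comb R c"
    using path_span_component xy by blast
  have "lin_comb R (Poly_Mapping.single b 1) = lin_comb R c"
    using c(2) xy v b B_closed by (simp add: P_iff)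
  then have "Poly_Mapping.single b 1 = c"
    using k_basis_unique[OF k_basis_P[OF xy(1,2)] P_subset[OF v], of "Poly_Mapping.single b 1" c] c(1) b xy
    by auto
  then have "b \<in> Poly_Mapping.keys c" by auto
  then show ?thesis using c by blast
qed

lemma nonstationary_in_J:
  assumes gen: "peirce R (E T) (E T) \<subseteq> path_span T" and b: "b \<in> B" "b \<notin> \<epsilon> ` verts Q"
  shows "b \<in> J"
proof -
  obtain x p y c where p: "(x, p, y) \<in> paths (induce_subgraph Q T)" "c \<noteq> 0" "b = c \<odot> \<gamma> (x, p, y)"
    using basis_path_multiple[OF gen b(1)] by auto
  have "p \<noteq> []"
  proof
    assume "p = []"
    then have xy: "x \<in> T" "y = x" using p by (auto simp: Nil_paths_induce_iff)
    then have "\<epsilon> x \<in> B" using B by (auto simp: semi_normed_on_def)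
    moreover have "1 \<odot> b = c \<odot> \<epsilon> x"
      using p xy \<open>p = []\<close> B_closed b by (simp add: stationary_def)
    ultimately have "b = \<epsilon> x" using B_multiples[of b "\<epsilon> x" 1 c] b by simp
    then show False using b xy T by blast
  qed
  then show ?thesis
    using p paths_induce_subset[OF T] path_in_J J_smult by blast
qed

lemma basis_product_nonstationary:
  assumes gen: "peirce R (E T) (E T) \<subseteq> path_span T"
    and "b \<in> B" "b \<notin> \<epsilon> ` verts Q" "b' \<in> B" "b' \<notin> \<epsilon> ` verts Q" "b \<otimes> b' \<noteq> \<zero>"
  shows "m b b' \<in> B - \<epsilon> ` verts Q"
proof -
  obtain c where c: "m b b' \<in> B" "c \<noteq> 0" "b \<otimes> b' = c \<odot> m b b'" using basis_product assms by blast
  have "b \<otimes> b' \<in> J" 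
    by (intro J_mult nonstationary_in_J[OF gen] assms)
  moreover have "m b b' = inverse c \<odot> (b \<otimes> b')"
    using smult_eq_iff[of "m b b'" "b \<otimes> b'" c] B_closed assms c by auto
  ultimately have "m b b' \<in> J" using J_smult by simp
  then show ?thesis using c stationary_notin_J by auto
qed

end

declare sc_boundary_simplex.simps(2) [simp del]

context quiver_basis
begin

lemma sc_simplices_corner:
  "sc_simplices (corner R (E T)) (induce_subgraph Q T) \<gamma> B = simplices T B"
proof
  fix n
  have prod: "foldr (\<otimes>) s (E T) = product s" if "set s \<subseteq> B" "s \<noteq> []" for s
    using that
  proof (induction s)
    case (Cons b s)
    have "b \<otimes> E T = b" "b \<in> carrier R"
      using Cons.prems B_in_corner EE_iff[OF T] by auto
    then show ?case using Cons by (cases s) auto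
  qed simp
  have stat: "set s \<inter> \<epsilon> ` T = {} \<longleftrightarrow> set s \<inter> \<epsilon> ` verts Q = {}" if "set s \<subseteq> B" for s
  proof -
    have "x \<in> T" if "x \<in> verts Q" "\<epsilon> x \<in> B" for x
      using B_endpoints(1)[OF that(2) idem_in_P] that by blast
    then show ?thesis using that T by blast
  qed
  show "sc_simplices (corner R (E T)) (induce_subgraph Q T) \<gamma> B n = simplices T B n"
  proof -
    have "length s = n \<and> set s \<subseteq> B \<and> foldr (\<otimes>) s (E T) \<noteq> \<zero> \<and> set s \<inter> \<epsilon> ` T = {} \<longleftrightarrow>
      length s = n \<and> set s \<subseteq> B \<and> product s \<noteq> \<zero> \<and> set s \<inter> \<epsilon> ` verts Q = {}"
      if "n \<noteq> 0" for s
      using prod[of s] stat[of s] that by (cases "s = []") auto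
    moreover have "(\<otimes>\<^bsub>corner R (E T)\<^esub>) = (\<otimes>)" by (simp add: fun_eq_iff)
    ultimately show ?thesis
      by (simp add: sc_simplices_def simplices_def)
  qed
qed

abbreviation bnd :: "('d, 'a) sc_simplex \<Rightarrow> ('d, 'a) sc_simplex \<Rightarrow>\<^sub>0 int" where
  "bnd \<equiv> sc_boundary_simplex (corner R (E T)) (induce_subgraph Q T) \<gamma> B"

lemma endpoints_corner:
  assumes "b \<in> B" "b \<in> P x y" "x \<in> T" "y \<in> T"
  shows "endpoints (corner R (E T)) (induce_subgraph Q T) \<gamma> b = (x, y)"
  unfolding endpoints_def
proof (rule the_equality)
  show "case (x, y) of (x, y) \<Rightarrow> x \<in> verts (induce_subgraph Q T) \<and> y \<in> verts (induce_subgraph Q T) \<and>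
      b \<in> peirce (corner R (E T)) (\<epsilon> x) (\<epsilon> y)"
    using assms by (simp add: peirce_corner[OF T])
next
  fix p assume "case p of (x, y) \<Rightarrow> x \<in> verts (induce_subgraph Q T) \<and> y \<in> verts (induce_subgraph Q T) \<and>
      b \<in> peirce (corner R (E T)) (\<epsilon> x) (\<epsilon> y)"
  then obtain x' y' where p: "p = (x', y')" "x' \<in> T" "y' \<in> T" "b \<in> P x' y'"
    by (auto simp: peirce_corner[OF T])
  then show "p = (x, y)"
    using P_endpoints_unique[of x' y' x y b] assms T B_nonzero by auto
qed

lemma bnd_one:
  assumes "b \<in> B" "b \<in> P x y" "x \<in> T" "y \<in> T"
  shows "bnd (Tuple [b]) = frag_of (Vertex y) - frag_of (Vertex x)"
  using endpoints_corner[OF assms] by (simp add: sc_boundary_simplex.simps)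

lemma bnd_bar:
  assumes "length s \<ge> 2"
  shows "bnd (Tuple s) = bar_boundary m s"
proof -
  have "basis_product (corner R (E T)) B = m"
    by (simp add: fun_eq_iff basis_product_def)
  then show ?thesis using assms by (simp add: bar_boundary_unfold sc_boundary_simplex.simps)
qed

lemma simplices_length_ge_2:
  assumes "s \<in> simplices T B n" "n \<ge> 2"
  obtains t where "s = Tuple t" "length t = n" "set t \<subseteq> B" "product t \<noteq> \<zero>" "set t \<inter> \<epsilon> ` verts Q = {}"
  using assms by (auto simp: simplices_def split: if_splits)

lemma product_face:
  assumes gen: "peirce R (E T) (E T) \<subseteq> path_span T"
    and "set s \<subseteq> B - \<epsilon> ` verts Q" "product s \<noteq> \<zero>" "j < length s"
  shows "set (face m (Suc j) s) \<subseteq> B - \<epsilon> ` verts Q \<and>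
    (\<exists>c. \<exists>z\<in>carrier R. product s = (c \<odot> product (face m (Suc j) s)) \<otimes> z)"
proof -
  have cl: "set s \<subseteq> B - \<epsilon> ` verts Q \<Longrightarrow> product s \<in> carrier R" for s
    using B_closed by (intro product_closed) blast
  show ?thesis
    using assms(2-)
  proof (induction s arbitrary: j)
    case Nil
    then show ?case by simp
  next
    case (Cons x s)
    have x: "x \<in> B - \<epsilon> ` verts Q" "x \<in> carrier R" and s: "set s \<subseteq> B - \<epsilon> ` verts Q"
      using Cons.prems B_closed by auto
    have ps: "product s \<noteq> \<zero>" using Cons.prems(2) x by auto
    show ?case
    proof (cases j)
      case 0
      show ?thesis
      proof (cases s)
        case Nil
        have "product (x # s) = (1 \<odot> product (face m (Suc j) (x # s))) \<otimes> x"
          using Nil 0 x by simp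
        moreover have "set (face m (Suc j) (x # s)) \<subseteq> B - \<epsilon> ` verts Q" using Nil 0 by simp
        ultimately show ?thesis using x by blast
      next
        case (Cons y t)
        have y: "y \<in> B - \<epsilon> ` verts Q" "y \<in> carrier R" and t: "set t \<subseteq> B - \<epsilon> ` verts Q"
          using s Cons B_closed by auto
        have p: "product (x # s) = x \<otimes> y \<otimes> product t"
          using Cons x y cl[OF t] by (simp add: m_assoc)
        then have xy: "x \<otimes> y \<noteq> \<zero>" using cl[OF t] Cons.prems(2) by auto
        obtain c where c: "m x y \<in> B" "c \<noteq> 0" "x \<otimes> y = c \<odot> m x y"
          using basis_product[of x y] x y xy by blast
        have "product (x # s) = (c \<odot> product (face m (Suc j) (x # s))) \<otimes> \<one>"
          unfolding p using c B_closed cl[OF t] Cons 0 by (simp add: smult_mult)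
        moreover have "m x y \<in> B - \<epsilon> ` verts Q"
          using basis_product_nonstationary[OF gen, of x y] x y xy by blast
        then have "set (face m (Suc j) (x # s)) \<subseteq> B - \<epsilon> ` verts Q" using 0 Cons t by simp
        ultimately show ?thesis using one_closed by blast
      qed
    next
      case (Suc k)
      have "k < length s" using Cons.prems(3) Suc by simp
      from Cons.IH[OF s ps this] obtain c z
        where IH: "set (face m (Suc k) s) \<subseteq> B - \<epsilon> ` verts Q" "z \<in> carrier R"
          "product s = (c \<odot> product (face m (Suc k) s)) \<otimes> z" by blast
      have "product (x # s) = (c \<odot> product (face m (Suc j) (x # s))) \<otimes> z"
        using IH x cl[OF IH(1)] Suc by (simp add: m_assoc smult_mult mult_smult)
      moreover have "set (face m (Suc j) (x # s)) \<subseteq> B - \<epsilon> ` verts Q"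
        using IH(1) x Suc by simp
      ultimately show ?thesis using IH(2) by blast
    qed
  qed
qed

lemma face_in_simplices:
  assumes gen: "peirce R (E T) (E T) \<subseteq> path_span T"
    and s: "length s = Suc (Suc n)" "set s \<subseteq> B" "product s \<noteq> \<zero>" "set s \<inter> \<epsilon> ` verts Q = {}"
    and j: "j \<le> length s"
  shows "Tuple (face m j s) \<in> simplices T B (Suc n)"
proof -
  have s': "set s \<subseteq> B - \<epsilon> ` verts Q" "s \<noteq> []" using s by auto
  have len: "length (face m j s) = Suc n" using length_face[OF s'(2) j] s by simp
  have "set (face m j s) \<subseteq> B - \<epsilon> ` verts Q \<and> product (face m j s) \<noteq> \<zero>"
  proof (cases j)
    case 0
    obtain x t where t: "s = x # t" using s'(2) by (cases s) auto
    then have "x \<in> carrier R" using s' B_closed by auto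
    then show ?thesis using 0 t s' s(3) by auto
  next
    case (Suc k)
    then obtain c z where "set (face m j s) \<subseteq> B - \<epsilon> ` verts Q" "z \<in> carrier R"
      "product s = (c \<odot> product (face m j s)) \<otimes> z"
      using product_face[OF gen s'(1) s(3), of k] j by auto
    then show ?thesis using s(3) by auto
  qed
  then show ?thesis
  proof (cases "n = 0")
    case True
    then obtain b where "face m j s = [b]" using len by (cases "face m j s") auto
    then show ?thesis
      using True \<open>set (face m j s) \<subseteq> B - \<epsilon> ` verts Q \<and> _\<close> by (simp add: simplices_def)
  qed (use len in \<open>auto simp: simplices_def\<close>)
qed

lemma bnd_closed:
  assumes gen: "peirce R (E T) (E T) \<subseteq> path_span T" and s: "s \<in> simplices T B (Suc n)"
  shows "Poly_Mapping.keys (bnd s) \<subseteq> simplices T B n"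
proof (cases n)
  case 0
  then obtain b where b: "s = Tuple [b]" "b \<in> B" using s by (auto simp: simplices_def)
  obtain x y where xy: "x \<in> T" "y \<in> T" "b \<in> P x y" using endpoints_exist b by blast
  have "Poly_Mapping.keys (bnd s) \<subseteq> {Vertex y} \<union> {Vertex x}"
    unfolding b(1) bnd_one[OF b(2) xy(3,1,2)] using keys_diff[of "frag_of (Vertex y)" "frag_of (Vertex x)"]
    by (simp add: keys_frag_of)
  then show ?thesis using 0 xy by (auto simp: simplices_def)
next
  case (Suc k)
  obtain t where t: "s = Tuple t" "length t = Suc (Suc k)" "set t \<subseteq> B" "product t \<noteq> \<zero>"
    "set t \<inter> \<epsilon> ` verts Q = {}"
    using simplices_length_ge_2[OF s] Suc by auto
  have "Poly_Mapping.keys (bar_boundary m t :: ('d, 'a) sc_simplex \<Rightarrow>\<^sub>0 int)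
      \<subseteq> (\<Union>j\<in>{..length t}. {Tuple (face m j t)})"
    unfolding bar_boundary_def
    by (rule order_trans[OF keys_sum]) (auto simp: keys_frag_of split: if_splits)
  also have "\<dots> \<subseteq> simplices T B n"
    using face_in_simplices[OF gen t(2-5)] Suc by auto
  finally show ?thesis using t by (simp add: bnd_bar)
qed

lemma bnd_bnd:
  assumes gen: "peirce R (E T) (E T) \<subseteq> path_span T" and s: "s \<in> simplices T B (Suc (Suc n))"
  shows "frag_extend bnd (bnd s) = 0"
proof -
  obtain t where t: "s = Tuple t" "length t = Suc (Suc n)" "set t \<subseteq> B" "product t \<noteq> \<zero>"
    "set t \<inter> \<epsilon> ` verts Q = {}"
    using simplices_length_ge_2[OF s] by auto
  have tc: "set t \<subseteq> carrier R" using t(3) B_closed by auto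
  have "frag_extend bnd (bnd s) =
      (\<Sum>j\<le>length t. frag_cmul ((-1) ^ j) (bnd (Tuple (face m j t))))"
  proof -
    have "length t \<ge> 2" using t(2) by simp
    then show ?thesis
      unfolding t(1) by (simp add: bnd_bar bar_boundary_def frag_extend_sum frag_extend_cmul)
  qed
  also have "\<dots> = 0"
  proof (cases n)
    case 0
    then obtain b b' where b: "t = [b, b']" using t(2)
      by (metis One_nat_def Suc_length_conv length_0_conv)
    have nz: "b \<otimes> b' \<noteq> \<zero>" using t(4) b tc by auto
    have bB: "b \<in> B" "b' \<in> B" using b t(3) by auto
    obtain x y where xy: "x \<in> T" "y \<in> T" "b \<in> P x y" using endpoints_exist bB by blast
    obtain y' z where yz: "y' \<in> T" "z \<in> T" "b' \<in> P y' z" using endpoints_exist bB by blast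
    have v: "x \<in> verts Q" "y \<in> verts Q" "y' \<in> verts Q" "z \<in> verts Q" using xy yz T by auto
    have "y' = y" using P_mult_zero[OF v xy(3) yz(3)] nz by auto
    then have b'P: "b' \<in> P y z" using yz by simp
    have mP: "m b b' \<in> P x z" using basis_product_in_P[OF bB nz xy(3) b'P v(1,2,4)] .
    have mB: "m b b' \<in> B" using basis_product[OF bB nz] by blast
    have "{..length t} = {0, 1, 2}" using b by auto
    then show ?thesis
      using b bnd_one[OF bB(1) xy(3,1,2)] bnd_one[OF bB(2) b'P xy(2) yz(2)] bnd_one[OF mB mP xy(1) yz(2)]
      by (simp add: numeral_2_eq_2)
  next
    case (Suc k)
    have "t \<noteq> []" using t(2) by auto
    then have "bnd (Tuple (face m j t)) = bar_boundary m (face m j t)" if "j \<le> length t" for j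
      by (intro bnd_bar) (use length_face[of t j m] that t(2) Suc in simp)
    then have "(\<Sum>j\<le>length t. frag_cmul ((-1) ^ j) (bnd (Tuple (face m j t)))) =
        (\<Sum>j\<le>length t. frag_cmul ((-1) ^ j) (bar_boundary m (face m j t)))"
      by (intro sum.cong) auto
    also have "\<dots> = 0"
    proof (rule bar_boundary_bar_boundary)
      fix x y z u v assume tt: "t = u @ x # y # z # v"
      have c: "x \<in> B" "y \<in> B" "z \<in> B" "x \<in> carrier R" "y \<in> carrier R" "z \<in> carrier R"
        "product v \<in> carrier R"
        using tt t(3) tc by auto
      have "product (x # y # z # v) \<noteq> \<zero>"
        using product_suffix_nonzero[of u "x # y # z # v"] t(4) tc tt by simp
      moreover have "product (x # y # z # v) = (x \<otimes> (y \<otimes> z)) \<otimes> product v"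
        using c by (simp add: m_assoc)
      ultimately have "x \<otimes> (y \<otimes> z) \<noteq> \<zero>" using c by auto
      then show "m (m x y) z = m x (m y z)" using basis_product_assoc c by blast
    qed (use t in simp)
    finally show ?thesis .
  qed
  finally show ?thesis .
qed

lemma based_complex:
  assumes "peirce R (E T) (E T) \<subseteq> path_span T"
  shows "based_complex (simplices T B) bnd"
  by (rule based_complex.intro) (use bnd_closed[OF assms] bnd_bnd[OF assms] in blast)+

end

context quiver_algebra
begin

lemma sc_boundary_corner_eq:
  assumes "quiver_basis R Q \<gamma> J T B" "quiver_basis R Q \<gamma> J T' B'" "B \<subseteq> B'" "T \<subseteq> T'"
    and s: "s \<in> simplices T B (Suc n)"
  shows "sc_boundary_simplex (corner R (E T)) (induce_subgraph Q T) \<gamma> B s =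
    sc_boundary_simplex (corner R (E T')) (induce_subgraph Q T') \<gamma> B' s"
proof -
  interpret B: quiver_basis R Q \<gamma> J T B by fact
  interpret B': quiver_basis R Q \<gamma> J T' B' by fact
  show ?thesis
  proof (cases n)
    case 0
    then obtain b where b: "s = Tuple [b]" "b \<in> B" using s by (auto simp: simplices_def)
    obtain x y where xy: "x \<in> T" "y \<in> T" "b \<in> P x y" using B.endpoints_exist b by blast
    then show ?thesis
      unfolding b(1) using B.bnd_one[OF b(2), of x y] B'.bnd_one[of b x y] b assms(3,4)
      by (metis subsetD)
  next
    case (Suc k)
    have "2 \<le> Suc n" using Suc by simp
    then obtain t where t: "s = Tuple t" "length t = Suc n" "set t \<subseteq> B" "product t \<noteq> \<zero>"
      using B.simplices_length_ge_2[OF s] by metis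
    have tc: "set t \<subseteq> carrier R" using t(3) B.B_closed by auto
    have "bar_boundary B.m t = (bar_boundary B'.m t :: ('v, 'r) sc_simplex \<Rightarrow>\<^sub>0 int)"
      unfolding bar_boundary_def
    proof (rule sum.cong[OF refl])
      fix j assume j: "j \<in> {..length t}"
      have "face B.m j t = face B'.m j t"
      proof (cases "j = 0 \<or> j = length t")
        case True
        moreover have "t \<noteq> []" using t(2) by auto
        ultimately show ?thesis using face_last[of t] by auto
      next
        case False
        define u v where "u = take (j - 1) t" and "v = drop (Suc j) t"
        have j': "j - 1 < length t" "Suc (j - 1) = j" "j < length t" using False j by auto
        have "t = take (j - 1) t @ t ! (j - 1) # drop (Suc (j - 1)) t"
          using j'(1) by (rule id_take_nth_drop)
        then have split: "t = u @ t ! (j - 1) # t ! j # v"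
          unfolding j'(2) Cons_nth_drop_Suc[OF j'(3), symmetric] u_def v_def .
        have nz: "t ! (j - 1) \<otimes> t ! j \<noteq> \<zero>"
          using product_infix_nonzero[of u "t ! (j - 1)" "t ! j" v, folded split] t(4) tc by blast
        have el: "t ! (j - 1) \<in> B" "t ! j \<in> B"
          using t(3) j' nth_mem by blast+
        obtain c where "B.m (t ! (j - 1)) (t ! j) \<in> B" "c \<noteq> 0"
          "t ! (j - 1) \<otimes> t ! j = c \<odot> B.m (t ! (j - 1)) (t ! j)"
          using B.basis_product[OF el nz] by blast
        then have "B'.m (t ! (j - 1)) (t ! j) = B.m (t ! (j - 1)) (t ! j)"
          using B'.basis_product_eq assms(3) by blast
        then show ?thesis using False j by (simp add: face_middle)
      qed
      then show "frag_cmul ((-1) ^ j) (frag_of (Tuple (face B.m j t))) =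
          (frag_cmul ((-1) ^ j) (frag_of (Tuple (face B'.m j t))) :: ('v, 'r) sc_simplex \<Rightarrow>\<^sub>0 int)"
        by simp
    qed
    then show ?thesis
      using t Suc by (simp add: B.bnd_bar B'.bnd_bar)
  qed
qed

end

section \<open>Gluing semi-normed bases\<close>

context quiver_basis
begin

lemma semi_normed_on_restrict:
  assumes U: "U \<subseteq> T"
  shows "semi_normed_on U (B \<inter> peirce R (E U) (E U))"
  unfolding semi_normed_on_def
proof (intro conjI ballI subsetI)
  have UQ: "U \<subseteq> verts Q" using U T by blast
  let ?C = "peirce R (E U) (E U)"
  fix b assume "b \<in> B \<inter> ?C"
  then have b: "b \<in> B" "b \<in> ?C" by auto
  obtain x y where xy: "x \<in> T" "y \<in> T" "b \<in> P x y" using endpoints_exist b by blast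
  then have "x \<in> U" "y \<in> U"
    using P_in_corner_iff[OF UQ, of x y b] b B_nonzero T by auto
  then show "b \<in> (\<Union>x\<in>U. \<Union>y\<in>U. P x y)" using xy by blast
next
  let ?C = "peirce R (E U) (E U)"
  have UQ: "U \<subseteq> verts Q" using U T by blast
  fix x y assume xy: "x \<in> U" "y \<in> U"
  then have "B \<inter> ?C \<inter> P x y = B \<inter> P x y" using P_subset_corner[OF UQ] by blast
  then show "k_basis R (P x y) (B \<inter> ?C \<inter> P x y)" using k_basis_P xy U by auto
next
  have UQ: "U \<subseteq> verts Q" using U T by blast
  fix x assume x: "x \<in> U"
  then have "\<epsilon> x \<in> B" using B U by (auto simp: semi_normed_on_def)
  then show "\<epsilon> x \<in> B \<inter> peirce R (E U) (E U)"
    using x UQ idem_in_P[of x] P_subset_corner[OF UQ x x] by blast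
next
  have UQ: "U \<subseteq> verts Q" using U T by blast
  fix a assume a: "a \<in> {a \<in> arcs Q. tail Q a \<in> U \<and> head Q a \<in> U}"
  then have "\<gamma> (arrow_path Q a) \<in> B" using B U by (auto simp: semi_normed_on_def)
  moreover have "\<gamma> (arrow_path Q a) \<in> P (tail Q a) (head Q a)"
    using path_in_P arrow_path_in_paths[of a] a UQ by (auto simp: arrow_path_def)
  ultimately show "\<gamma> (arrow_path Q a) \<in> B \<inter> peirce R (E U) (E U)"
    using P_subset_corner[OF UQ] a by blast
next
  have UQ: "U \<subseteq> verts Q" using U T by blast
  let ?C = "peirce R (E U) (E U)"
  fix b b' assume b: "b \<in> B \<inter> ?C" "b' \<in> B \<inter> ?C"
  show "b \<otimes> b' = \<zero> \<or> (\<exists>c b''. c \<noteq> 0 \<and> b'' \<in> B \<inter> ?C \<and> b \<otimes> b' = c \<odot> b'')"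
  proof (cases "b \<otimes> b' = \<zero>")
    case False
    then obtain c where c: "m b b' \<in> B" "c \<noteq> 0" "b \<otimes> b' = c \<odot> m b b'"
      using basis_product[of b b'] b by blast
    have bc: "b \<in> carrier R" "E U \<otimes> b = b" "b' \<in> carrier R" "b' \<otimes> E U = b'"
      using b EE_iff[OF UQ] by auto
    have Ec: "E U \<in> carrier R" using UQ by simp
    have "m b b' = inverse c \<odot> (b \<otimes> b')"
      using smult_eq_iff[of "m b b'" "b \<otimes> b'" c] B_closed bc c by auto
    moreover have "E U \<otimes> (b \<otimes> b') = b \<otimes> b'" using bc Ec by (simp flip: m_assoc)
    moreover have "(b \<otimes> b') \<otimes> E U = b \<otimes> b'" using bc Ec by (simp add: m_assoc)
    ultimately have "m b b' \<in> ?C"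
      using bc Ec by (simp add: EE_iff[OF UQ] smult_mult mult_smult)
    then show ?thesis using c by blast
  qed simp
qed

end

context quiver_algebra
begin

text \<open>
  Both bases consist of multiples of classes of paths, and every nonzero class of a path is a
  multiple of an element of either basis.
\<close>

lemma bases_proportional:
  assumes "quiver_basis R Q \<gamma> J T B" "quiver_basis R Q \<gamma> J T B'"
    and gen: "peirce R (E T) (E T) \<subseteq> path_span T" and b: "b \<in> B"
  shows "\<exists>c. c \<noteq> 0 \<and> c \<odot> b \<in> B'"
proof -
  interpret B: quiver_basis R Q \<gamma> J T B by fact
  interpret B': quiver_basis R Q \<gamma> J T B' by fact
  obtain x p y c where p: "(x, p, y) \<in> paths (induce_subgraph Q T)" "c \<noteq> 0" "b = c \<odot> \<gamma> (x, p, y)"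
    using B.basis_path_multiple[OF gen b] by auto
  have cl: "\<gamma> (x, p, y) \<in> carrier R" using p paths_induce_subset[OF B.T] path_closed by blast
  have "\<gamma> (x, p, y) \<noteq> \<zero>" using p B.B_nonzero[OF b] by auto
  then obtain d b' where d: "d \<noteq> 0" "b' \<in> B'" "\<gamma> (x, p, y) = d \<odot> b'"
    using B'.path_multiple[OF p(1)] by blast
  have "b = (c * d) \<odot> b'" using p d B'.B_closed by (simp add: smult_smult)
  then have "inverse (c * d) \<odot> b = b'"
    using smult_eq_iff[of b' b "c * d"] p d B'.B_closed B.B_closed b by auto
  then show ?thesis using p d by (intro exI[of _ "inverse (c * d)"]) auto
qed

end

locale gluing = quiver_algebra +
  fixes S S1 S2 B1 B2
  assumes S1: "quiver_basis R Q \<gamma> J (S1 \<union> S) B1" and S2: "quiver_basis R Q \<gamma> J (S2 \<union> S) B2"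
    and disjoint: "S1 \<inter> S = {}" "S2 \<inter> S = {}" "S1 \<inter> S2 = {}"
    and verts: "S1 \<union> S \<union> S2 = verts Q"
    and P12: "x \<in> S1 \<Longrightarrow> y \<in> S2 \<Longrightarrow> P x y = {\<zero>}" and P21: "x \<in> S2 \<Longrightarrow> y \<in> S1 \<Longrightarrow> P x y = {\<zero>}"
    and agree: "B1 \<inter> peirce R (E S) (E S) = B2 \<inter> peirce R (E S) (E S)"
begin

sublocale B1: quiver_basis R Q \<gamma> J "S1 \<union> S" B1 by (rule S1)
sublocale B2: quiver_basis R Q \<gamma> J "S2 \<union> S" B2 by (rule S2)

lemma swap: "gluing R Q \<gamma> J S S2 S1 B2 B1"
  by (intro gluing.intro gluing_axioms.intro quiver_algebra_axioms S1 S2 P12 P21)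
    (use disjoint verts agree in auto)

lemma S_verts: "S \<subseteq> verts Q" using verts by blast

lemma mem_B1_iff:
  assumes "b \<in> B1 \<union> B2" "x \<in> verts Q" "y \<in> verts Q" "b \<in> P x y"
  shows "b \<in> B1 \<longleftrightarrow> x \<in> S1 \<union> S \<and> y \<in> S1 \<union> S"
proof
  assume "b \<in> B1"
  then show "x \<in> S1 \<union> S \<and> y \<in> S1 \<union> S" using B1.B_endpoints assms by blast
next
  assume xy: "x \<in> S1 \<union> S \<and> y \<in> S1 \<union> S"
  show "b \<in> B1"
  proof (rule ccontr)
    assume "b \<notin> B1"
    then have b: "b \<in> B2" using assms by blast
    then have "x \<in> S" "y \<in> S" using B2.B_endpoints[OF b assms(4,2,3)] xy disjoint by auto
    then have "b \<in> peirce R (E S) (E S)" using P_subset_corner[OF S_verts] assms by blast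
    then show False using agree b \<open>b \<notin> B1\<close> by blast
  qed
qed

lemma mem_B2_iff:
  assumes "b \<in> B1 \<union> B2" "x \<in> verts Q" "y \<in> verts Q" "b \<in> P x y"
  shows "b \<in> B2 \<longleftrightarrow> x \<in> S2 \<union> S \<and> y \<in> S2 \<union> S"
  using gluing.mem_B1_iff[OF swap] assms by blast

lemma B_Int: "B1 \<inter> B2 = B1 \<inter> peirce R (E S) (E S)"
proof
  show "B1 \<inter> B2 \<subseteq> B1 \<inter> peirce R (E S) (E S)"
  proof
    fix b assume b: "b \<in> B1 \<inter> B2"
    then obtain x y where xy: "x \<in> S1 \<union> S" "y \<in> S1 \<union> S" "b \<in> P x y" using B1.endpoints_exist by blast
    then have v: "x \<in> verts Q" "y \<in> verts Q" using verts by auto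
    have "x \<in> S" "y \<in> S" using B2.B_endpoints[OF _ xy(3) v] b xy disjoint by auto
    then show "b \<in> B1 \<inter> peirce R (E S) (E S)" using P_subset_corner[OF S_verts] xy b by blast
  qed
qed (use agree in blast)

lemma basis_Int: "quiver_basis R Q \<gamma> J S (B1 \<inter> B2)"
  using B1.semi_normed_on_restrict[of S] S_verts
  by (intro quiver_basis.intro quiver_basis_axioms.intro quiver_algebra_axioms) (auto simp: B_Int)

lemma Un_endpoints:
  assumes "b \<in> B1 \<union> B2"
  obtains x y where "x \<in> verts Q" "y \<in> verts Q" "b \<in> P x y" "b \<noteq> \<zero>" "b \<in> carrier R"
proof -
  have "\<exists>x\<in>verts Q. \<exists>y\<in>verts Q. b \<in> P x y"
    using assms B1.endpoints_exist B2.endpoints_exist verts by blast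
  moreover have "b \<noteq> \<zero>" "b \<in> carrier R"
    using assms B1.B_nonzero B2.B_nonzero B1.B_closed B2.B_closed by blast+
  ultimately show thesis using that by blast
qed

lemma product_mixed:
  assumes "b \<in> B1" "b' \<in> B2"
  shows "b \<otimes> b' = \<zero> \<or> b \<in> B2 \<or> b' \<in> B1"
proof (rule ccontr)
  assume *: "\<not> ?thesis"
  obtain x y where xy: "x \<in> verts Q" "y \<in> verts Q" "b \<in> P x y" using Un_endpoints assms by blast
  obtain y' z where yz: "y' \<in> verts Q" "z \<in> verts Q" "b' \<in> P y' z" using Un_endpoints assms by blast
  have "y' = y" using P_mult_zero[OF xy(1,2) yz(1,2) xy(3) yz(3)] * by auto
  then have "b \<otimes> b' \<in> P x z" using P_mult[of x y z b b'] xy yz by simp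
  moreover have "x \<in> S1 \<union> S" "y \<in> S1 \<union> S" "y \<in> S2 \<union> S" "z \<in> S2 \<union> S"
    using mem_B1_iff[of b x y] mem_B2_iff[of b' y z] assms xy yz \<open>y' = y\<close> by auto
  moreover have "\<not> (x \<in> S2 \<union> S \<and> y \<in> S2 \<union> S)" "\<not> (y \<in> S1 \<union> S \<and> z \<in> S1 \<union> S)"
    using mem_B2_iff[of b x y] mem_B1_iff[of b' y z] assms xy yz \<open>y' = y\<close> * by auto
  ultimately have "x \<in> S1" "z \<in> S2" by auto
  then show False using P12 \<open>b \<otimes> b' \<in> P x z\<close> * by auto
qed

lemma product_Un:
  assumes "b \<in> B1 \<union> B2" "b' \<in> B1 \<union> B2" "b \<otimes> b' \<noteq> \<zero>"
  shows "\<exists>c b''. c \<noteq> 0 \<and> b'' \<in> B1 \<union> B2 \<and> b \<otimes> b' = c \<odot> b''"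
proof -
  consider "b \<in> B1" "b' \<in> B1" | "b \<in> B2" "b' \<in> B2"
    using product_mixed[of b b'] gluing.product_mixed[OF swap, of b b'] assms by blast
  then show ?thesis
  proof cases
    case 1
    then show ?thesis using B1.basis_product[OF 1 assms(3)] by blast
  next
    case 2
    then show ?thesis using B2.basis_product[OF 2 assms(3)] by blast
  qed
qed

lemma k_basis_Un:
  assumes "x \<in> S1 \<union> S" "y \<in> S1 \<union> S"
  shows "k_basis R (P x y) ((B1 \<union> B2) \<inter> P x y)"
proof -
  have "(B1 \<union> B2) \<inter> P x y = B1 \<inter> P x y"
    using mem_B1_iff[of _ x y] assms verts by blast
  then show ?thesis using B1.k_basis_P assms by simp
qed

lemma basis_Un: "quiver_basis R Q \<gamma> J (verts Q) (B1 \<union> B2)"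
proof (intro quiver_basis.intro quiver_basis_axioms.intro quiver_algebra_axioms order_refl)
  show "semi_normed_on (verts Q) (B1 \<union> B2)"
    unfolding semi_normed_on_def
  proof (intro conjI ballI)
    show "B1 \<union> B2 \<subseteq> (\<Union>x\<in>verts Q. \<Union>y\<in>verts Q. P x y)"
      using Un_endpoints by blast
  next
    fix x y assume xy: "x \<in> verts Q" "y \<in> verts Q"
    consider "x \<in> S1 \<union> S" "y \<in> S1 \<union> S" | "x \<in> S2 \<union> S" "y \<in> S2 \<union> S" | "P x y = {\<zero>}"
      using xy verts P12 P21 by blast
    then show "k_basis R (P x y) ((B1 \<union> B2) \<inter> P x y)"
    proof cases
      case 1
      then show ?thesis by (rule k_basis_Un)
    next
      case 2
      then show ?thesis using gluing.k_basis_Un[OF swap, of x y] by (simp add: Un_commute)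
    next
      case 3
      have "(B1 \<union> B2) \<inter> P x y = {}" using 3 B1.B_nonzero B2.B_nonzero by auto
      then show ?thesis using 3 by (auto simp: k_basis_def intro!: exI[of _ 0])
    qed
  next
    fix x assume "x \<in> verts Q"
    then show "\<epsilon> x \<in> B1 \<union> B2"
      using B1.B B2.B verts by (auto simp: semi_normed_on_def)
  next
    fix a assume "a \<in> {a \<in> arcs Q. tail Q a \<in> verts Q \<and> head Q a \<in> verts Q}"
    then have a: "a \<in> arcs Q" "tail Q a \<in> verts Q" "head Q a \<in> verts Q" by auto
    have "\<gamma> (arrow_path Q a) \<in> P (tail Q a) (head Q a)"
      using path_in_P arrow_path_in_paths[OF a(1)] a by (auto simp: arrow_path_def)
    then have "P (tail Q a) (head Q a) \<noteq> {\<zero>}" using arrow_nonzero a by auto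
    then have "tail Q a \<in> S1 \<union> S \<and> head Q a \<in> S1 \<union> S \<or> tail Q a \<in> S2 \<union> S \<and> head Q a \<in> S2 \<union> S"
      using a verts P12 P21 by blast
    then show "\<gamma> (arrow_path Q a) \<in> B1 \<union> B2"
      using B1.B B2.B a unfolding semi_normed_on_def by blast
  next
    fix b b' assume "b \<in> B1 \<union> B2" "b' \<in> B1 \<union> B2"
    then show "b \<otimes> b' = \<zero> \<or> (\<exists>c b''. c \<noteq> 0 \<and> b'' \<in> B1 \<union> B2 \<and> b \<otimes> b' = c \<odot> b'')"
      using product_Un by blast
  qed
qed

lemma Un_closed: "set t \<subseteq> B1 \<union> B2 \<Longrightarrow> set t \<subseteq> carrier R"
  using B1.B_closed B2.B_closed by blast

lemma product_from_S1:
  assumes "x \<in> S1" "y \<in> verts Q" "a \<in> P x y" "set t \<subseteq> B1 \<union> B2" "a \<otimes> product t \<noteq> \<zero>"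
  shows "y \<in> S1 \<union> S \<and> set t \<subseteq> B1"
  using assms
proof (induction t arbitrary: a y)
  case Nil
  have xv: "x \<in> verts Q" using Nil.prems verts by blast
  then have "a \<noteq> \<zero>" using Nil.prems P_subset by auto
  then show ?case using Nil.prems P12[of x y] verts by auto
next
  case (Cons b t)
  have xv: "x \<in> verts Q" using Cons.prems verts by blast
  have acl: "a \<in> carrier R" using Cons.prems P_subset xv by blast
  have bU: "b \<in> B1 \<union> B2" using Cons.prems by simp
  then obtain y' z where b: "y' \<in> verts Q" "z \<in> verts Q" "b \<in> P y' z" "b \<in> carrier R"
    using Un_endpoints by blast
  have t: "set t \<subseteq> B1 \<union> B2" using Cons.prems by simp
  then have tcl: "product t \<in> carrier R" using Un_closed by simp
  have nz: "(a \<otimes> b) \<otimes> product t \<noteq> \<zero>" using Cons.prems(5) acl b tcl by (simp add: m_assoc)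
  then have ab: "a \<otimes> b \<noteq> \<zero>" using tcl by auto
  then have y': "y' = y" using P_mult_zero[OF xv Cons.prems(2) b(1,2) Cons.prems(3) b(3)] by auto
  have abP: "a \<otimes> b \<in> P x z" using P_mult[OF xv Cons.prems(2) b(2) Cons.prems(3)] b y' by simp
  have IH: "z \<in> S1 \<union> S" "set t \<subseteq> B1" using Cons.IH[OF Cons.prems(1) b(2) abP t nz] by auto
  have "a \<noteq> \<zero>" using ab b by auto
  then have y: "y \<in> S1 \<union> S" using Cons.prems P12[of x y] verts by auto
  have "b \<in> B1" using mem_B1_iff[OF bU b(1-3)] y y' IH by simp
  then show ?case using y IH by simp
qed

lemma product_nonzero_one_side:
  assumes "set s \<subseteq> B1 \<union> B2" "product s \<noteq> \<zero>"
  shows "set s \<subseteq> B1 \<or> set s \<subseteq> B2"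
  using assms
proof (induction s)
  case (Cons b s)
  have bU: "b \<in> B1 \<union> B2" using Cons.prems by simp
  then obtain x y where b: "x \<in> verts Q" "y \<in> verts Q" "b \<in> P x y" "b \<in> carrier R"
    using Un_endpoints by blast
  have s: "set s \<subseteq> B1 \<union> B2" using Cons.prems by simp
  then have scl: "product s \<in> carrier R" using Un_closed by simp
  have nz: "b \<otimes> product s \<noteq> \<zero>" using Cons.prems by simp
  have "\<epsilon> y \<otimes> product s \<noteq> \<zero>"
    using nz b scl m_assoc[of b "\<epsilon> y" "product s"] by (auto simp: P_iff)
  then have one: "y \<in> S1 \<Longrightarrow> set s \<subseteq> B1" "y \<in> S2 \<Longrightarrow> set s \<subseteq> B2"
    using product_from_S1[of y y "\<epsilon> y" s] gluing.product_from_S1[OF swap, of y y "\<epsilon> y" s]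
      idem_in_P b(2) s by (auto simp: Un_commute)
  have two: "x \<in> S1 \<Longrightarrow> y \<in> S1 \<union> S \<and> set s \<subseteq> B1" "x \<in> S2 \<Longrightarrow> y \<in> S2 \<union> S \<and> set s \<subseteq> B2"
    using product_from_S1[of x y b s] gluing.product_from_S1[OF swap, of x y b s] b s nz
    by (auto simp: Un_commute)
  have "product s \<noteq> \<zero>" using nz b by auto
  then have IH: "set s \<subseteq> B1 \<or> set s \<subseteq> B2" using Cons.IH s by blast
  have m1: "b \<in> B1 \<longleftrightarrow> x \<in> S1 \<union> S \<and> y \<in> S1 \<union> S" by (rule mem_B1_iff[OF bU b(1-3)])
  have m2: "b \<in> B2 \<longleftrightarrow> x \<in> S2 \<union> S \<and> y \<in> S2 \<union> S" by (rule mem_B2_iff[OF bU b(1-3)])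
  have "x \<in> S1 \<or> x \<in> S2 \<or> x \<in> S" "y \<in> S1 \<or> y \<in> S2 \<or> y \<in> S" using b verts by auto
  then show ?case using one two IH m1 m2 by auto
qed simp

lemma simplices_Un:
  "simplices (verts Q) (B1 \<union> B2) n = simplices (S1 \<union> S) B1 n \<union> simplices (S2 \<union> S) B2 n"
proof -
  have "verts Q = (S1 \<union> S) \<union> (S2 \<union> S)" using verts by blast
  moreover have "set s \<subseteq> B1 \<union> B2 \<and> product s \<noteq> \<zero> \<and> X \<longleftrightarrow>
      set s \<subseteq> B1 \<and> product s \<noteq> \<zero> \<and> X \<or> set s \<subseteq> B2 \<and> product s \<noteq> \<zero> \<and> X" for s X
    using product_nonzero_one_side[of s] by blast
  ultimately show ?thesis
    unfolding simplices_def by auto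
qed

lemma simplices_Int:
  "simplices S (B1 \<inter> B2) n = simplices (S1 \<union> S) B1 n \<inter> simplices (S2 \<union> S) B2 n"
  using disjoint by (auto simp: simplices_def)

theorem long_exact_sequence:
  assumes gen: "peirce R (E (S1 \<union> S)) (E (S1 \<union> S)) \<subseteq> path_span (S1 \<union> S)"
      "peirce R (E (S2 \<union> S)) (E (S2 \<union> S)) \<subseteq> path_span (S2 \<union> S)"
    and G: "comm_group (G :: 'g monoid)"
  shows "long_exact_sequence
    (SH R Q \<gamma> (B1 \<union> B2) G)
    (\<lambda>n. SH (corner R (E (S1 \<union> S))) (induce_subgraph Q (S1 \<union> S)) \<gamma> B1 G n \<times>\<times>
         SH (corner R (E (S2 \<union> S))) (induce_subgraph Q (S2 \<union> S)) \<gamma> B2 G n)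
    (SH (corner R (E S)) (induce_subgraph Q S) \<gamma> (B1 \<inter> B2) G)"
proof -
  interpret U: quiver_basis R Q \<gamma> J "verts Q" "B1 \<union> B2" by (rule basis_Un)
  interpret I: quiver_basis R Q \<gamma> J S "B1 \<inter> B2" by (rule basis_Int)
  let ?bd = U.bnd
  have SU: "SH R Q \<gamma> (B1 \<union> B2) G =
      cohomology (cochains (simplices (verts Q) (B1 \<union> B2)) G) (coboundary (simplices (verts Q) (B1 \<union> B2)) ?bd)"
    using U.sc_simplices_corner by (simp add: SH_eq_cohomology corner_verts induce_verts)
  have SH: "SH (corner R (E T)) (induce_subgraph Q T) \<gamma> B G =
      cohomology (cochains (simplices T B) G) (coboundary (simplices T B) ?bd)"
    and eq: "\<And>n s. s \<in> simplices T B (Suc n) \<Longrightarrow>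
      sc_boundary_simplex (corner R (E T)) (induce_subgraph Q T) \<gamma> B s = ?bd s"
    if "quiver_basis R Q \<gamma> J T B" "B \<subseteq> B1 \<union> B2" for T B
  proof -
    have T: "T \<subseteq> verts Q" using quiver_basis.T[OF that(1)] .
    show *: "sc_boundary_simplex (corner R (E T)) (induce_subgraph Q T) \<gamma> B s = ?bd s"
      if "s \<in> simplices T B (Suc n)" for n s
      by (rule sc_boundary_corner_eq[OF _ basis_Un _ T that]) fact+
    show "SH (corner R (E T)) (induce_subgraph Q T) \<gamma> B G =
      cohomology (cochains (simplices T B) G) (coboundary (simplices T B) ?bd)"
      unfolding SH_eq_cohomology quiver_basis.sc_simplices_corner[OF that(1)]
      by (intro arg_cong[where f = "cohomology _"] coboundary_cong *)
  qed
  have b1: "based_complex (simplices (S1 \<union> S) B1) ?bd"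
    by (rule based_complex_cong[OF B1.based_complex[OF gen(1)] eq[OF S1]]) auto
  have b2: "based_complex (simplices (S2 \<union> S) B2) ?bd"
    by (rule based_complex_cong[OF B2.based_complex[OF gen(2)] eq[OF S2]]) auto
  have U': "(\<lambda>n. simplices (S1 \<union> S) B1 n \<union> simplices (S2 \<union> S) B2 n) = simplices (verts Q) (B1 \<union> B2)"
    and I': "(\<lambda>n. simplices (S1 \<union> S) B1 n \<inter> simplices (S2 \<union> S) B2 n) = simplices S (B1 \<inter> B2)"
    by (auto simp only: simplices_Un simplices_Int)
  have S1': "SH (corner R (E (S1 \<union> S))) (induce_subgraph Q (S1 \<union> S)) \<gamma> B1 G =
      cohomology (cochains (simplices (S1 \<union> S) B1) G) (coboundary (simplices (S1 \<union> S) B1) ?bd)"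
    by (rule SH[OF S1]) auto
  have S2': "SH (corner R (E (S2 \<union> S))) (induce_subgraph Q (S2 \<union> S)) \<gamma> B2 G =
      cohomology (cochains (simplices (S2 \<union> S) B2) G) (coboundary (simplices (S2 \<union> S) B2) ?bd)"
    by (rule SH[OF S2]) auto
  have SI': "SH (corner R (E S)) (induce_subgraph Q S) \<gamma> (B1 \<inter> B2) G =
      cohomology (cochains (simplices S (B1 \<inter> B2)) G) (coboundary (simplices S (B1 \<inter> B2)) ?bd)"
    by (rule SH[OF basis_Int]) auto
  show ?thesis
    unfolding SU S1' S2' SI'
    using mayer_vietoris_based_complexes[OF b1 b2 G] unfolding U' I' .
qed

end

section \<open>Path algebras and their quotients by admissible ideals\<close>

lemma lookup_pa_smult [simp]: "Poly_Mapping.lookup (pa_smult c f) k = c * Poly_Mapping.lookup f k"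
  by (simp add: pa_smult_def map.rep_eq when_def)

lemma pa_smult_add: "pa_smult c (f + g) = pa_smult c f + pa_smult c g"
  by (rule poly_mapping_eqI) (simp add: lookup_add algebra_simps)

lemma pa_smult_add_left: "pa_smult (c + d) f = pa_smult c f + pa_smult d f"
  by (rule poly_mapping_eqI) (simp add: lookup_add algebra_simps)

lemma pa_smult_pa_smult: "pa_smult c (pa_smult d f) = pa_smult (c * d) f"
  by (rule poly_mapping_eqI) (simp add: algebra_simps)

lemma pa_smult_one [simp]: "pa_smult 1 f = f"
  by (rule poly_mapping_eqI) simp

lemma pa_smult_zero [simp]: "pa_smult c 0 = 0" "pa_smult 0 f = 0"
  by (rule poly_mapping_eqI; simp)+

lemma pa_smult_sum: "pa_smult c (sum f A) = (\<Sum>x\<in>A. pa_smult c (f x))"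
  by (induction A rule: infinite_finite_induct) (simp_all add: pa_smult_add)

lemma keys_pa_smult: "Poly_Mapping.keys (pa_smult c f) \<subseteq> Poly_Mapping.keys f"
  by (auto simp: in_keys_iff)

lemma pa_smult_single: "pa_smult c (Poly_Mapping.single u d) = Poly_Mapping.single u (c * d)"
  by (rule poly_mapping_eqI) (simp add: lookup_single when_def)

lemma pa_mult_eq_sum:
  assumes "finite A" "finite B" "Poly_Mapping.keys f \<subseteq> A" "Poly_Mapping.keys g \<subseteq> B"
  shows "pa_mult f g = (\<Sum>u\<in>A. \<Sum>w\<in>B. pa_smult (Poly_Mapping.lookup f u * Poly_Mapping.lookup g w) (path_mult u w))"
proof -
  have "(\<Sum>w\<in>Poly_Mapping.keys g. pa_smult (Poly_Mapping.lookup f u * Poly_Mapping.lookup g w) (path_mult u w)) =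
      (\<Sum>w\<in>B. pa_smult (Poly_Mapping.lookup f u * Poly_Mapping.lookup g w) (path_mult u w))" for u
    by (rule sum.mono_neutral_left) (use assms in \<open>auto simp: in_keys_iff\<close>)
  then have "pa_mult f g = (\<Sum>u\<in>Poly_Mapping.keys f. \<Sum>w\<in>B. pa_smult (Poly_Mapping.lookup f u * Poly_Mapping.lookup g w) (path_mult u w))"
    by (simp add: pa_mult_def)
  also have "\<dots> = (\<Sum>u\<in>A. \<Sum>w\<in>B. pa_smult (Poly_Mapping.lookup f u * Poly_Mapping.lookup g w) (path_mult u w))"
    by (rule sum.mono_neutral_left) (use assms in \<open>auto simp: in_keys_iff\<close>)
  finally show ?thesis .
qed

lemma pa_smult_mult: "pa_mult (pa_smult c f) g = pa_smult c (pa_mult f g)"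
  using pa_mult_eq_sum[OF finite_keys finite_keys keys_pa_smult[of c f] order_refl[of "Poly_Mapping.keys g"]]
  by (simp add: pa_mult_def pa_smult_sum pa_smult_pa_smult mult.assoc)

lemma pa_mult_smult: "pa_mult f (pa_smult c g) = pa_smult c (pa_mult f g)"
  using pa_mult_eq_sum[OF finite_keys finite_keys order_refl[of "Poly_Mapping.keys f"] keys_pa_smult[of c g]]
  by (simp add: pa_mult_def pa_smult_sum pa_smult_pa_smult mult.left_commute)

lemma pa_mult_single: "pa_mult (Poly_Mapping.single u 1) (Poly_Mapping.single w 1) = path_mult u w"
  by (simp add: pa_mult_def)

lemma keys_pa_mult:
  fixes f g :: "('v, 'a) qpath \<Rightarrow>\<^sub>0 'k::field"
  assumes "t \<in> Poly_Mapping.keys (pa_mult f g)"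
  obtains x p y q z where "(x, p, y) \<in> Poly_Mapping.keys f" "(y, q, z) \<in> Poly_Mapping.keys g"
    "t = (x, p @ q, z)"
proof -
  obtain u w where uw: "u \<in> Poly_Mapping.keys f" "w \<in> Poly_Mapping.keys g"
    "t \<in> Poly_Mapping.keys (pa_smult (Poly_Mapping.lookup f u * Poly_Mapping.lookup g w) (path_mult u w))"
    using subsetD[OF keys_sum assms[unfolded pa_mult_def]] by (blast dest: subsetD[OF keys_sum])
  have t: "t \<in> Poly_Mapping.keys (path_mult u w :: _ \<Rightarrow>\<^sub>0 'k)"
    by (rule subsetD[OF keys_pa_smult uw(3)])
  obtain x p y where u: "u = (x, p, y)" by (cases u)
  obtain y' q z where w: "w = (y', q, z)" by (cases w)
  have "y = y'" "t = (x, p @ q, z)" using t by (auto simp: u w split: if_splits)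
  then show thesis using that uw(1,2) by (simp add: u w)
qed

lemma path_algebra_simps [simp]:
  "carrier (path_algebra Q) = {f. Poly_Mapping.keys f \<subseteq> paths Q}"
  "f \<otimes>\<^bsub>path_algebra Q\<^esub> g = pa_mult f g" "f \<oplus>\<^bsub>path_algebra Q\<^esub> g = f + g"
  "\<zero>\<^bsub>path_algebra Q\<^esub> = 0"
  "\<one>\<^bsub>path_algebra Q\<^esub> = (\<Sum>x\<in>verts Q. Poly_Mapping.single (stationary x) 1)"
  by (simp_all add: path_algebra_def)

lemma coset_path_algebra: "I +>\<^bsub>path_algebra Q\<^esub> f = (\<lambda>h. h + f) ` I"
  by (auto simp: a_r_coset_def r_coset_def)

lemma set_add_path_algebra: "set_add (path_algebra Q) I X = (\<Union>h\<in>I. (+) h ` X)"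
  by (auto simp: set_add_def set_mult_def)

lemma bound_quiver_algebra_simps [simp]:
  "carrier (bound_quiver_algebra Q I) = (\<lambda>f. I +>\<^bsub>path_algebra Q\<^esub> f) ` carrier (path_algebra Q)"
  "X \<otimes>\<^bsub>bound_quiver_algebra Q I\<^esub> Y = X \<otimes>\<^bsub>path_algebra Q Quot I\<^esub> Y"
  "X \<oplus>\<^bsub>bound_quiver_algebra Q I\<^esub> Y = X \<oplus>\<^bsub>path_algebra Q Quot I\<^esub> Y"
  "\<zero>\<^bsub>bound_quiver_algebra Q I\<^esub> = I"
  "\<one>\<^bsub>bound_quiver_algebra Q I\<^esub> = I +>\<^bsub>path_algebra Q\<^esub> \<one>\<^bsub>path_algebra Q\<^esub>"
  "c \<odot>\<^bsub>bound_quiver_algebra Q I\<^esub> X = set_add (path_algebra Q) I (pa_smult c ` X)"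
  by (auto simp: bound_quiver_algebra_def ring.defs module.defs FactRing_def A_RCOSETS_def RCOSETS_def
      a_r_coset_def)

definition long_paths :: "('v, 'a) pre_digraph \<Rightarrow> nat \<Rightarrow> (('v, 'a) qpath \<Rightarrow>\<^sub>0 'k::field) set" where
  "long_paths Q n = {f. Poly_Mapping.keys f \<subseteq> {(x, p, y). (x, p, y) \<in> paths Q \<and> n \<le> length p}}"

lemma long_paths_add: "f \<in> long_paths Q n \<Longrightarrow> g \<in> long_paths Q n \<Longrightarrow> f + g \<in> long_paths Q n"
  using keys_add[of f g] by (auto simp: long_paths_def)

lemma long_paths_antimono: "m \<le> n \<Longrightarrow> long_paths Q n \<subseteq> long_paths Q m"
  by (fastforce simp: long_paths_def)

locale bound_quiver_ideal =
  fixes Q :: "('v, 'a) pre_digraph" and I :: "(('v, 'a) qpath \<Rightarrow>\<^sub>0 'k::field) set"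
  assumes bound_quiver: "bound_quiver Q I"
begin

abbreviation "A \<equiv> path_algebra Q :: ('k, ('v, 'a) qpath \<Rightarrow>\<^sub>0 'k) module"
abbreviation "R \<equiv> bound_quiver_algebra Q I"
abbreviation "cls f \<equiv> I +>\<^bsub>A\<^esub> f"

sublocale ideal I A
  using bound_quiver by (simp add: bound_quiver_def admissible_def)

lemma A_mult_closed: "f \<in> carrier A \<Longrightarrow> g \<in> carrier A \<Longrightarrow> pa_mult f g \<in> carrier A"
  using m_closed[of f g] by simp

lemma A_minus: "f \<in> carrier A \<Longrightarrow> \<ominus>\<^bsub>A\<^esub> f = - f"
  by (rule minus_equality) auto

lemma long_paths_mult:
  fixes f g :: "('v, 'a) qpath \<Rightarrow>\<^sub>0 'k"
  assumes "f \<in> long_paths Q m" "g \<in> long_paths Q n"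
  shows "pa_mult f g \<in> long_paths Q (m + n)"
proof -
  have fg: "pa_mult f g \<in> carrier A"
    by (rule A_mult_closed) (use assms in \<open>auto simp: long_paths_def\<close>)
  have "m + n \<le> length r" if r: "(a, r, b) \<in> Poly_Mapping.keys (pa_mult f g)" for a r b
  proof -
    obtain x p y q z where "(x, p, y) \<in> Poly_Mapping.keys f" "(y, q, z) \<in> Poly_Mapping.keys g"
      "(a, r, b) = (x, p @ q, z)"
      using keys_pa_mult[OF r] by metis
    then show ?thesis using assms by (fastforce simp: long_paths_def)
  qed
  then show ?thesis using fg by (auto simp: long_paths_def)
qed

lemma carrier_A_long_paths: "carrier A = long_paths Q 0"
  by (auto simp: long_paths_def)

lemma ideal_long_paths: "ideal (long_paths Q n) A"
proof (rule idealI[OF ring_axioms])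
  show "subgroup (long_paths Q n) (add_monoid A)"
  proof (rule add.subgroupI)
    show "long_paths Q n \<subseteq> carrier A" by (auto simp: long_paths_def)
    show "long_paths Q n \<noteq> {}" by (auto simp: long_paths_def intro!: exI[of _ 0])
    fix f assume f: "(f :: _ \<Rightarrow>\<^sub>0 'k) \<in> long_paths Q n"
    then have "\<ominus>\<^bsub>A\<^esub> f = - f" by (intro A_minus) (auto simp: long_paths_def)
    then show "\<ominus>\<^bsub>A\<^esub> f \<in> long_paths Q n" using f by (simp add: long_paths_def)
  qed (simp add: long_paths_add)
next
  fix f g :: "('v, 'a) qpath \<Rightarrow>\<^sub>0 'k"
  assume "f \<in> long_paths Q n" "g \<in> carrier A"
  then show "g \<otimes>\<^bsub>A\<^esub> f \<in> long_paths Q n" "f \<otimes>\<^bsub>A\<^esub> g \<in> long_paths Q n"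
    using long_paths_mult[of g 0 f n] long_paths_mult[of f n g 0] carrier_A_long_paths by auto
qed

lemma ideal_prod_long_paths:
  assumes "X \<subseteq> long_paths Q m" "Y \<subseteq> long_paths Q n"
  shows "ideal_prod A X Y \<subseteq> long_paths Q (m + n)"
proof
  fix f assume "f \<in> ideal_prod A X Y"
  then show "f \<in> long_paths Q (m + n)"
    by induction (use assms in \<open>auto intro: long_paths_mult long_paths_add\<close>)
qed

lemma single_path_in_long_paths:
  "(x, p, y) \<in> paths Q \<Longrightarrow> n \<le> length p \<Longrightarrow> Poly_Mapping.single (x, p, y) c \<in> long_paths Q n"
  by (simp add: long_paths_def)

lemma wf: "wf_digraph Q" and finite_verts: "finite (verts Q)"
  using bound_quiver by (simp_all add: bound_quiver_def)

lemma arrow_path_in_paths: "\<alpha> \<in> arcs Q \<Longrightarrow> arrow_path Q \<alpha> \<in> paths Q"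
  using wf by (simp add: arrow_path_def paths_def pre_digraph.awalk_def pre_digraph.cas.simps wf_digraph_def)

lemma stationary_in_paths: "x \<in> verts Q \<Longrightarrow> stationary x \<in> paths Q"
  by (simp add: stationary_def paths_def pre_digraph.awalk_def pre_digraph.cas.simps)

lemma I_long_paths: "I \<subseteq> long_paths Q 2"
proof -
  have "arrow_ideal Q \<subseteq> (long_paths Q 1 :: (_ \<Rightarrow>\<^sub>0 'k) set)"
    unfolding arrow_ideal_def
    by (rule genideal_minimal[OF ideal_long_paths])
      (use arrow_path_in_paths in \<open>auto simp: arrow_path_def intro: single_path_in_long_paths\<close>)
  then have "ideal_power A (arrow_ideal Q) 2 \<subseteq> long_paths Q (0 + 1 + 1)"
    unfolding numeral_2_eq_2 ideal_power.simps
    by (intro ideal_prod_long_paths) (simp_all add: carrier_A_long_paths del: path_algebra_simps(1))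
  then show ?thesis
    using bound_quiver by (auto simp: bound_quiver_def admissible_def numeral_2_eq_2)
qed

lemma I_smult:
  assumes "f \<in> I" shows "pa_smult c f \<in> I"
proof -
  have f: "f \<in> carrier A" using assms Icarr by blast
  have one: "\<one>\<^bsub>A\<^esub> \<in> carrier A" by (rule one_closed)
  then have "pa_smult c \<one>\<^bsub>A\<^esub> \<in> carrier A" using keys_pa_smult[of c "\<one>\<^bsub>A\<^esub>"] by auto
  then have "pa_mult (pa_smult c \<one>\<^bsub>A\<^esub>) f \<in> I" using I_l_closed[OF assms] by simp
  moreover have "pa_mult \<one>\<^bsub>A\<^esub> f = f" using l_one[OF f] by simp
  ultimately show ?thesis by (simp only: pa_smult_mult)
qed

lemma cls_mem: "g \<in> cls f \<longleftrightarrow> g - f \<in> I"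
proof
  assume "g - f \<in> I"
  then have "(g - f) + f \<in> (\<lambda>h. h + f) ` I" by blast
  then show "g \<in> cls f" by (simp add: coset_path_algebra)
qed (auto simp: coset_path_algebra)

lemma I_add: "f \<in> I \<Longrightarrow> g \<in> I \<Longrightarrow> f + g \<in> I"
  using additive_subgroup.a_closed[OF additive_subgroup_axioms, of f g] by simp

lemma I_zero: "0 \<in> I"
  using additive_subgroup.zero_closed[OF additive_subgroup_axioms] by simp

lemma I_uminus:
  assumes "f \<in> I" shows "- f \<in> I"
proof -
  have "pa_smult (-1) f = - f" by (rule poly_mapping_eqI) simp
  then show ?thesis using I_smult[OF assms, of "-1"] by simp
qed

lemma cls_eq_iff: "cls f = cls g \<longleftrightarrow> f - g \<in> I"
proof
  assume "cls f = cls g"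
  moreover have "f \<in> cls f" using I_zero by (simp add: cls_mem)
  ultimately show "f - g \<in> I" by (simp add: cls_mem)
next
  assume fg: "f - g \<in> I"
  have "h - f \<in> I \<longleftrightarrow> h - g \<in> I" for h
    using I_add[OF _ fg, of "h - f"] I_add[OF _ I_uminus[OF fg], of "h - g"] by auto
  then show "cls f = cls g" by (auto simp: cls_mem)
qed

lemma cls_zero: "cls 0 = I"
  by (simp add: coset_path_algebra)

lemma cls_mult: "f \<in> carrier A \<Longrightarrow> g \<in> carrier A \<Longrightarrow> cls f \<otimes>\<^bsub>R\<^esub> cls g = cls (pa_mult f g)"
  using ring_hom_mult[OF rcos_ring_hom, of f g] by simp

lemma cls_add: "f \<in> carrier A \<Longrightarrow> g \<in> carrier A \<Longrightarrow> cls f \<oplus>\<^bsub>R\<^esub> cls g = cls (f + g)"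
  using ring_hom_add[OF rcos_ring_hom, of f g] by simp

lemma cls_smult: "c \<odot>\<^bsub>R\<^esub> cls f = cls (pa_smult c f)"
proof -
  have "set_add A I (pa_smult c ` cls f) = (\<lambda>h. h + pa_smult c f) ` I"
    unfolding set_add_path_algebra coset_path_algebra
  proof (intro equalityI subsetI)
    fix g assume "g \<in> (\<Union>h\<in>I. (+) h ` pa_smult c ` (\<lambda>h. h + f) ` I)"
    then obtain h h' where "h \<in> I" "h' \<in> I" "g = h + pa_smult c (h' + f)" by auto
    then have "g = (h + pa_smult c h') + pa_smult c f" "h + pa_smult c h' \<in> I"
      using I_add I_smult by (auto simp: pa_smult_add add.assoc)
    then show "g \<in> (\<lambda>h. h + pa_smult c f) ` I" by blast
  next
    fix g assume "g \<in> (\<lambda>h. h + pa_smult c f) ` I"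
    then obtain h where "h \<in> I" "g = h + pa_smult c (0 + f)" by auto
    then show "g \<in> (\<Union>h\<in>I. (+) h ` pa_smult c ` (\<lambda>h. h + f) ` I)" using I_zero by blast
  qed
  then show ?thesis by (simp add: coset_path_algebra)
qed

lemma A_smult_closed: "f \<in> carrier A \<Longrightarrow> pa_smult c f \<in> carrier A"
  using keys_pa_smult[of c f] by auto

lemma A_add_closed: "f \<in> carrier A \<Longrightarrow> g \<in> carrier A \<Longrightarrow> f + g \<in> carrier A"
  using keys_add[of f g] by auto

lemma ring_R: "ring R"
proof -
  interpret q: ring "A Quot I" by (rule quotient_is_ring)
  have c: "carrier R = carrier (A Quot I)"
    by (auto simp: FactRing_def A_RCOSETS_def RCOSETS_def a_r_coset_def)
  have z: "\<zero>\<^bsub>R\<^esub> = \<zero>\<^bsub>A Quot I\<^esub>" "\<one>\<^bsub>R\<^esub> = \<one>\<^bsub>A Quot I\<^esub>" by (simp_all add: FactRing_def)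
  have m: "X \<otimes>\<^bsub>R\<^esub> Y = X \<otimes>\<^bsub>A Quot I\<^esub> Y" "X \<oplus>\<^bsub>R\<^esub> Y = X \<oplus>\<^bsub>A Quot I\<^esub> Y" for X Y by simp_all
  show ?thesis
  proof (rule ringI)
    show "abelian_group R"
    proof (rule abelian_groupI; unfold c z m)
      fix X assume "X \<in> carrier (A Quot I)"
      then show "\<exists>Y\<in>carrier (A Quot I). Y \<oplus>\<^bsub>A Quot I\<^esub> X = \<zero>\<^bsub>A Quot I\<^esub>"
        by (intro bexI[of _ "\<ominus>\<^bsub>A Quot I\<^esub> X"]) (simp_all add: q.l_neg)
    qed (simp_all add: q.a_ac)
    show "monoid R"
      by (rule monoidI; unfold c z m) (simp_all add: q.m_assoc)
  qed (simp_all only: c z m q.l_distr q.r_distr)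
qed

lemma field_algebra_R: "field_algebra R"
proof (intro field_algebra.intro field_algebra_axioms.intro ring_R)
  fix X Y :: "(('v, 'a) qpath \<Rightarrow>\<^sub>0 'k) set" and c d :: 'k
  assume "X \<in> carrier R"
  then obtain f where f: "f \<in> carrier A" "X = cls f" by auto
  show "c \<odot>\<^bsub>R\<^esub> X \<in> carrier R"
    unfolding f(2) cls_smult using A_smult_closed[OF f(1), of c] by simp
  show "(c + d) \<odot>\<^bsub>R\<^esub> X = c \<odot>\<^bsub>R\<^esub> X \<oplus>\<^bsub>R\<^esub> d \<odot>\<^bsub>R\<^esub> X"
    unfolding f(2) cls_smult using f(1) by (simp only: cls_add A_smult_closed pa_smult_add_left)
  show "c \<odot>\<^bsub>R\<^esub> (d \<odot>\<^bsub>R\<^esub> X) = (c * d) \<odot>\<^bsub>R\<^esub> X"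
    unfolding f(2) cls_smult pa_smult_pa_smult ..
  show "1 \<odot>\<^bsub>R\<^esub> X = X" unfolding f(2) cls_smult pa_smult_one ..
  assume "Y \<in> carrier R"
  then obtain g where g: "g \<in> carrier A" "Y = cls g" by auto
  show "c \<odot>\<^bsub>R\<^esub> (X \<oplus>\<^bsub>R\<^esub> Y) = c \<odot>\<^bsub>R\<^esub> X \<oplus>\<^bsub>R\<^esub> c \<odot>\<^bsub>R\<^esub> Y"
    unfolding f(2) g(2) using f(1) g(1) by (simp only: cls_smult cls_add A_smult_closed pa_smult_add)
  show "(c \<odot>\<^bsub>R\<^esub> X) \<otimes>\<^bsub>R\<^esub> Y = c \<odot>\<^bsub>R\<^esub> (X \<otimes>\<^bsub>R\<^esub> Y)"
    unfolding f(2) g(2) using f(1) g(1) by (simp only: cls_smult cls_mult A_smult_closed pa_smult_mult)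
  show "X \<otimes>\<^bsub>R\<^esub> (c \<odot>\<^bsub>R\<^esub> Y) = c \<odot>\<^bsub>R\<^esub> (X \<otimes>\<^bsub>R\<^esub> Y)"
    unfolding f(2) g(2) using f(1) g(1) by (simp only: cls_smult cls_mult A_smult_closed pa_mult_smult)
qed

lemma cls_sum:
  assumes "finite X" "\<And>x. x \<in> X \<Longrightarrow> f x \<in> carrier A"
  shows "cls (\<Sum>x\<in>X. f x) = (\<Oplus>\<^bsub>R\<^esub>x\<in>X. cls (f x))"
proof -
  interpret R: ring R by (rule ring_R)
  have "(\<Sum>x\<in>X. f x) \<in> carrier A \<and> cls (\<Sum>x\<in>X. f x) = (\<Oplus>\<^bsub>R\<^esub>x\<in>X. cls (f x))"
    using assms
  proof (induction X)
    case empty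
    then show ?case using cls_zero by simp
  next
    case (insert a X)
    have c: "cls (f x) \<in> carrier R" if "x \<in> insert a X" for x
      using insert.prems[OF that] by simp
    have fa: "f a \<in> carrier A" using insert.prems by blast
    have IH: "(\<Sum>x\<in>X. f x) \<in> carrier A" "cls (\<Sum>x\<in>X. f x) = (\<Oplus>\<^bsub>R\<^esub>x\<in>X. cls (f x))"
      using insert by blast+
    have "(\<Oplus>\<^bsub>R\<^esub>x\<in>insert a X. cls (f x)) = cls (f a) \<oplus>\<^bsub>R\<^esub> (\<Oplus>\<^bsub>R\<^esub>x\<in>X. cls (f x))"
      by (rule R.finsum_insert) (use insert c in auto)
    also have "\<dots> = cls (f a + (\<Sum>x\<in>X. f x))"
      unfolding IH(2)[symmetric] by (rule cls_add[OF fa IH(1)])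
    finally show ?case using insert.hyps A_add_closed[OF fa IH(1)] by simp
  qed
  then show ?thesis by blast
qed

abbreviation "\<gamma> \<equiv> path_class Q I"

definition J :: "(('v, 'a) qpath \<Rightarrow>\<^sub>0 'k) set set" where
  "J = cls ` long_paths Q 1"

lemma path_class_eq: "\<gamma> u = cls (Poly_Mapping.single u 1)"
  by (simp add: path_class_def)

lemma single_in_carrier: "u \<in> paths Q \<Longrightarrow> Poly_Mapping.single u c \<in> carrier A"
  by simp

lemma cls_closed: "f \<in> carrier A \<Longrightarrow> cls f \<in> carrier R"
  unfolding bound_quiver_algebra_simps by (rule imageI)

lemma long_paths_cls_eq:
  fixes f g :: "('v, 'a) qpath \<Rightarrow>\<^sub>0 'k"
  shows "f \<in> long_paths Q n \<Longrightarrow> n \<le> 2 \<Longrightarrow> cls g = cls f \<Longrightarrow> g \<in> long_paths Q n"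
  using long_paths_antimono[of n 2 Q] I_long_paths long_paths_add[of "g - f" Q n f]
  by (auto simp: cls_eq_iff)

lemma quiver_algebra_R: "quiver_algebra R Q \<gamma> J"
proof (intro quiver_algebra.intro quiver_algebra_axioms.intro field_algebra_R wf finite_verts)
  show "\<gamma> u \<in> carrier R" if "u \<in> paths Q" for u
    unfolding path_class_eq by (intro cls_closed single_in_carrier that)
  show "\<gamma> (x, p, y) \<otimes>\<^bsub>R\<^esub> \<gamma> (y', q, z) = (if y = y' then \<gamma> (x, p @ q, z) else \<zero>\<^bsub>R\<^esub>)"
    if "(x, p, y) \<in> paths Q" "(y', q, z) \<in> paths Q" for x p y y' q z
  proof -
    have "\<gamma> (x, p, y) \<otimes>\<^bsub>R\<^esub> \<gamma> (y', q, z) = cls (path_mult (x, p, y) (y', q, z))"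
      unfolding path_class_eq
      by (subst cls_mult) (use that single_in_carrier in \<open>auto simp: pa_mult_single\<close>)
    then show ?thesis by (simp add: path_class_eq cls_zero)
  qed
  show "\<one>\<^bsub>R\<^esub> = (\<Oplus>\<^bsub>R\<^esub>x\<in>verts Q. \<gamma> (stationary x))"
    unfolding path_class_eq
    by (subst cls_sum[symmetric]) (use finite_verts stationary_in_paths single_in_carrier in auto)
  have "0 \<in> (long_paths Q 1 :: (_ \<Rightarrow>\<^sub>0 'k) set)" by (simp add: long_paths_def)
  then show "\<zero>\<^bsub>R\<^esub> \<in> J" unfolding J_def using cls_zero by fastforce
  show "X \<otimes>\<^bsub>R\<^esub> Y \<in> J" if XY: "X \<in> J" "Y \<in> J" for X Y
  proof -
    obtain f g where f: "f \<in> long_paths Q 1" "X = cls f" and g: "g \<in> long_paths Q 1" "Y = cls g"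
      using XY by (auto simp: J_def)
    have "X \<otimes>\<^bsub>R\<^esub> Y = cls (pa_mult f g)"
      unfolding f(2) g(2) by (rule cls_mult) (use f g in \<open>auto simp: long_paths_def\<close>)
    moreover have "pa_mult f g \<in> long_paths Q 1"
      using long_paths_mult[OF f(1) g(1)] long_paths_antimono[of 1 "1 + 1" Q] by auto
    ultimately show ?thesis by (simp add: J_def)
  qed
  show "c \<odot>\<^bsub>R\<^esub> X \<in> J" if X: "X \<in> J" for X c
  proof -
    obtain f where f: "f \<in> long_paths Q 1" "X = cls f" using X by (auto simp: J_def)
    then have "pa_smult c f \<in> long_paths Q 1" using keys_pa_smult[of c f] by (auto simp: long_paths_def)
    then show ?thesis unfolding f(2) cls_smult J_def by blast
  qed
  show "\<gamma> (x, p, y) \<in> J" if "(x, p, y) \<in> paths Q" "p \<noteq> []" for x p y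
    unfolding J_def path_class_eq
    by (rule imageI) (use that in \<open>auto simp: long_paths_def Suc_le_eq\<close>)
  show "\<gamma> (stationary x) \<notin> J" if "x \<in> verts Q" for x
  proof
    assume "\<gamma> (stationary x) \<in> J"
    then obtain f where f: "f \<in> long_paths Q 1" "cls (Poly_Mapping.single (stationary x) 1) = cls f"
      by (auto simp: J_def path_class_eq)
    have "Poly_Mapping.single (stationary x) (1 :: 'k) \<in> long_paths Q 1"
      using long_paths_cls_eq[OF f(1) _ f(2)] by simp
    then show False by (simp add: long_paths_def stationary_def)
  qed
  show "\<gamma> (arrow_path Q \<alpha>) \<noteq> \<zero>\<^bsub>R\<^esub>" if "\<alpha> \<in> arcs Q" for \<alpha>
  proof
    assume "\<gamma> (arrow_path Q \<alpha>) = \<zero>\<^bsub>R\<^esub>"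
    then have "cls (Poly_Mapping.single (arrow_path Q \<alpha>) 1) = cls 0" by (simp add: path_class_eq cls_zero)
    then have "Poly_Mapping.single (arrow_path Q \<alpha>) (1 :: 'k) \<in> long_paths Q 2"
      by (rule long_paths_cls_eq[rotated 2]) (simp_all add: long_paths_def)
    then show False by (simp add: long_paths_def arrow_path_def)
  qed
qed

sublocale R: quiver_algebra R Q \<gamma> J by (rule quiver_algebra_R)

lemma cls_in_path_span:
  assumes T: "T \<subseteq> verts Q" and "finite X" "Poly_Mapping.keys f \<subseteq> X" "X \<subseteq> paths (induce_subgraph Q T)"
  shows "cls f \<in> R.path_span T"
  using assms(2-)
proof (induction X arbitrary: f)
  case empty
  then show ?case using R.path_span.zero[of T] cls_zero by simp
next
  case (insert u X)
  let ?g = "f - Poly_Mapping.single u (Poly_Mapping.lookup f u)"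
  have u: "u \<in> paths (induce_subgraph Q T)" using insert.prems by blast
  have "Poly_Mapping.keys ?g \<subseteq> X"
  proof
    fix w assume "w \<in> Poly_Mapping.keys ?g"
    then have "w \<noteq> u" "w \<in> Poly_Mapping.keys f"
      by (auto simp: in_keys_iff lookup_minus lookup_single when_def split: if_splits)
    then show "w \<in> X" using insert.prems by blast
  qed
  moreover from this have "?g \<in> carrier A" using insert.prems paths_induce_subset[OF T] by auto
  moreover have "Poly_Mapping.single u (Poly_Mapping.lookup f u) \<in> carrier A"
    using u paths_induce_subset[OF T] single_in_carrier by blast
  ultimately have "cls (Poly_Mapping.single u (Poly_Mapping.lookup f u)) \<oplus>\<^bsub>R\<^esub> cls ?g = cls f"
    "cls ?g \<in> R.path_span T"
    using cls_add[of "Poly_Mapping.single u (Poly_Mapping.lookup f u)" ?g] insert.IH insert.prems by auto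
  moreover have "cls (Poly_Mapping.single u (Poly_Mapping.lookup f u)) = Poly_Mapping.lookup f u \<odot>\<^bsub>R\<^esub> \<gamma> u"
    unfolding path_class_eq cls_smult by (simp add: pa_smult_single)
  ultimately show ?case using R.path_span.add[OF u] by metis
qed

lemma corner_path_span:
  assumes T: "T \<subseteq> verts Q" and "corner_is_bound_quiver_algebra Q I T e"
  shows "peirce R e e \<subseteq> R.path_span T"
proof
  fix X assume "X \<in> peirce R e e"
  then have "X \<in> carrier (corner R e)" by (simp add: corner_def)
  moreover have "(\<lambda>X. set_add A I X) ` carrier (bound_quiver_algebra (induce_subgraph Q T) (restricted_ideal Q I T))
      = carrier (corner R e)"
    using assms(2) unfolding corner_is_bound_quiver_algebra_def ring_iso_def bij_betw_def by blast
  ultimately have "X \<in> (\<lambda>X. set_add A I X) ` carrier (bound_quiver_algebra (induce_subgraph Q T) (restricted_ideal Q I T))"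
    by simp
  then obtain f where f: "Poly_Mapping.keys f \<subseteq> paths (induce_subgraph Q T)"
    "X = set_add A I (restricted_ideal Q I T +>\<^bsub>path_algebra (induce_subgraph Q T)\<^esub> f)"
    unfolding bound_quiver_algebra_simps path_algebra_simps by blast
  have "X = cls f"
    unfolding f(2) set_add_path_algebra coset_path_algebra
  proof (intro equalityI subsetI)
    fix g assume "g \<in> (\<Union>h\<in>I. (+) h ` (\<lambda>h. h + f) ` restricted_ideal Q I T)"
    then obtain h h' where "h \<in> I" "h' \<in> I" "g = (h + h') + f"
      by (auto simp: restricted_ideal_def add.assoc)
    then show "g \<in> (\<lambda>h. h + f) ` I" using I_add by blast
  next
    fix g assume "g \<in> (\<lambda>h. h + f) ` I"
    then obtain h where "h \<in> I" "g = h + (0 + f)" by auto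
    moreover have "0 \<in> restricted_ideal Q I T" using I_zero by (simp add: restricted_ideal_def)
    ultimately show "g \<in> (\<Union>h\<in>I. (+) h ` (\<lambda>h. h + f) ` restricted_ideal Q I T)" by blast
  qed
  then show "X \<in> R.path_span T"
    using cls_in_path_span[OF T finite_keys order_refl f(1)] by simp
qed

end

section \<open>Rescaling a basis on a corner\<close>

context quiver_algebra
begin

lemma rescaled_basis:
  assumes B: "quiver_basis R Q \<gamma> J T B" and D: "quiver_basis R Q \<gamma> J S D" and "S \<subseteq> T"
    and gen: "peirce R (E S) (E S) \<subseteq> path_span S"
    and B': "B' = D \<union> (B - peirce R (E S) (E S))"
  shows "quiver_basis R Q \<gamma> J T B'"
    and "\<exists>c. (\<forall>\<sigma>\<in>B. c \<sigma> \<noteq> 0) \<and> B' = (\<lambda>\<sigma>. c \<sigma> \<odot> \<sigma>) ` B"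
    and "B' \<inter> peirce R (E S) (E S) = D"
proof -
  let ?C = "peirce R (E S) (E S)"
  interpret B: quiver_basis R Q \<gamma> J T B by fact
  interpret D: quiver_basis R Q \<gamma> J S D by fact
  have BC: "quiver_basis R Q \<gamma> J S (B \<inter> ?C)"
    using B.semi_normed_on_restrict[OF \<open>S \<subseteq> T\<close>] D.T
    by (intro quiver_basis.intro quiver_basis_axioms.intro quiver_algebra_axioms)
  have DC: "D \<subseteq> ?C" using D.B_in_corner by blast
  show "B' \<inter> ?C = D" using B' DC by blast
  have "\<exists>c. c \<noteq> 0 \<and> (\<sigma> \<in> ?C \<longrightarrow> c \<odot> \<sigma> \<in> D) \<and> (\<sigma> \<notin> ?C \<longrightarrow> c = 1)" if "\<sigma> \<in> B" for \<sigma>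
    using bases_proportional[OF BC D gen, of \<sigma>] that zero_neq_one by (cases "\<sigma> \<in> ?C") auto
  then obtain c where c: "\<And>\<sigma>. \<sigma> \<in> B \<Longrightarrow> c \<sigma> \<noteq> 0" "\<And>\<sigma>. \<sigma> \<in> B \<Longrightarrow> \<sigma> \<in> ?C \<Longrightarrow> c \<sigma> \<odot> \<sigma> \<in> D"
    "\<And>\<sigma>. \<sigma> \<in> B \<Longrightarrow> \<sigma> \<notin> ?C \<Longrightarrow> c \<sigma> = 1"
    by metis
  have out: "c \<sigma> \<odot> \<sigma> = \<sigma>" if "\<sigma> \<in> B" "\<sigma> \<notin> ?C" for \<sigma>
    using c(3)[OF that] B.B_closed[OF that(1)] by simp
  have image: "B' = (\<lambda>\<sigma>. c \<sigma> \<odot> \<sigma>) ` B"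
  proof (intro equalityI subsetI)
    fix b assume "b \<in> B'"
    then consider "b \<in> D" | "b \<in> B" "b \<notin> ?C" using B' by blast
    then show "b \<in> (\<lambda>\<sigma>. c \<sigma> \<odot> \<sigma>) ` B"
    proof cases
      case 1
      obtain d where d: "d \<noteq> 0" "d \<odot> b \<in> B \<inter> ?C"
        using bases_proportional[OF D BC gen 1] by blast
      define b' where "b' = c (d \<odot> b) \<odot> (d \<odot> b)"
      have b': "b' \<in> D" unfolding b'_def using c(2) d by blast
      have "(c (d \<odot> b) * d) \<odot> b = 1 \<odot> b'"
        using D.B_closed[OF 1] by (simp add: b'_def smult_smult)
      moreover have "c (d \<odot> b) * d \<noteq> 0" using c(1) d by auto
      ultimately have "b = b'" by (rule D.B_multiples[OF 1 b'])
      then show ?thesis using d(2) unfolding b'_def by blast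
    next
      case 2
      show ?thesis by (rule image_eqI[where f = "\<lambda>\<sigma>. c \<sigma> \<odot> \<sigma>" and x = b, OF out[OF 2, symmetric] 2(1)])
    qed
  next
    fix b assume "b \<in> (\<lambda>\<sigma>. c \<sigma> \<odot> \<sigma>) ` B"
    then obtain \<sigma> where "\<sigma> \<in> B" "b = c \<sigma> \<odot> \<sigma>" by blast
    then show "b \<in> B'" using c(2) out B' by (cases "\<sigma> \<in> ?C") auto
  qed
  then show "\<exists>c. (\<forall>\<sigma>\<in>B. c \<sigma> \<noteq> 0) \<and> B' = (\<lambda>\<sigma>. c \<sigma> \<odot> \<sigma>) ` B" using c(1) by blast
  have in_P: "b \<in> ?C \<longleftrightarrow> x \<in> S \<and> y \<in> S" if "x \<in> T" "y \<in> T" "b \<in> P x y" "b \<noteq> \<zero>" for b x y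
    using P_in_corner_iff[OF D.T _ _ that(3,4)] that B.T by auto
  have PT: "P x y \<subseteq> ?C" if "x \<in> S" "y \<in> S" for x y using P_subset_corner[OF D.T that] .
  have "semi_normed_on T B'"
    unfolding semi_normed_on_def
  proof (intro conjI ballI)
    show "B' \<subseteq> (\<Union>x\<in>T. \<Union>y\<in>T. P x y)"
    proof
      fix b assume "b \<in> B'"
      then have "b \<in> D \<or> b \<in> B" using B' by blast
      then show "b \<in> (\<Union>x\<in>T. \<Union>y\<in>T. P x y)"
        using D.endpoints_exist[of b] B.endpoints_exist[of b] \<open>S \<subseteq> T\<close> by blast
    qed
  next
    fix x y assume xy: "x \<in> T" "y \<in> T"
    show "k_basis R (P x y) (B' \<inter> P x y)"
    proof (cases "x \<in> S \<and> y \<in> S")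
      case True
      then have "B' \<inter> P x y = D \<inter> P x y" using B' PT by blast
      then show ?thesis using D.k_basis_P True by simp
    next
      case False
      have "b \<notin> ?C" if "b \<in> B \<or> b \<in> D" "b \<in> P x y" for b
        using in_P[OF xy that(2)] that(1) B.B_nonzero D.B_nonzero False by blast
      then have "B' \<inter> P x y = B \<inter> P x y" using B' DC by blast
      then show ?thesis using B.k_basis_P xy by simp
    qed
  next
    fix x assume x: "x \<in> T"
    then have e: "\<epsilon> x \<in> P x x" "\<epsilon> x \<noteq> \<zero>" using idem_in_P idem_nonzero B.T by auto
    show "\<epsilon> x \<in> B'"
      using in_P[OF x x e] B' B.B D.B x by (auto simp: semi_normed_on_def)
  next
    fix a assume a: "a \<in> {a \<in> arcs Q. tail Q a \<in> T \<and> head Q a \<in> T}"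
    then have aP: "\<gamma> (arrow_path Q a) \<in> P (tail Q a) (head Q a)"
      using path_in_P arrow_path_in_paths[of a] B.T by (auto simp: arrow_path_def)
    show "\<gamma> (arrow_path Q a) \<in> B'"
      using in_P[OF _ _ aP] arrow_nonzero a B' B.B D.B by (auto simp: semi_normed_on_def)
  next
    fix b b' assume "b \<in> B'" "b' \<in> B'"
    then obtain \<sigma> \<sigma>' where \<sigma>: "\<sigma> \<in> B" "b = c \<sigma> \<odot> \<sigma>" "\<sigma>' \<in> B" "b' = c \<sigma>' \<odot> \<sigma>'"
      using image by blast
    have cl: "\<sigma> \<in> carrier R" "\<sigma>' \<in> carrier R" using B.B_closed \<sigma> by auto
    have bb: "b \<otimes> b' = (c \<sigma> * c \<sigma>') \<odot> (\<sigma> \<otimes> \<sigma>')"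
      using cl unfolding \<sigma>(2,4) by (simp add: smult_mult mult_smult smult_smult mult.commute)
    show "b \<otimes> b' = \<zero> \<or> (\<exists>d b''. d \<noteq> 0 \<and> b'' \<in> B' \<and> b \<otimes> b' = d \<odot> b'')"
    proof (cases "\<sigma> \<otimes> \<sigma>' = \<zero>")
      case False
      obtain d where d: "B.m \<sigma> \<sigma>' \<in> B" "d \<noteq> 0" "\<sigma> \<otimes> \<sigma>' = d \<odot> B.m \<sigma> \<sigma>'"
        using B.basis_product[OF \<sigma>(1,3) False] by blast
      let ?\<tau> = "B.m \<sigma> \<sigma>'"
      have "c \<sigma> * c \<sigma>' * d * inverse (c ?\<tau>) * c ?\<tau> = c \<sigma> * c \<sigma>' * d"
        using c(1)[OF d(1)] by simp
      then have "b \<otimes> b' = (c \<sigma> * c \<sigma>' * d * inverse (c ?\<tau>)) \<odot> (c ?\<tau> \<odot> ?\<tau>)"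
        unfolding bb d(3) using B.B_closed[OF d(1)] by (simp only: smult_smult)
      moreover have "c \<sigma> * c \<sigma>' * d * inverse (c ?\<tau>) \<noteq> 0" using c(1) \<sigma> d by simp
      moreover have "c ?\<tau> \<odot> ?\<tau> \<in> B'" using image d(1) by blast
      ultimately show ?thesis by blast
    qed (use bb in simp)
  qed
  then show "quiver_basis R Q \<gamma> J T B'"
    using B.T by (intro quiver_basis.intro quiver_basis_axioms.intro quiver_algebra_axioms)
qed

end

theorem proposition4p2:
  fixes Q :: "('v, 'a) pre_digraph"
    and I :: "(('v, 'a) qpath \<Rightarrow>\<^sub>0 'k::field) set"
  assumes bq: "bound_quiver Q I"
    and R: "R = bound_quiver_algebra Q I"
    and \<gamma>: "\<gamma> = path_class Q I"
    and verts: "S \<subseteq> verts Q" "S1' \<subseteq> verts Q" "S2' \<subseteq> verts Q"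
    and e: "e = (\<Oplus>\<^bsub>R\<^esub>x\<in>S. \<gamma> (stationary x))"
    and e1': "e1' = (\<Oplus>\<^bsub>R\<^esub>x\<in>S1'. \<gamma> (stationary x))"
    and e2': "e2' = (\<Oplus>\<^bsub>R\<^esub>x\<in>S2'. \<gamma> (stationary x))"
    and orth: "orthogonal_elems R e e1'" "orthogonal_elems R e e2'" "orthogonal_elems R e1' e2'"
    and unit: "\<one>\<^bsub>R\<^esub> = e1' \<oplus>\<^bsub>R\<^esub> e \<oplus>\<^bsub>R\<^esub> e2'"
    and zero: "peirce R e1' e2' = {\<zero>\<^bsub>R\<^esub>}" "peirce R e2' e1' = {\<zero>\<^bsub>R\<^esub>}"
    and e1: "e1 = e1' \<oplus>\<^bsub>R\<^esub> e" and e2: "e2 = e2' \<oplus>\<^bsub>R\<^esub> e"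
    and A1: "A1 = corner R e1" and A2: "A2 = corner R e2" and C: "C = corner R e"
    and Q1: "Q1 = induce_subgraph Q (S1' \<union> S)"
    and Q2: "Q2 = induce_subgraph Q (S2' \<union> S)"
    and QC: "QC = induce_subgraph Q S"
    and A1_eq: "corner_is_bound_quiver_algebra Q I (S1' \<union> S) e1"
    and A2_eq: "corner_is_bound_quiver_algebra Q I (S2' \<union> S) e2"
    and C_eq: "corner_is_bound_quiver_algebra Q I S e"
    and B1: "semi_normed_basis A1 Q1 \<gamma> B1"
    and B2: "semi_normed_basis A2 Q2 \<gamma> B2"
  shows "\<exists>B2'. semi_normed_basis A2 Q2 \<gamma> B2' \<and> rescaling A2 B2 B2' \<and>
           (B1 \<inter> carrier C = B2 \<inter> carrier C \<longrightarrow> B2' = B2) \<and>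
           semi_normed_basis R Q \<gamma> (B1 \<union> B2') \<and>
           semi_normed_basis C QC \<gamma> (B1 \<inter> B2') \<and>
           (\<forall>G :: 'g monoid. comm_group G \<longrightarrow>
              long_exact_sequence
                (SH R Q \<gamma> (B1 \<union> B2') G)
                (\<lambda>n. SH A1 Q1 \<gamma> B1 G n \<times>\<times> SH A2 Q2 \<gamma> B2' G n)
                (SH C QC \<gamma> (B1 \<inter> B2') G))"
proof -
  note peirce_zero = zero
  have bqi: "bound_quiver_ideal Q I" by (rule bound_quiver_ideal.intro[OF bq])
  define J where "J = bound_quiver_ideal.J Q I"
  interpret quiver_algebra R Q \<gamma> J
    unfolding J_def R \<gamma> by (rule bound_quiver_ideal.quiver_algebra_R[OF bqi])
  define C' where "C' = peirce R (E S) (E S)"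
  have e_eq: "e = E S" "e1' = E S1'" "e2' = E S2'"
    unfolding e e1' e2' E_def by simp_all
  have disjoint: "S1' \<inter> S = {}" "S2' \<inter> S = {}" "S1' \<inter> S2' = {}"
  proof -
    have "T \<inter> U = {}" if "T \<subseteq> verts Q" "U \<subseteq> verts Q" "E T \<otimes>\<^bsub>R\<^esub> E U = \<zero>\<^bsub>R\<^esub>" for T U
    proof -
      have "T \<inter> U \<subseteq> verts Q" using that by blast
      then show ?thesis using that E_mult[OF that(1,2)] E_eq_zero_iff by simp
    qed
    then show "S1' \<inter> S = {}" "S2' \<inter> S = {}" "S1' \<inter> S2' = {}"
      using orth verts by (simp_all add: orthogonal_elems_def e_eq)
  qed
  have e1_eq: "e1 = E (S1' \<union> S)" and e2_eq: "e2 = E (S2' \<union> S)"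
    unfolding e1 e2 e_eq using E_Un_disjoint verts disjoint by simp_all
  have all: "S1' \<union> S \<union> S2' = verts Q"
  proof -
    have "E (S1' \<union> S \<union> S2') = E (S1' \<union> S) \<oplus>\<^bsub>R\<^esub> E S2'"
      by (rule E_Un_disjoint[symmetric]) (use verts disjoint in auto)
    also have "\<dots> = \<one>\<^bsub>R\<^esub>"
      using unit by (simp add: e_eq flip: e1_eq) (simp add: e1 e_eq)
    finally show ?thesis using E_eq_one_iff[of "S1' \<union> S \<union> S2'"] verts by simp
  qed
  have P_zero: "P x y = {\<zero>\<^bsub>R\<^esub>}"
    if "T \<subseteq> verts Q" "U \<subseteq> verts Q" "peirce R (E T) (E U) = {\<zero>\<^bsub>R\<^esub>}" "x \<in> T" "y \<in> U" for T U x y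
  proof -
    have xy: "x \<in> verts Q" "y \<in> verts Q" using that by auto
    have "a = \<zero>\<^bsub>R\<^esub>" if a: "a \<in> P x y" for a
    proof -
      have "a = E T \<otimes>\<^bsub>R\<^esub> a \<otimes>\<^bsub>R\<^esub> E U" "a \<in> carrier R"
        using E_mult_P[OF _ xy a] \<open>T \<subseteq> verts Q\<close> \<open>U \<subseteq> verts Q\<close> \<open>x \<in> T\<close> \<open>y \<in> U\<close> a P_iff[OF xy]
        by simp_all
      then have "a \<in> peirce R (E T) (E U)" unfolding peirce_def by blast
      then show ?thesis using \<open>peirce R (E T) (E U) = {\<zero>\<^bsub>R\<^esub>}\<close> by blast
    qed
    moreover have "\<zero>\<^bsub>R\<^esub> \<in> P x y" using xy by (simp add: P_iff)
    ultimately show ?thesis by blast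
  qed
  have basis: "quiver_basis R Q \<gamma> J T B"
    if "T \<subseteq> verts Q" "semi_normed_basis (corner R (E T)) (induce_subgraph Q T) \<gamma> B" for T B
    using that semi_normed_basis_corner_iff[OF that(1)]
    by (intro quiver_basis.intro quiver_basis_axioms.intro quiver_algebra_axioms) simp_all
  have semi_normed: "semi_normed_basis (corner R (E T)) (induce_subgraph Q T) \<gamma> B"
    if "quiver_basis R Q \<gamma> J T B" for T B
    using quiver_basis.T[OF that] quiver_basis.B[OF that] semi_normed_basis_corner_iff
    by blast
  have sub: "S1' \<union> S \<subseteq> verts Q" "S2' \<union> S \<subseteq> verts Q" using verts by auto
  have b1: "quiver_basis R Q \<gamma> J (S1' \<union> S) B1" and b2: "quiver_basis R Q \<gamma> J (S2' \<union> S) B2"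
    using basis[OF sub(1)] basis[OF sub(2)] B1 B2 unfolding A1 A2 Q1 Q2 e1_eq e2_eq by blast+
  have gen: "peirce R (E T) (E T) \<subseteq> path_span T"
    if "T \<subseteq> verts Q" "corner_is_bound_quiver_algebra Q I T (E T)" for T
    using bound_quiver_ideal.corner_path_span[OF bqi that] unfolding R \<gamma> .
  have gen1: "peirce R (E (S1' \<union> S)) (E (S1' \<union> S)) \<subseteq> path_span (S1' \<union> S)"
    and gen2: "peirce R (E (S2' \<union> S)) (E (S2' \<union> S)) \<subseteq> path_span (S2' \<union> S)"
    and genS: "peirce R (E S) (E S) \<subseteq> path_span S"
    using gen[OF sub(1)] gen[OF sub(2)] gen[OF verts(1)] A1_eq A2_eq C_eq
    unfolding e1_eq e2_eq e_eq by blast+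
  have bC: "quiver_basis R Q \<gamma> J S (B1 \<inter> C')"
    using quiver_basis.semi_normed_on_restrict[OF b1, of S] verts(1)
    unfolding C'_def by (intro quiver_basis.intro quiver_basis_axioms.intro quiver_algebra_axioms) auto
  define B2' where "B2' = (B1 \<inter> C') \<union> (B2 - C')"
  have b2': "quiver_basis R Q \<gamma> J (S2' \<union> S) B2'"
    and scale: "\<exists>c. (\<forall>\<sigma>\<in>B2. c \<sigma> \<noteq> 0) \<and> B2' = (\<lambda>\<sigma>. c \<sigma> \<odot>\<^bsub>R\<^esub> \<sigma>) ` B2"
    and B2'_C: "B2' \<inter> C' = B1 \<inter> C'"
    using rescaled_basis[of "S2' \<union> S" B2 S "B1 \<inter> C'" B2'] b2 bC genS
    unfolding B2'_def C'_def by blast+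
  have g: "gluing R Q \<gamma> J S S1' S2' B1 B2'"
  proof (intro gluing.intro gluing_axioms.intro quiver_algebra_axioms b1 b2' disjoint all)
    show "B1 \<inter> peirce R (E S) (E S) = B2' \<inter> peirce R (E S) (E S)"
      using B2'_C unfolding C'_def by simp
    show "P x y = {\<zero>\<^bsub>R\<^esub>}" if "x \<in> S1'" "y \<in> S2'" for x y
      using P_zero[OF verts(2,3) _ that] peirce_zero(1) unfolding e_eq .
    show "P x y = {\<zero>\<^bsub>R\<^esub>}" if "x \<in> S2'" "y \<in> S1'" for x y
      using P_zero[OF verts(3,2) _ that] peirce_zero(2) unfolding e_eq .
  qed
  have "semi_normed_basis A2 Q2 \<gamma> B2'"
    using semi_normed[OF b2'] unfolding A2 Q2 e2_eq .
  moreover have "rescaling A2 B2 B2'"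
    using scale unfolding rescaling_def A2 by (simp add: corner_def)
  moreover have "B1 \<inter> carrier C = B2 \<inter> carrier C \<longrightarrow> B2' = B2"
    unfolding B2'_def C'_def C e_eq by (auto simp: corner_def)
  moreover have "semi_normed_basis R Q \<gamma> (B1 \<union> B2')"
    using semi_normed[OF gluing.basis_Un[OF g]] corner_verts induce_verts by simp
  moreover have "semi_normed_basis C QC \<gamma> (B1 \<inter> B2')"
    using semi_normed[OF gluing.basis_Int[OF g]] unfolding C QC e_eq .
  moreover have "long_exact_sequence (SH R Q \<gamma> (B1 \<union> B2') G)
      (\<lambda>n. SH A1 Q1 \<gamma> B1 G n \<times>\<times> SH A2 Q2 \<gamma> B2' G n) (SH C QC \<gamma> (B1 \<inter> B2') G)"
    if "comm_group G" for G :: "'g monoid"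
    using gluing.long_exact_sequence[OF g _ _ that] gen1 gen2
    unfolding A1 A2 C Q1 Q2 QC e1_eq e2_eq e_eq by blast
  ultimately show ?thesis by blast
qed

end
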